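(* Let $\mathcal U$ be either $\mathcal U_{ad}$ (unconstrained controls) or $\mathcal U^c_{ad}$ (controls with values in $\mathbb R^m_+$). If there exists a relaxed compensator $K_{\cdot,\alpha_\cdot}\in\varUpsilon$, then Problem (SLQ-MRS) is well-posed, i.e. $V(\xi,i_0)=\inf_{u_\cdot\in\mathcal U}\mathcal J(\xi,i_0;u_\cdot)>-\infty$ for all $(\xi,i_0)\in\mathbb R^n\times\mathbb S$.
   Context: Setting. Fix $T>0$ and a complete filtered probability space carrying two independent processes: a one-dimensional Brownian motion $W$ and an irreducible homogeneous continuous-time Markov chain $\alpha$ with finite state space $\mathbb S=\{1,\dots,d\}$, fixed initial state $\alpha_0=i_0$ and generator $(\pi_{i,j})_{i,j=1}^d$ ($\pi_{i,j}\ge 0$ for $i\ne j$, $\pi_{i,i}=-\sum_{j\neq i}\pi_{i,j}$). $\mathbb F=\{\mathcal F_t\}$ is the filtration generated by $(\alpha,W)$ augmented by null sets. For $i\ne j$ let $M_{i,j}(t)=\sum_{0<s\le t}\mathcal X_{\{\alpha_{s-}=i\}}\mathcal X_{\{\alpha_s=j\}}$ ($\mathcal X$ = indicator) and $\widetilde M_{i,j}(t)=M_{i,j}(t)-\int_0^t\pi_{i,j}\mathcal X_{\{\alpha_{s-}=i\}}ds$. $\mathcal S^n$, $\mathcal S^n_+$, $\mathcal S^n_{++}$ denote symmetric, positive semi-definite, positive definite $n\times n$ matrices. $L^\infty(0,T;\mathscr H)$: uniformly bounded deterministic $\mathscr H$-valued functions; $L^2_{\mathbb F}(0,T;\mathscr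 H)$: $\mathbb F$-progressively measurable processes $g$ with $\mathbb E\int_0^T|g_t|^2dt<\infty$; $L^\infty_{\mathbb F}(0,T;\mathscr H)$: bounded $\mathbb F$-progressively measurable processes. A regime-dependent coefficient $F_{t,\alpha_t}$ equals $F_{t,i}$ when $\alpha_t=i$, $i\in\mathbb S$; "$F_{\cdot,\alpha_\cdot}\in L^\infty(0,T;\mathscr H)$" means $F_{\cdot,i}\in L^\infty(0,T;\mathscr H)$ for each $i$. State equation: $$dx_t=[A_{t,\alpha_t}x_t+B_{t,\alpha_t}u_t]dt+[C_{t,\alpha_t}x_t+D_{t,\alpha_t}u_t]dW_t,\ t\in[0,T],\quad x_0=\xi\in\mathbb R^n,\ \alpha_0=i_0,$$ with $A,C\in L^\infty(0,T;\mathbb R^{n\times n})$, $B,D\in L^\infty(0,T;\mathbb R^{n\times m})$. Cost: $$\mathcal J(\xi,i_0;u_\cdot)=\tfrac12\mathbb E\Big\{\int_0^T\begin{bmatrix}x_t\\ u_t\end{bmatrix}^\top\begin{bmatrix}Q_{t,\alpha_t}&S_{t,\alpha_t}\\S_{t,\alpha_t}^\top&R_{t,\alpha_t}\end{bmatrix}\begin{bmatrix}x_t\\ u_t\end{bmatrix}dt+x_T^\top G_{T,\alpha_T}x_T\,\Big|\,x_0=\xi,\alpha_0=i_0\Big\},$$ with $Q\in L^\infty(0,T;\mathcal S^n)$, $S\in L^\infty(0,T;\mathbb R^{n\times m})$, $R\in L^\infty(0,T;\mathcal S^m)$, $G_{T,i}\in\mathcal S^n$, all possibly indefinite. Admissible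 sets: $\mathcal U_{ad}=L^2_{\mathbb F}(0,T;\mathbb R^m)$ and $\mathcal U^c_{ad}=\{u_\cdot\in L^2_{\mathbb F}(0,T;\mathbb R^m): u_t\in\mathbb R^m_+\}$. Problem (SLQ-MRS): for given $(\xi,i_0)\in\mathbb R^n\times\mathbb S$, find $u^*\in\mathcal U$ with $\mathcal J(\xi,i_0;u^* )=\inf_{u\in\mathcal U}\mathcal J(\xi,i_0;u)=:V(\xi,i_0)$. Relaxed compensator. $\varUpsilon$ is the set of regime-indexed $K_{\cdot,\alpha_\cdot}\in L^\infty_{\mathbb F}(0,T;\mathcal S^n)$ of the form $$K_{t,\alpha_t}=K_{0,\alpha_0}+\int_0^t\Theta_{s,\alpha_s}ds+\int_0^t\sum_{i\neq j}\pi_{i,j}\mathcal X_{\{\alpha_{s-}=i\}}(K_{s,j}-K_{s,i})ds+\int_0^t\sum_{i\neq j}(K_{s,j}-K_{s,i})d\widetilde M_{i,j}(s)$$ with $\Theta_{\cdot,\alpha_\cdot}\in L^\infty(0,T;\mathcal S^n)$, $K_{0,\alpha_0}\in\mathcal S^n$. For $K\in\varUpsilon$ put $\mathcal Q^K_{t,\alpha_t}=Q_{t,\alpha_t}+\Theta_{t,\alpha_t}+K_{t,\alpha_t}A_{t,\alpha_t}+A_{t,\alpha_t}^\top K_{t,\alpha_t}+C_{t,\alpha_t}^\top K_{t,\alpha_t}C_{t,\alpha_t}+\sum_{j=1}^d\pi_{\alpha_{t-},j}(K_{t,j}-K_{t,\alpha_{t-}})$, $\mathcal S^K_{t,\alpha_t}=S_{t,\alpha_t}+K_{t,\alpha_t}B_{t,\alpha_t}+C_{t,\alpha_t}^\top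 K_{t,\alpha_t}D_{t,\alpha_t}$, $\mathcal R^K_{t,\alpha_t}=R_{t,\alpha_t}+D_{t,\alpha_t}^\top K_{t,\alpha_t}D_{t,\alpha_t}$, $\mathcal G^K_{T,\alpha_T}=G_{T,\alpha_T}-K_{T,\alpha_T}$. $K$ is a relaxed compensator if $\begin{bmatrix}\mathcal Q^K&\mathcal S^K\\(\mathcal S^K)^\top&\mathcal R^K\end{bmatrix}\in L^\infty(0,T;\mathcal S^{n+m}_+)$, $\mathcal G^K_{T,\alpha_T}\in\mathcal S^n_+$ and $\mathcal R^K\in L^\infty(0,T;\mathcal S^m_{++})$ (for every regime). *)

theory Defs
  imports "HOL-Probability.Probability"
begin

section \<open>Matrices\<close>

definition sym_mats :: "(real ^ 'n ^ 'n) set" where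
  "sym_mats = {P. transpose P = P}"

definition psd_mats :: "(real ^ 'n ^ 'n) set" where
  "psd_mats = {P \<in> sym_mats. \<forall>x. 0 \<le> x \<bullet> (P *v x)}"

definition pd_mats :: "(real ^ 'n ^ 'n) set" where
  "pd_mats = {P \<in> sym_mats. \<forall>x. x \<noteq> 0 \<longrightarrow> 0 < x \<bullet> (P *v x)}"

definition nonneg_orthant :: "(real ^ 'm) set" where
  "nonneg_orthant = {v. \<forall>i. 0 \<le> v $ i}"

text \<open>The block matrix with rows \<open>(P, L)\<close> and \<open>(transpose L, N)\<close>.\<close>

definition block_mat ::
  "real ^ 'n ^ 'n \<Rightarrow> real ^ 'm ^ 'n \<Rightarrow> real ^ 'm ^ 'm \<Rightarrow> real ^ ('n + 'm) ^ ('n + 'm)" where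
  "block_mat P L N = (\<chi> a b. case a of
      Inl i \<Rightarrow> (case b of Inl j \<Rightarrow> P $ i $ j | Inr j \<Rightarrow> L $ i $ j)
    | Inr i \<Rightarrow> (case b of Inl j \<Rightarrow> L $ j $ i | Inr j \<Rightarrow> N $ i $ j))"

definition stack :: "real ^ 'n \<Rightarrow> real ^ 'm \<Rightarrow> real ^ ('n + 'm)" where
  "stack x u = (\<chi> a. case a of Inl i \<Rightarrow> x $ i | Inr j \<Rightarrow> u $ j)"


section \<open>Brownian motion, Markov chain and their filtration\<close>

definition process_sigma ::
  "'w measure \<Rightarrow> 'a measure \<Rightarrow> (real \<Rightarrow> 'w \<Rightarrow> 'a) \<Rightarrow> real set \<Rightarrow> 'w measure" where
  "process_sigma M N X I =
     sigma (space M) {X s -` B \<inter> space M | s B. s \<in> I \<and> B \<in> sets N}"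

definition brownian_motion :: "'w measure \<Rightarrow> (real \<Rightarrow> 'w \<Rightarrow> real) \<Rightarrow> bool" where
  "brownian_motion M W \<longleftrightarrow>
     (\<forall>t\<ge>0. W t \<in> borel_measurable M) \<and>
     (\<forall>\<omega>\<in>space M. W 0 \<omega> = 0 \<and> continuous_on {0..} (\<lambda>t. W t \<omega>)) \<and>
     (\<forall>s t. 0 \<le> s \<and> s < t \<longrightarrow>
        distributed M lborel (\<lambda>\<omega>. W t \<omega> - W s \<omega>) (normal_density 0 (sqrt (t - s))) \<and>
        prob_space.indep_set M (sets (process_sigma M borel W {0..s}))
          (sets (vimage_algebra (space M) (\<lambda>\<omega>. W t \<omega> - W s \<omega>) borel)))"

definition generator_matrix :: "('d::finite \<Rightarrow> 'd \<Rightarrow> real) \<Rightarrow> bool" where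
  "generator_matrix \<pi> \<longleftrightarrow>
     (\<forall>i j. i \<noteq> j \<longrightarrow> 0 \<le> \<pi> i j) \<and> (\<forall>i. \<pi> i i = - (\<Sum>j\<in>UNIV - {i}. \<pi> i j))"

text \<open>\<open>p t i j\<close> is the probability of moving from \<open>i\<close> to \<open>j\<close> within time \<open>t\<close>;
  the generator is the derivative of the transition semigroup at time zero.\<close>

definition transition_function ::
  "('d::finite \<Rightarrow> 'd \<Rightarrow> real) \<Rightarrow> (real \<Rightarrow> 'd \<Rightarrow> 'd \<Rightarrow> real) \<Rightarrow> bool" where
  "transition_function \<pi> p \<longleftrightarrow>
     (\<forall>t\<ge>0. \<forall>i. (\<forall>j. 0 \<le> p t i j) \<and> (\<Sum>j\<in>UNIV. p t i j) = 1) \<and>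
     (\<forall>i j. p 0 i j = of_bool (i = j)) \<and>
     (\<forall>s\<ge>0. \<forall>t\<ge>0. \<forall>i j. p (s + t) i j = (\<Sum>k\<in>UNIV. p s i k * p t k j)) \<and>
     (\<forall>i j. ((\<lambda>h. (p h i j - of_bool (i = j)) / h) \<longlongrightarrow> \<pi> i j) (at_right 0))"

definition markov_chain ::
  "'w measure \<Rightarrow> (real \<Rightarrow> 'w \<Rightarrow> 'd::finite) \<Rightarrow> ('d \<Rightarrow> 'd \<Rightarrow> real) \<Rightarrow> 'd \<Rightarrow> bool" where
  "markov_chain M \<alpha> \<pi> i\<^sub>0 \<longleftrightarrow>
     generator_matrix \<pi> \<and>
     (\<forall>t\<ge>0. \<alpha> t \<in> measurable M (count_space UNIV)) \<and>
     (\<forall>\<omega>\<in>space M. \<alpha> 0 \<omega> = i\<^sub>0 \<and>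
        (\<forall>t\<ge>0. \<forall>\<^sub>F s in at_right t. \<alpha> s \<omega> = \<alpha> t \<omega>) \<and>
        (\<forall>t>0. \<exists>i. \<forall>\<^sub>F s in at_left t. \<alpha> s \<omega> = i)) \<and>
     (\<exists>p. transition_function \<pi> p \<and>
        (\<forall>i j. \<exists>t\<ge>0. 0 < p t i j) \<and>
        (\<forall>s\<ge>0. \<forall>t\<ge>0. \<forall>j. AE \<omega> in M.
           real_cond_exp M (process_sigma M (count_space UNIV) \<alpha> {0..s})
             (indicator {\<omega>'\<in>space M. \<alpha> (s + t) \<omega>' = j}) \<omega> = p t (\<alpha> s \<omega>) j))"

locale regime_switching_space = prob_space M + complete_measure M
  for M :: "'w measure" +
  fixes W :: "real \<Rightarrow> 'w \<Rightarrow> real"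
    and \<alpha> :: "real \<Rightarrow> 'w \<Rightarrow> 'd::finite"
    and \<pi> :: "'d \<Rightarrow> 'd \<Rightarrow> real"
    and i\<^sub>0 :: 'd
  assumes brownian: "brownian_motion M W"
    and chain: "markov_chain M \<alpha> \<pi> i\<^sub>0"
    and independent: "indep_set (sets (process_sigma M borel W {0..}))
      (sets (process_sigma M (count_space UNIV) \<alpha> {0..}))"

definition filtr ::
  "'w measure \<Rightarrow> (real \<Rightarrow> 'w \<Rightarrow> real) \<Rightarrow> (real \<Rightarrow> 'w \<Rightarrow> 'd) \<Rightarrow> real \<Rightarrow> 'w measure" where
  "filtr M W \<alpha> t = sigma (space M)
     (sets (process_sigma M borel W {0..t}) \<union>
      sets (process_sigma M (count_space UNIV) \<alpha> {0..t}) \<union> null_sets M)"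


section \<open>Spaces of functions and processes\<close>

text \<open>Membership in the value set and boundedness are required for almost every time, as is
  usual for Lebesgue spaces.\<close>

definition Linf :: "real \<Rightarrow> 'v::euclidean_space set \<Rightarrow> (real \<Rightarrow> 'v) set" where
  "Linf T H = {f. f \<in> borel_measurable (restrict_space borel {0..T}) \<and>
     (\<exists>c. AE t in lborel. t \<in> {0..T} \<longrightarrow> f t \<in> H \<and> norm (f t) \<le> c)}"

definition progressive ::
  "(real \<Rightarrow> 'w measure) \<Rightarrow> real \<Rightarrow> (real \<Rightarrow> 'w \<Rightarrow> 'v::euclidean_space) \<Rightarrow> bool" where
  "progressive F T g \<longleftrightarrow> (\<forall>t\<in>{0..T}.
     (\<lambda>(s, \<omega>). g s \<omega>) \<in> borel_measurable (restrict_space borel {0..t} \<Otimes>\<^sub>M F t))"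

definition Linf_F ::
  "'w measure \<Rightarrow> (real \<Rightarrow> 'w measure) \<Rightarrow> real \<Rightarrow> 'v::euclidean_space set \<Rightarrow> (real \<Rightarrow> 'w \<Rightarrow> 'v) set" where
  "Linf_F M F T H = {g. progressive F T g \<and>
     (\<exists>c. AE \<omega> in M. AE t in lborel. t \<in> {0..T} \<longrightarrow> g t \<omega> \<in> H \<and> norm (g t \<omega>) \<le> c)}"

definition L2_F ::
  "'w measure \<Rightarrow> (real \<Rightarrow> 'w measure) \<Rightarrow> real \<Rightarrow> 'v::euclidean_space set \<Rightarrow> (real \<Rightarrow> 'w \<Rightarrow> 'v) set" where
  "L2_F M F T H = {g. progressive F T g \<and>
     (AE \<omega> in M. AE t in lborel. t \<in> {0..T} \<longrightarrow> g t \<omega> \<in> H) \<and>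
     (\<integral>\<^sup>+\<omega>. (\<integral>\<^sup>+t\<in>{0..T}. ennreal ((norm (g t \<omega>))\<^sup>2) \<partial>lborel) \<partial>M) < \<infinity>}"


section \<open>Ito integral\<close>

text \<open>A simple process is \<open>\<Sum>k<N. \<eta> k * indicator {p k<..p (Suc k)}\<close> with bounded
  \<open>F (p k)\<close>-measurable \<open>\<eta> k\<close>.\<close>

definition is_simple ::
  "(real \<Rightarrow> 'w measure) \<Rightarrow> real \<Rightarrow> nat \<Rightarrow> (nat \<Rightarrow> real) \<Rightarrow> (nat \<Rightarrow> 'w \<Rightarrow> 'v::euclidean_space) \<Rightarrow> bool" where
  "is_simple F T N p \<eta> \<longleftrightarrow> (\<forall>k<N. 0 \<le> p k \<and> p k \<le> p (Suc k) \<and> p (Suc k) \<le> T \<and>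
     \<eta> k \<in> borel_measurable (F (p k)) \<and> (\<exists>c. \<forall>\<omega>\<in>space (F (p k)). norm (\<eta> k \<omega>) \<le> c))"

definition simple_process ::
  "nat \<Rightarrow> (nat \<Rightarrow> real) \<Rightarrow> (nat \<Rightarrow> 'w \<Rightarrow> 'v::euclidean_space) \<Rightarrow> real \<Rightarrow> 'w \<Rightarrow> 'v" where
  "simple_process N p \<eta> t \<omega> = (\<Sum>k<N. indicat_real {p k<..p (Suc k)} t *\<^sub>R \<eta> k \<omega>)"

definition simple_integral ::
  "(real \<Rightarrow> 'w \<Rightarrow> real) \<Rightarrow> nat \<Rightarrow> (nat \<Rightarrow> real) \<Rightarrow> (nat \<Rightarrow> 'w \<Rightarrow> 'v::euclidean_space) \<Rightarrow> real \<Rightarrow> 'w \<Rightarrow> 'v" where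
  "simple_integral W N p \<eta> t \<omega> =
     (\<Sum>k<N. (W (min t (p (Suc k))) \<omega> - W (min t (p k)) \<omega>) *\<^sub>R \<eta> k \<omega>)"

text \<open>\<open>I\<close> is a continuous version of \<open>t \<mapsto> \<integral>\<^sub>0\<^sup>t H dW\<close> on \<open>[0,T]\<close>: the mean-square limit of the
  integrals of simple processes that approximate \<open>H\<close> in mean square.  By the Ito isometry it does
  not depend on the approximating sequence, and is unique up to indistinguishability.\<close>

definition has_ito_integral ::
  "'w measure \<Rightarrow> (real \<Rightarrow> 'w measure) \<Rightarrow> (real \<Rightarrow> 'w \<Rightarrow> real) \<Rightarrow> real \<Rightarrow>
   (real \<Rightarrow> 'w \<Rightarrow> 'v::euclidean_space) \<Rightarrow> (real \<Rightarrow> 'w \<Rightarrow> 'v) \<Rightarrow> bool" where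
  "has_ito_integral M F W T H I \<longleftrightarrow>
     H \<in> L2_F M F T UNIV \<and>
     (\<forall>t\<in>{0..T}. I t \<in> borel_measurable (F t)) \<and>
     (AE \<omega> in M. continuous_on {0..T} (\<lambda>t. I t \<omega>)) \<and>
     (\<exists>N p \<eta>. (\<forall>k::nat. is_simple F T (N k) (p k) (\<eta> k)) \<and>
        (\<lambda>k. \<integral>\<^sup>+\<omega>. (\<integral>\<^sup>+t\<in>{0..T}.
            ennreal ((norm (H t \<omega> - simple_process (N k) (p k) (\<eta> k) t \<omega>))\<^sup>2) \<partial>lborel) \<partial>M)
          \<longlonglongrightarrow> 0 \<and>
        (\<forall>t\<in>{0..T}. (\<lambda>k. \<integral>\<^sup>+\<omega>.
            ennreal ((norm (I t \<omega> - simple_integral W (N k) (p k) (\<eta> k) t \<omega>))\<^sup>2) \<partial>M)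
          \<longlonglongrightarrow> 0))"


section \<open>The control problem\<close>

definition U_ad ::
  "'w measure \<Rightarrow> (real \<Rightarrow> 'w \<Rightarrow> real) \<Rightarrow> (real \<Rightarrow> 'w \<Rightarrow> 'd) \<Rightarrow> real \<Rightarrow> (real \<Rightarrow> 'w \<Rightarrow> real ^ 'm) set" where
  "U_ad M W \<alpha> T = L2_F M (filtr M W \<alpha>) T UNIV"

definition Uc_ad ::
  "'w measure \<Rightarrow> (real \<Rightarrow> 'w \<Rightarrow> real) \<Rightarrow> (real \<Rightarrow> 'w \<Rightarrow> 'd) \<Rightarrow> real \<Rightarrow> (real \<Rightarrow> 'w \<Rightarrow> real ^ 'm) set" where
  "Uc_ad M W \<alpha> T = L2_F M (filtr M W \<alpha>) T nonneg_orthant"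

definition state_solution ::
  "'w measure \<Rightarrow> (real \<Rightarrow> 'w \<Rightarrow> real) \<Rightarrow> (real \<Rightarrow> 'w \<Rightarrow> 'd) \<Rightarrow> real \<Rightarrow>
   (real \<Rightarrow> 'd \<Rightarrow> real ^ 'n ^ 'n) \<Rightarrow> (real \<Rightarrow> 'd \<Rightarrow> real ^ 'm ^ 'n) \<Rightarrow>
   (real \<Rightarrow> 'd \<Rightarrow> real ^ 'n ^ 'n) \<Rightarrow> (real \<Rightarrow> 'd \<Rightarrow> real ^ 'm ^ 'n) \<Rightarrow>
   real ^ 'n \<Rightarrow> (real \<Rightarrow> 'w \<Rightarrow> real ^ 'm) \<Rightarrow> (real \<Rightarrow> 'w \<Rightarrow> real ^ 'n) \<Rightarrow> bool" where
  "state_solution M W \<alpha> T A B C D \<xi> u x \<longleftrightarrow>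
     x \<in> L2_F M (filtr M W \<alpha>) T UNIV \<and>
     (\<exists>I. has_ito_integral M (filtr M W \<alpha>) W T
            (\<lambda>t \<omega>. C t (\<alpha> t \<omega>) *v x t \<omega> + D t (\<alpha> t \<omega>) *v u t \<omega>) I \<and>
          (AE \<omega> in M. \<forall>t\<in>{0..T}.
             x t \<omega> = \<xi> + (LINT s:{0..t}|lborel. A s (\<alpha> s \<omega>) *v x s \<omega> + B s (\<alpha> s \<omega>) *v u s \<omega>) + I t \<omega>))"

text \<open>The initial data \<open>x\<^sub>0 = \<xi>\<close> and \<open>\<alpha>\<^sub>0 = i\<^sub>0\<close> are deterministic, so the conditional expectation
  given them is the expectation.\<close>

definition cost ::
  "'w measure \<Rightarrow> (real \<Rightarrow> 'w \<Rightarrow> 'd) \<Rightarrow> real \<Rightarrow>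
   (real \<Rightarrow> 'd \<Rightarrow> real ^ 'n ^ 'n) \<Rightarrow> (real \<Rightarrow> 'd \<Rightarrow> real ^ 'm ^ 'n) \<Rightarrow> (real \<Rightarrow> 'd \<Rightarrow> real ^ 'm ^ 'm) \<Rightarrow>
   ('d \<Rightarrow> real ^ 'n ^ 'n) \<Rightarrow> (real \<Rightarrow> 'w \<Rightarrow> real ^ 'n) \<Rightarrow> (real \<Rightarrow> 'w \<Rightarrow> real ^ 'm) \<Rightarrow> real" where
  "cost M \<alpha> T Q S R G x u = 1 / 2 * (LINT \<omega>|M.
     (LINT t:{0..T}|lborel. stack (x t \<omega>) (u t \<omega>) \<bullet>
        (block_mat (Q t (\<alpha> t \<omega>)) (S t (\<alpha> t \<omega>)) (R t (\<alpha> t \<omega>)) *v stack (x t \<omega>) (u t \<omega>)))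
     + x T \<omega> \<bullet> (G (\<alpha> T \<omega>) *v x T \<omega>))"

text \<open>Under the standing assumptions every control has a state process, unique up to
  indistinguishability, so \<open>\<J>(\<xi>,i\<^sub>0;u)\<close> is \<open>cost\<close> at any solution \<open>x\<close>, and the infimum over controls
  is the infimum over admissible pairs \<open>(x,u)\<close>.\<close>

definition slq_value ::
  "'w measure \<Rightarrow> (real \<Rightarrow> 'w \<Rightarrow> real) \<Rightarrow> (real \<Rightarrow> 'w \<Rightarrow> 'd) \<Rightarrow> real \<Rightarrow>
   (real \<Rightarrow> 'd \<Rightarrow> real ^ 'n ^ 'n) \<Rightarrow> (real \<Rightarrow> 'd \<Rightarrow> real ^ 'm ^ 'n) \<Rightarrow>
   (real \<Rightarrow> 'd \<Rightarrow> real ^ 'n ^ 'n) \<Rightarrow> (real \<Rightarrow> 'd \<Rightarrow> real ^ 'm ^ 'n) \<Rightarrow>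
   (real \<Rightarrow> 'd \<Rightarrow> real ^ 'n ^ 'n) \<Rightarrow> (real \<Rightarrow> 'd \<Rightarrow> real ^ 'm ^ 'n) \<Rightarrow> (real \<Rightarrow> 'd \<Rightarrow> real ^ 'm ^ 'm) \<Rightarrow>
   ('d \<Rightarrow> real ^ 'n ^ 'n) \<Rightarrow> (real \<Rightarrow> 'w \<Rightarrow> real ^ 'm) set \<Rightarrow> real ^ 'n \<Rightarrow> ereal" where
  "slq_value M W \<alpha> T A B C D Q S R G U \<xi> =
     Inf {ereal (cost M \<alpha> T Q S R G x u) | x u. u \<in> U \<and> state_solution M W \<alpha> T A B C D \<xi> u x}"


section \<open>Relaxed compensators\<close>

definition left_state :: "(real \<Rightarrow> 'w \<Rightarrow> 'd) \<Rightarrow> real \<Rightarrow> 'w \<Rightarrow> 'd" where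
  "left_state \<alpha> t \<omega> = (THE i. \<forall>\<^sub>F s in at_left t. \<alpha> s \<omega> = i)"

definition jump_count :: "(real \<Rightarrow> 'w \<Rightarrow> 'd) \<Rightarrow> 'd \<Rightarrow> 'd \<Rightarrow> real \<Rightarrow> 'w \<Rightarrow> real" where
  "jump_count \<alpha> i j t \<omega> = real (card {s \<in> {0<..t}. left_state \<alpha> s \<omega> = i \<and> \<alpha> s \<omega> = j})"

text \<open>The pathwise Lebesgue--Stieltjes integral over \<open>(0,t]\<close> against the compensated process
  \<open>M\<^bsub>i,j\<^esub>(t) - \<integral>\<^sub>0\<^sup>t \<pi>\<^bsub>i,j\<^esub> \<chi>{\<alpha>\<^bsub>s-\<^esub> = i} ds\<close>, where \<open>M\<^bsub>i,j\<^esub>\<close> is \<open>jump_count\<close>.\<close>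

definition compensated_integral ::
  "(real \<Rightarrow> 'w \<Rightarrow> 'd) \<Rightarrow> ('d \<Rightarrow> 'd \<Rightarrow> real) \<Rightarrow> 'd \<Rightarrow> 'd \<Rightarrow>
   (real \<Rightarrow> 'v::euclidean_space) \<Rightarrow> real \<Rightarrow> 'w \<Rightarrow> 'v" where
  "compensated_integral \<alpha> \<pi> i j f t \<omega> =
     (LINT s:{0<..t}|interval_measure (\<lambda>r. jump_count \<alpha> i j r \<omega>). f s)
     - (LINT s:{0..t}|lborel. (\<pi> i j * of_bool (left_state \<alpha> s \<omega> = i)) *\<^sub>R f s)"

definition Upsilon ::
  "'w measure \<Rightarrow> (real \<Rightarrow> 'w \<Rightarrow> real) \<Rightarrow> (real \<Rightarrow> 'w \<Rightarrow> 'd::finite) \<Rightarrow> ('d \<Rightarrow> 'd \<Rightarrow> real) \<Rightarrow> 'd \<Rightarrow> real \<Rightarrow>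
   (real \<Rightarrow> 'd \<Rightarrow> real ^ 'n ^ 'n) \<Rightarrow> (real \<Rightarrow> 'd \<Rightarrow> real ^ 'n ^ 'n) \<Rightarrow> bool" where
  "Upsilon M W \<alpha> \<pi> i\<^sub>0 T K \<Theta> \<longleftrightarrow>
     (\<forall>i. (\<lambda>t. K t i) \<in> Linf T sym_mats) \<and>
     (\<lambda>t \<omega>. K t (\<alpha> t \<omega>)) \<in> Linf_F M (filtr M W \<alpha>) T sym_mats \<and>
     (\<forall>i. (\<lambda>t. \<Theta> t i) \<in> Linf T sym_mats) \<and>
     K 0 i\<^sub>0 \<in> sym_mats \<and>
     (AE \<omega> in M. \<forall>t\<in>{0..T}.
        K t (\<alpha> t \<omega>) = K 0 i\<^sub>0 + (LINT s:{0..t}|lborel. \<Theta> s (\<alpha> s \<omega>))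
          + (LINT s:{0..t}|lborel. \<Sum>(i, j)\<in>{(i, j). i \<noteq> j}.
               (\<pi> i j * of_bool (left_state \<alpha> s \<omega> = i)) *\<^sub>R (K s j - K s i))
          + (\<Sum>(i, j)\<in>{(i, j). i \<noteq> j}.
               compensated_integral \<alpha> \<pi> i j (\<lambda>s. K s j - K s i) t \<omega>))"

definition Q_comp ::
  "('d::finite \<Rightarrow> 'd \<Rightarrow> real) \<Rightarrow> (real \<Rightarrow> 'd \<Rightarrow> real ^ 'n ^ 'n) \<Rightarrow> (real \<Rightarrow> 'd \<Rightarrow> real ^ 'n ^ 'n) \<Rightarrow>
   (real \<Rightarrow> 'd \<Rightarrow> real ^ 'n ^ 'n) \<Rightarrow> (real \<Rightarrow> 'd \<Rightarrow> real ^ 'n ^ 'n) \<Rightarrow> (real \<Rightarrow> 'd \<Rightarrow> real ^ 'n ^ 'n) \<Rightarrow>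
   real \<Rightarrow> 'd \<Rightarrow> real ^ 'n ^ 'n" where
  "Q_comp \<pi> A C Q K \<Theta> t i = Q t i + \<Theta> t i + K t i ** A t i + transpose (A t i) ** K t i
     + transpose (C t i) ** K t i ** C t i + (\<Sum>j\<in>UNIV. \<pi> i j *\<^sub>R (K t j - K t i))"

definition S_comp ::
  "(real \<Rightarrow> 'd \<Rightarrow> real ^ 'm ^ 'n) \<Rightarrow> (real \<Rightarrow> 'd \<Rightarrow> real ^ 'n ^ 'n) \<Rightarrow> (real \<Rightarrow> 'd \<Rightarrow> real ^ 'm ^ 'n) \<Rightarrow>
   (real \<Rightarrow> 'd \<Rightarrow> real ^ 'm ^ 'n) \<Rightarrow> (real \<Rightarrow> 'd \<Rightarrow> real ^ 'n ^ 'n) \<Rightarrow>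
   real \<Rightarrow> 'd \<Rightarrow> real ^ 'm ^ 'n" where
  "S_comp B C D S K t i = S t i + K t i ** B t i + transpose (C t i) ** K t i ** D t i"

definition R_comp ::
  "(real \<Rightarrow> 'd \<Rightarrow> real ^ 'm ^ 'n) \<Rightarrow> (real \<Rightarrow> 'd \<Rightarrow> real ^ 'm ^ 'm) \<Rightarrow> (real \<Rightarrow> 'd \<Rightarrow> real ^ 'n ^ 'n) \<Rightarrow>
   real \<Rightarrow> 'd \<Rightarrow> real ^ 'm ^ 'm" where
  "R_comp D R K t i = R t i + transpose (D t i) ** K t i ** D t i"

text \<open>The process \<open>\<Theta>\<close> is part of the decomposition of \<open>K\<close>, hence quantified existentially.\<close>

definition relaxed_compensator ::
  "'w measure \<Rightarrow> (real \<Rightarrow> 'w \<Rightarrow> real) \<Rightarrow> (real \<Rightarrow> 'w \<Rightarrow> 'd::finite) \<Rightarrow> ('d \<Rightarrow> 'd \<Rightarrow> real) \<Rightarrow> 'd \<Rightarrow> real \<Rightarrow>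
   (real \<Rightarrow> 'd \<Rightarrow> real ^ 'n ^ 'n) \<Rightarrow> (real \<Rightarrow> 'd \<Rightarrow> real ^ 'm ^ 'n) \<Rightarrow>
   (real \<Rightarrow> 'd \<Rightarrow> real ^ 'n ^ 'n) \<Rightarrow> (real \<Rightarrow> 'd \<Rightarrow> real ^ 'm ^ 'n) \<Rightarrow>
   (real \<Rightarrow> 'd \<Rightarrow> real ^ 'n ^ 'n) \<Rightarrow> (real \<Rightarrow> 'd \<Rightarrow> real ^ 'm ^ 'n) \<Rightarrow> (real \<Rightarrow> 'd \<Rightarrow> real ^ 'm ^ 'm) \<Rightarrow>
   ('d \<Rightarrow> real ^ 'n ^ 'n) \<Rightarrow> (real \<Rightarrow> 'd \<Rightarrow> real ^ 'n ^ 'n) \<Rightarrow> bool" where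
  "relaxed_compensator M W \<alpha> \<pi> i\<^sub>0 T A B C D Q S R G K \<longleftrightarrow>
     (\<exists>\<Theta>. Upsilon M W \<alpha> \<pi> i\<^sub>0 T K \<Theta> \<and>
        (\<forall>i. (\<lambda>t. block_mat (Q_comp \<pi> A C Q K \<Theta> t i) (S_comp B C D S K t i) (R_comp D R K t i))
               \<in> Linf T psd_mats \<and>
             G i - K T i \<in> psd_mats \<and>
             (\<lambda>t. R_comp D R K t i) \<in> Linf T pd_mats))"

end

theory Submission
  imports Defs
begin

text \<open>
  Write \<open>a = A x + B u\<close> and \<open>H = C x + D u\<close> for the coefficients of the state.  The proof completes the
  cost by the telescoping identity for \<open>E (x \<bullet> K x)\<close>.  If \<open>K\<close> is a compensator with derivative \<open>\<Theta>\<close>, then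
  \<open>E (x T \<bullet> K T x T) - \<xi> \<bullet> K 0 \<xi>\<close> is the expected time integral of
  \<open>x \<bullet> K a + a \<bullet> K x + H \<bullet> K H + x \<bullet> (\<Theta> + \<Sum>j. \<pi> \<alpha> j K j) x\<close>.  Adding this to twice the cost turns the running
  weights into the compensated block matrix and the terminal weight into \<open>G - K T\<close>.  Both are positive
  semidefinite, so the cost is at least \<open>\<xi> \<bullet> K 0 \<xi> / 2\<close> for every control, constrained or not;
  here \<open>K 0\<close> is the limit from the right at time \<open>0\<close> in the initial regime (\<open>cost_lower_bound\<close>, with the algebra in \<open>compensated_form\<close>).

  For the identity (\<open>verification_identity\<close>) time is cut into cells.  Over a cell \<open>(s,t]\<close> the change
  of \<open>E (x \<bullet> K x)\<close> is computed exactly (\<open>one_step\<close>): the weight is frozen at its value \<open>k t (\<alpha> t)\<close> at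
  the right end, where \<open>k\<close> is the version of \<open>K\<close> that is continuous on \<open>[0,T]\<close>, and \<open>x t - x s\<close> is the sum of a drift and an increment of the Ito
  integral.  Three facts enter.  First, \<open>W\<close> is independent of the chain, so it keeps independent
  increments for the filtration enlarged by the whole chain; the weight \<open>k t (\<alpha> t)\<close> is known in that
  filtration at time \<open>s\<close>, hence the Ito increment is orthogonal to \<open>x s\<close> with this weight and satisfies
  the weighted isometry (\<open>ito_increment_orthogonal\<close>, \<open>ito_increment_isometry\<close>).  Second, the mean change of
  the weight itself is given by the Markov property (\<open>expectation_weight_change\<close>).  Third, the energy of
  a cell controls the mean-square oscillation of \<open>x\<close> there (\<open>state_increment_energy\<close>), so the integrands
  converge in mean square as the mesh tends to zero (\<open>step_energy\<close>, \<open>tendsto_integral_matrix_form\<close>).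

  The compensator is given by an identity along the paths of the chain started at \<open>j\<^sub>0\<close>, whereas the
  problem is posed for every initial regime.  The two are linked by \<open>compensator_increment\<close>: by
  irreducibility every regime is reached within every positive time with positive probability
  (\<open>irreducible_transition_pos\<close>), and is then kept up to time \<open>T\<close> with positive probability
  (\<open>AE_stay_witness\<close>).  Along such a path the jump terms are constant and the compensating drifts cancel,
  so \<open>K t i - K s i\<close> is the integral of \<open>\<Theta> r i\<close> over \<open>(s,t]\<close> for every regime \<open>i\<close> and \<open>0 < s \<le> t \<le> T\<close>.
\<close>

section \<open>Matrices acting on vectors\<close>

lemma norm_matrix_vector_mult_le:
  fixes P :: "real ^ 'n ^ 'm" and x :: "real ^ 'n"
  shows "norm (P *v x) \<le> norm P * norm x"
proof -
  have "norm (P *v x) = L2_set (\<lambda>i. norm ((P *v x) $ i)) UNIV"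
    by (simp add: norm_vec_def)
  also have "\<dots> \<le> L2_set (\<lambda>i. norm (P $ i) * norm x) UNIV"
    by (intro L2_set_mono) (auto simp: matrix_vector_mul_component Cauchy_Schwarz_ineq2)
  also have "\<dots> = norm P * norm x"
    by (simp add: norm_vec_def L2_set_left_distrib)
  finally show ?thesis .
qed

lemma bounded_bilinear_matrix_vector_mult:
  "bounded_bilinear ((*v) :: real ^ 'n ^ 'm \<Rightarrow> real ^ 'n \<Rightarrow> real ^ 'm)"
proof
  show "\<exists>K. \<forall>(a :: real ^ 'n ^ 'm) b. norm (a *v b) \<le> norm a * norm b * K"
    by (intro exI[of _ 1]) (simp add: norm_matrix_vector_mult_le)
qed (auto simp: matrix_vector_mult_add_rdistrib matrix_vector_right_distrib
      scaleR_matrix_vector_assoc matrix_vector_mult_scaleR)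

lemma borel_measurable_matrix_vector_mult [measurable (raw)]:
  fixes P :: "'a \<Rightarrow> real ^ 'n ^ 'm"
  assumes [measurable]: "P \<in> borel_measurable N" "f \<in> borel_measurable N"
  shows "(\<lambda>x. P x *v f x) \<in> borel_measurable N"
proof -
  have "continuous_on UNIV (\<lambda>p. fst p *v snd p :: real ^ 'm)" for dummy :: "real ^ 'n ^ 'm"
    by (intro bounded_bilinear.continuous_on[OF bounded_bilinear_matrix_vector_mult] continuous_intros)
  then have [measurable]: "(\<lambda>p :: (real ^ 'n ^ 'm) \<times> (real ^ 'n). fst p *v snd p) \<in> borel_measurable borel"
    by (rule borel_measurable_continuous_onI)
  have "(\<lambda>x. (P x, f x)) \<in> borel_measurable N" by measurable
  from measurable_compose[OF this, of "\<lambda>p. fst p *v snd p" borel] show ?thesis by simp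
qed

lemma norm_transpose: "norm (transpose P) = norm (P :: real ^ 'n ^ 'm)"
proof -
  have "(norm P)\<^sup>2 = (\<Sum>i\<in>UNIV. \<Sum>j\<in>UNIV. (P $ i $ j)\<^sup>2)" for P :: "real ^ 'n ^ 'm"
    unfolding power2_norm_eq_inner inner_vec_def by (simp add: power2_eq_square)
  note * = this
  have "(norm P)\<^sup>2 = (\<Sum>i\<in>UNIV. \<Sum>j\<in>UNIV. (P $ i $ j)\<^sup>2)" for P :: "real ^ 'm ^ 'n"
    unfolding power2_norm_eq_inner inner_vec_def by (simp add: power2_eq_square)
  note ** = this
  have "(norm (transpose P))\<^sup>2 = (norm P)\<^sup>2"
    unfolding * ** by (subst sum.swap) (simp add: transpose_def)
  then show ?thesis by (simp add: power2_eq_iff_nonneg)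
qed

lemma bounded_linear_transpose: "bounded_linear (transpose :: real ^ 'n ^ 'm \<Rightarrow> _)"
proof
  show "\<exists>K. \<forall>(a :: real ^ 'n ^ 'm). norm (transpose a) \<le> norm a * K"
    by (intro exI[of _ 1]) (simp add: norm_transpose)
qed (auto simp: transpose_def vec_eq_iff)

lemma borel_measurable_transpose [measurable (raw)]:
  fixes P :: "'a \<Rightarrow> real ^ 'n ^ 'm"
  assumes "P \<in> borel_measurable N"
  shows "(\<lambda>x. transpose (P x)) \<in> borel_measurable N"
  using measurable_compose[OF assms borel_measurable_continuous_onI
      [OF linear_continuous_on[OF bounded_linear_transpose]]] .

section \<open>Square-integrable functions\<close>

definition square_integrable :: "'a measure \<Rightarrow> ('a \<Rightarrow> 'v::euclidean_space) \<Rightarrow> bool" where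
  "square_integrable N f \<longleftrightarrow> f \<in> borel_measurable N \<and> integrable N (\<lambda>x. (norm (f x))\<^sup>2)"

lemma square_integrableD [dest]:
  assumes "square_integrable N f"
  shows "f \<in> borel_measurable N" "integrable N (\<lambda>x. (norm (f x))\<^sup>2)"
  using assms by (auto simp: square_integrable_def)

lemma square_integrable_bound:
  fixes f :: "'a \<Rightarrow> 'v::euclidean_space"
  assumes "integrable N g" "f \<in> borel_measurable N" "AE x in N. (norm (f x))\<^sup>2 \<le> g x"
  shows "square_integrable N f"
  unfolding square_integrable_def
proof
  show "integrable N (\<lambda>x. (norm (f x))\<^sup>2)"
    using assms(2,3) by (intro Bochner_Integration.integrable_bound[OF assms(1)])
      (auto elim: eventually_mono)
qed fact

lemma norm_add_square_le: "(norm (a + b :: 'v::real_inner))\<^sup>2 \<le> 2 * (norm a)\<^sup>2 + 2 * (norm b)\<^sup>2"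
proof -
  have "0 \<le> (norm (a - b))\<^sup>2" by simp
  then show ?thesis by (simp add: power2_norm_eq_inner inner_simps inner_commute)
qed

lemma norm_diff_square_le: "(norm (a - b :: 'v::real_inner))\<^sup>2 \<le> 2 * (norm a)\<^sup>2 + 2 * (norm b)\<^sup>2"
  using norm_add_square_le[of a "- b"] by simp

lemma square_integrable_add:
  assumes "square_integrable N f" "square_integrable N g"
  shows "square_integrable N (\<lambda>x. f x + g x)"
  using assms[THEN square_integrableD(1)] assms[THEN square_integrableD(2)]
  by (intro square_integrable_bound[where g="\<lambda>x. 2 * (norm (f x))\<^sup>2 + 2 * (norm (g x))\<^sup>2"])
     (auto simp: norm_add_square_le)

lemma square_integrable_diff:
  assumes "square_integrable N f" "square_integrable N g"
  shows "square_integrable N (\<lambda>x. f x - g x)"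
  using assms[THEN square_integrableD(1)] assms[THEN square_integrableD(2)]
  by (intro square_integrable_bound[where g="\<lambda>x. 2 * (norm (f x))\<^sup>2 + 2 * (norm (g x))\<^sup>2"])
     (auto simp: norm_diff_square_le)

lemma square_integrable_bounded:
  assumes "finite_measure N" "f \<in> borel_measurable N" "\<And>x. x \<in> space N \<Longrightarrow> norm (f x) \<le> c"
  shows "square_integrable N f"
  using finite_measure.integrable_const[OF assms(1), of "c\<^sup>2"] assms(2)
  by (rule square_integrable_bound) (auto intro!: AE_I2 power_mono assms(3))

lemma square_integrable_matrix_mult:
  fixes f :: "'a \<Rightarrow> real ^ 'n" and P :: "'a \<Rightarrow> real ^ 'n ^ 'm"
  assumes f: "square_integrable N f" and [measurable]: "P \<in> borel_measurable N"
    and P: "AE x in N. norm (P x) \<le> c"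
  shows "square_integrable N (\<lambda>x. P x *v f x)"
proof -
  have [measurable]: "f \<in> borel_measurable N" using f by auto
  have "AE x in N. (norm (P x *v f x))\<^sup>2 \<le> c\<^sup>2 * (norm (f x))\<^sup>2"
    using P
  proof eventually_elim
    case (elim x)
    have "norm (P x *v f x) \<le> c * norm (f x)"
      using norm_matrix_vector_mult_le[of "P x" "f x"] elim
      by (meson mult_right_mono norm_ge_zero order_trans)
    then show ?case by (metis norm_ge_zero power_mono power_mult_distrib)
  qed
  then show ?thesis
    using f by (intro square_integrable_bound[where g="\<lambda>x. c\<^sup>2 * (norm (f x))\<^sup>2"]) auto
qed

lemma integrable_inner_square_integrable:
  assumes f: "square_integrable N f" and g: "square_integrable N g"
  shows "integrable N (\<lambda>x. f x \<bullet> g x)"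
proof (rule Bochner_Integration.integrable_bound)
  show "integrable N (\<lambda>x. (norm (f x))\<^sup>2 + (norm (g x))\<^sup>2)" using f g by auto
  show "(\<lambda>x. f x \<bullet> g x) \<in> borel_measurable N"
    using square_integrableD(1)[OF f] square_integrableD(1)[OF g] by measurable
  have "\<bar>a \<bullet> b\<bar> \<le> (norm a)\<^sup>2 + (norm b)\<^sup>2" for a b :: 'b
  proof -
    have "\<bar>a \<bullet> b\<bar> \<le> norm a * norm b" by (rule Cauchy_Schwarz_ineq2)
    also have "\<dots> \<le> (norm a)\<^sup>2 + (norm b)\<^sup>2"
      using sum_squares_bound[of "norm a" "norm b"]
        mult_nonneg_nonneg[OF norm_ge_zero norm_ge_zero, of a b]
      by linarith
    finally show ?thesis .
  qed
  then show "AE x in N. norm (f x \<bullet> g x) \<le> norm ((norm (f x))\<^sup>2 + (norm (g x))\<^sup>2)"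
    by (auto intro!: AE_I2)
qed

text \<open>The polynomial \<open>r \<mapsto> \<integral>\<parallel>f + r g\<parallel>\<^sup>2\<close> is nonnegative, so its discriminant is not positive.\<close>

lemma integral_inner_le:
  assumes f: "square_integrable N f" and g: "square_integrable N g"
  shows "\<bar>\<integral>x. f x \<bullet> g x \<partial>N\<bar> \<le> sqrt (\<integral>x. (norm (f x))\<^sup>2 \<partial>N) * sqrt (\<integral>x. (norm (g x))\<^sup>2 \<partial>N)"
proof -
  define A B C where "A = (\<integral>x. (norm (f x))\<^sup>2 \<partial>N)" and "B = (\<integral>x. (norm (g x))\<^sup>2 \<partial>N)"
    and "C = (\<integral>x. f x \<bullet> g x \<partial>N)"
  have int: "integrable N (\<lambda>x. (norm (f x))\<^sup>2)" "integrable N (\<lambda>x. (norm (g x))\<^sup>2)"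
    "integrable N (\<lambda>x. f x \<bullet> g x)"
    using f g integrable_inner_square_integrable[OF f g] by auto
  have q: "0 \<le> A + 2 * r * C + r\<^sup>2 * B" for r
  proof -
    have "0 \<le> (\<integral>x. (norm (f x + r *\<^sub>R g x))\<^sup>2 \<partial>N)" by (intro integral_nonneg_AE) auto
    also have "(\<lambda>x. (norm (f x + r *\<^sub>R g x))\<^sup>2)
      = (\<lambda>x. (norm (f x))\<^sup>2 + 2 * r * (f x \<bullet> g x) + r\<^sup>2 * (norm (g x))\<^sup>2)"
      unfolding power2_norm_eq_inner
      by (intro ext) (simp add: inner_simps inner_commute power2_eq_square algebra_simps)
    also have "(\<integral>x. \<dots> x \<partial>N) = A + 2 * r * C + r\<^sup>2 * B"
      using int by (simp add: A_def B_def C_def)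
    finally show ?thesis .
  qed
  have A: "A \<ge> 0" and B: "B \<ge> 0" unfolding A_def B_def by simp_all
  have "C\<^sup>2 \<le> A * B"
  proof (cases "B = 0")
    case True
    have "C = 0"
    proof (rule ccontr)
      assume C: "C \<noteq> 0"
      show False using q[of "- (A + 1) / (2 * C)"] True C by (simp add: field_simps)
    qed
    then show ?thesis using True by simp
  next
    case False
    then have "0 \<le> B * (A + 2 * (- C / B) * C + (- C / B)\<^sup>2 * B)"
      using B q[of "- C / B"] by simp
    also have "\<dots> = A * B - C\<^sup>2" using False by (simp add: field_simps power2_eq_square)
    finally show ?thesis by simp
  qed
  then have "sqrt (C\<^sup>2) \<le> sqrt (A * B)" by (rule real_sqrt_le_mono)
  then show ?thesis unfolding A_def B_def C_def by (simp add: real_sqrt_mult)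
qed

definition L2_tendsto :: "'a measure \<Rightarrow> (nat \<Rightarrow> 'a \<Rightarrow> 'v::euclidean_space) \<Rightarrow> ('a \<Rightarrow> 'v) \<Rightarrow> bool" where
  "L2_tendsto N f g \<longleftrightarrow> (\<forall>n. square_integrable N (f n)) \<and> square_integrable N g \<and>
     (\<lambda>n. \<integral>x. (norm (f n x - g x))\<^sup>2 \<partial>N) \<longlonglongrightarrow> 0"

lemma L2_tendsto_const: "square_integrable N f \<Longrightarrow> L2_tendsto N (\<lambda>n. f) f"
  by (simp add: L2_tendsto_def)

lemma integral_matrix_form_bound:
  fixes f :: "'a \<Rightarrow> real ^ 'm" and g :: "'a \<Rightarrow> real ^ 'n" and P :: "'a \<Rightarrow> real ^ 'n ^ 'm"
  assumes f: "square_integrable N f" and g: "square_integrable N g"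
    and P: "P \<in> borel_measurable N" "AE x in N. norm (P x) \<le> c" and c: "0 \<le> c"
  shows "\<bar>\<integral>x. f x \<bullet> (P x *v g x) \<partial>N\<bar>
    \<le> c * (sqrt (\<integral>x. (norm (f x))\<^sup>2 \<partial>N) * sqrt (\<integral>x. (norm (g x))\<^sup>2 \<partial>N))"
proof -
  have Pg: "square_integrable N (\<lambda>x. P x *v g x)"
    using square_integrable_matrix_mult[OF g P] .
  have "(\<integral>x. (norm (P x *v g x))\<^sup>2 \<partial>N) \<le> (\<integral>x. c\<^sup>2 * (norm (g x))\<^sup>2 \<partial>N)"
  proof (rule integral_mono_AE)
    show "AE x in N. (norm (P x *v g x))\<^sup>2 \<le> c\<^sup>2 * (norm (g x))\<^sup>2"
      using P(2)
    proof eventually_elim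
      case (elim x)
      have "norm (P x *v g x) \<le> c * norm (g x)"
        using norm_matrix_vector_mult_le[of "P x" "g x"] elim
        by (meson mult_right_mono norm_ge_zero order_trans)
      then show ?case by (metis norm_ge_zero power_mono power_mult_distrib)
    qed
  qed (use Pg g in auto)
  then have "sqrt (\<integral>x. (norm (P x *v g x))\<^sup>2 \<partial>N) \<le> sqrt (c\<^sup>2 * (\<integral>x. (norm (g x))\<^sup>2 \<partial>N))"
    by simp
  also have "\<dots> = c * sqrt (\<integral>x. (norm (g x))\<^sup>2 \<partial>N)"
    using c by (simp add: real_sqrt_mult)
  finally have "sqrt (\<integral>x. (norm (f x))\<^sup>2 \<partial>N) * sqrt (\<integral>x. (norm (P x *v g x))\<^sup>2 \<partial>N)
     \<le> sqrt (\<integral>x. (norm (f x))\<^sup>2 \<partial>N) * (c * sqrt (\<integral>x. (norm (g x))\<^sup>2 \<partial>N))"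
    by (intro mult_left_mono) auto
  with integral_inner_le[OF f Pg] show ?thesis by (simp add: mult_ac)
qed

text \<open>Quadratic expressions are continuous along mean-square convergent factors and boundedly
  convergent matrix weights.  The passages from simple to general integrands and from partitions to
  the continuous-time identity are instances.\<close>

lemma tendsto_integral_matrix_form:
  fixes f :: "nat \<Rightarrow> 'a \<Rightarrow> real ^ 'm" and g :: "nat \<Rightarrow> 'a \<Rightarrow> real ^ 'n"
    and P :: "nat \<Rightarrow> 'a \<Rightarrow> real ^ 'n ^ 'm"
  assumes f: "L2_tendsto N f f'" and g: "L2_tendsto N g g'"
    and P: "\<And>n. P n \<in> borel_measurable N" "\<And>n. AE x in N. norm (P n x) \<le> c"
    and P': "P' \<in> borel_measurable N" "AE x in N. (\<lambda>n. P n x) \<longlonglongrightarrow> P' x" and c: "0 \<le> c"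
  shows "(\<lambda>n. \<integral>x. f n x \<bullet> (P n x *v g n x) \<partial>N) \<longlonglongrightarrow> (\<integral>x. f' x \<bullet> (P' x *v g' x) \<partial>N)"
proof -
  let ?n = "\<lambda>h. sqrt (\<integral>x. (norm (h x))\<^sup>2 \<partial>N)"
  have sq: "\<And>n. square_integrable N (f n)" "square_integrable N f'"
     "\<And>n. square_integrable N (g n)" "square_integrable N g'"
    using f g by (auto simp: L2_tendsto_def)
  note Pm = square_integrable_matrix_mult[OF _ P]
  have [measurable]: "f' \<in> borel_measurable N" "g' \<in> borel_measurable N" "P' \<in> borel_measurable N"
    "\<And>n. P n \<in> borel_measurable N" using sq P P' by auto
  have split: "(\<integral>x. f n x \<bullet> (P n x *v g n x) \<partial>N) =
     (\<integral>x. (f n x - f' x) \<bullet> (P n x *v (g n x - g' x)) \<partial>N)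
     + (\<integral>x. (f n x - f' x) \<bullet> (P n x *v g' x) \<partial>N)
     + (\<integral>x. f' x \<bullet> (P n x *v (g n x - g' x)) \<partial>N)
     + (\<integral>x. f' x \<bullet> (P n x *v g' x) \<partial>N)" for n
  proof -
    have i: "integrable N (\<lambda>x. (f n x - f' x) \<bullet> (P n x *v (g n x - g' x)))"
      "integrable N (\<lambda>x. (f n x - f' x) \<bullet> (P n x *v g' x))"
      "integrable N (\<lambda>x. f' x \<bullet> (P n x *v (g n x - g' x)))"
      "integrable N (\<lambda>x. f' x \<bullet> (P n x *v g' x))"
      by (intro integrable_inner_square_integrable Pm square_integrable_diff sq)+
    have "(\<lambda>x. f n x \<bullet> (P n x *v g n x)) = (\<lambda>x. (f n x - f' x) \<bullet> (P n x *v (g n x - g' x))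
       + (f n x - f' x) \<bullet> (P n x *v g' x) + f' x \<bullet> (P n x *v (g n x - g' x))
       + f' x \<bullet> (P n x *v g' x))"
      by (simp add: inner_simps matrix_vector_mult_diff_distrib)
    then show ?thesis using i by simp
  qed
  have f0: "(\<lambda>n. ?n (\<lambda>x. f n x - f' x)) \<longlonglongrightarrow> 0"
    using f tendsto_real_sqrt[of _ 0] by (fastforce simp: L2_tendsto_def)
  have g0: "(\<lambda>n. ?n (\<lambda>x. g n x - g' x)) \<longlonglongrightarrow> 0"
    using g tendsto_real_sqrt[of _ 0] by (fastforce simp: L2_tendsto_def)
  have 1: "(\<lambda>n. \<integral>x. (f n x - f' x) \<bullet> (P n x *v (g n x - g' x)) \<partial>N) \<longlonglongrightarrow> 0"
  proof (rule Lim_null_comparison)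
    show "\<forall>\<^sub>F n in sequentially. norm (\<integral>x. (f n x - f' x) \<bullet> (P n x *v (g n x - g' x)) \<partial>N)
      \<le> c * (?n (\<lambda>x. f n x - f' x) * ?n (\<lambda>x. g n x - g' x))"
      unfolding real_norm_def
      by (intro always_eventually allI integral_matrix_form_bound square_integrable_diff sq P c)
    have "(\<lambda>n. c * (?n (\<lambda>x. f n x - f' x) * ?n (\<lambda>x. g n x - g' x))) \<longlonglongrightarrow> c * (0 * 0)"
      by (intro tendsto_intros f0 g0)
    then show "(\<lambda>n. c * (?n (\<lambda>x. f n x - f' x) * ?n (\<lambda>x. g n x - g' x))) \<longlonglongrightarrow> 0" by simp
  qed
  have 2: "(\<lambda>n. \<integral>x. (f n x - f' x) \<bullet> (P n x *v g' x) \<partial>N) \<longlonglongrightarrow> 0"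
  proof (rule Lim_null_comparison)
    show "\<forall>\<^sub>F n in sequentially. norm (\<integral>x. (f n x - f' x) \<bullet> (P n x *v g' x) \<partial>N)
      \<le> c * (?n (\<lambda>x. f n x - f' x) * ?n g')"
      unfolding real_norm_def
      by (intro always_eventually allI integral_matrix_form_bound square_integrable_diff sq P c)
    have "(\<lambda>n. c * (?n (\<lambda>x. f n x - f' x) * ?n g')) \<longlonglongrightarrow> c * (0 * ?n g')"
      by (intro tendsto_intros f0)
    then show "(\<lambda>n. c * (?n (\<lambda>x. f n x - f' x) * ?n g')) \<longlonglongrightarrow> 0" by simp
  qed
  have 3: "(\<lambda>n. \<integral>x. f' x \<bullet> (P n x *v (g n x - g' x)) \<partial>N) \<longlonglongrightarrow> 0"
  proof (rule Lim_null_comparison)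
    show "\<forall>\<^sub>F n in sequentially. norm (\<integral>x. f' x \<bullet> (P n x *v (g n x - g' x)) \<partial>N)
      \<le> c * (?n f' * ?n (\<lambda>x. g n x - g' x))"
      unfolding real_norm_def
      by (intro always_eventually allI integral_matrix_form_bound square_integrable_diff sq P c)
    have "(\<lambda>n. c * (?n f' * ?n (\<lambda>x. g n x - g' x))) \<longlonglongrightarrow> c * (?n f' * 0)"
      by (intro tendsto_intros g0)
    then show "(\<lambda>n. c * (?n f' * ?n (\<lambda>x. g n x - g' x))) \<longlonglongrightarrow> 0" by simp
  qed
  have 4: "(\<lambda>n. \<integral>x. f' x \<bullet> (P n x *v g' x) \<partial>N) \<longlonglongrightarrow> (\<integral>x. f' x \<bullet> (P' x *v g' x) \<partial>N)"
  proof (rule integral_dominated_convergence[where w="\<lambda>x. c * ((norm (f' x))\<^sup>2 + (norm (g' x))\<^sup>2)"])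
    show "integrable N (\<lambda>x. c * ((norm (f' x))\<^sup>2 + (norm (g' x))\<^sup>2))" using sq by auto
    show "AE x in N. (\<lambda>n. f' x \<bullet> (P n x *v g' x)) \<longlonglongrightarrow> f' x \<bullet> (P' x *v g' x)"
      using P'(2)
      by eventually_elim
        (intro tendsto_intros bounded_bilinear.tendsto[OF bounded_bilinear_matrix_vector_mult])
    show "AE x in N. norm (f' x \<bullet> (P n x *v g' x)) \<le> c * ((norm (f' x))\<^sup>2 + (norm (g' x))\<^sup>2)" for n
      using P(2)[of n]
    proof eventually_elim
      case (elim x)
      have "\<bar>f' x \<bullet> (P n x *v g' x)\<bar> \<le> norm (f' x) * norm (P n x *v g' x)"
        by (rule Cauchy_Schwarz_ineq2)
      also have "\<dots> \<le> norm (f' x) * (c * norm (g' x))"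
        using order_trans[OF norm_matrix_vector_mult_le[of "P n x" "g' x"]
            mult_right_mono[OF elim norm_ge_zero]]
        by (intro mult_left_mono) auto
      also have "\<dots> \<le> c * ((norm (f' x))\<^sup>2 + (norm (g' x))\<^sup>2)"
        using mult_left_mono[OF sum_squares_bound[of "norm (f' x)" "norm (g' x)"] c]
          mult_nonneg_nonneg[OF c, of "norm (f' x) * norm (g' x)"]
        by (simp add: algebra_simps)
      finally show ?case by simp
    qed
  qed measurable
  have "(\<lambda>n. \<integral>x. f n x \<bullet> (P n x *v g n x) \<partial>N) \<longlonglongrightarrow> 0 + 0 + 0 + (\<integral>x. f' x \<bullet> (P' x *v g' x) \<partial>N)"
    unfolding split by (intro tendsto_add 1 2 3 4)
  then show ?thesis by simp
qed

lemma square_integrable_iff_nn: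
  assumes [measurable]: "f \<in> borel_measurable N"
  shows "square_integrable N f \<longleftrightarrow> (\<integral>\<^sup>+x. ennreal ((norm (f x))\<^sup>2) \<partial>N) < \<infinity>"
  unfolding square_integrable_def by (auto simp: integrable_iff_bounded)

lemma L2_tendsto_nnI:
  assumes f: "\<And>n. square_integrable N (f n)" and [measurable]: "g \<in> borel_measurable N"
    and lim: "(\<lambda>n. \<integral>\<^sup>+x. ennreal ((norm (g x - f n x))\<^sup>2) \<partial>N) \<longlonglongrightarrow> 0"
  shows "L2_tendsto N f g"
proof -
  have [measurable]: "\<And>n. f n \<in> borel_measurable N" using f by auto
  have "\<forall>\<^sub>F n in sequentially. (\<integral>\<^sup>+x. ennreal ((norm (g x - f n x))\<^sup>2) \<partial>N) < 1"
    using lim by (rule order_tendstoD) simp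
  then obtain n where "(\<integral>\<^sup>+x. ennreal ((norm (g x - f n x))\<^sup>2) \<partial>N) < 1"
    by (auto simp: eventually_sequentially)
  then have "square_integrable N (\<lambda>x. g x - f n x)"
    by (subst square_integrable_iff_nn) (auto intro: less_trans)
  from square_integrable_add[OF this f[of n]] have g: "square_integrable N g" by simp
  have "ennreal (\<integral>x. (norm (f n x - g x))\<^sup>2 \<partial>N) = (\<integral>\<^sup>+x. ennreal ((norm (g x - f n x))\<^sup>2) \<partial>N)" for n
    using square_integrable_diff[OF f[of n] g]
    by (subst nn_integral_eq_integral[symmetric]) (auto simp: norm_minus_commute)
  with lim have "(\<lambda>n. ennreal (\<integral>x. (norm (f n x - g x))\<^sup>2 \<partial>N)) \<longlonglongrightarrow> ennreal 0" by simp
  then have "(\<lambda>n. \<integral>x. (norm (f n x - g x))\<^sup>2 \<partial>N) \<longlonglongrightarrow> 0"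
    by (rule tendsto_ennrealD) auto
  with f g show ?thesis by (simp add: L2_tendsto_def)
qed

lemma square_integrable_sum:
  assumes "\<And>i. i \<in> I \<Longrightarrow> square_integrable N (f i)"
  shows "square_integrable N (\<lambda>x. \<Sum>i\<in>I. f i x)"
  using assms
proof (induction I rule: infinite_finite_induct)
  case (insert i I)
  then show ?case by (simp add: square_integrable_add)
qed (auto simp: square_integrable_def)

lemma L2_tendsto_diff:
  assumes f: "L2_tendsto N f f'" and g: "L2_tendsto N g g'"
  shows "L2_tendsto N (\<lambda>n x. f n x - g n x) (\<lambda>x. f' x - g' x)"
proof -
  have sq: "\<And>n. square_integrable N (f n)" "square_integrable N f'"
     "\<And>n. square_integrable N (g n)" "square_integrable N g'"
    using f g by (auto simp: L2_tendsto_def)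
  have "(\<lambda>n. \<integral>x. (norm ((f n x - g n x) - (f' x - g' x)))\<^sup>2 \<partial>N) \<longlonglongrightarrow> 0"
  proof (rule tendsto_sandwich[where f = "\<lambda>_. 0"])
    let ?b = "\<lambda>n. 2 * (\<integral>x. (norm (f n x - f' x))\<^sup>2 \<partial>N) + 2 * (\<integral>x. (norm (g n x - g' x))\<^sup>2 \<partial>N)"
    have "(\<lambda>n. ?b n) \<longlonglongrightarrow> 2 * 0 + 2 * 0"
      using f g by (intro tendsto_intros) (auto simp: L2_tendsto_def)
    then show "?b \<longlonglongrightarrow> 0" by simp
    show "\<forall>\<^sub>F n in sequentially. (\<integral>x. (norm ((f n x - g n x) - (f' x - g' x)))\<^sup>2 \<partial>N) \<le> ?b n"
    proof (intro always_eventually allI)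
      fix n
      have "(\<integral>x. (norm ((f n x - g n x) - (f' x - g' x)))\<^sup>2 \<partial>N)
         \<le> (\<integral>x. 2 * (norm (f n x - f' x))\<^sup>2 + 2 * (norm (g n x - g' x))\<^sup>2 \<partial>N)"
      proof (rule integral_mono)
        show "(norm ((f n x - g n x) - (f' x - g' x)))\<^sup>2
           \<le> 2 * (norm (f n x - f' x))\<^sup>2 + 2 * (norm (g n x - g' x))\<^sup>2" for x
          using norm_diff_square_le[of "f n x - f' x" "g n x - g' x"] by (simp add: algebra_simps)
      qed (intro Bochner_Integration.integrable_add integrable_mult_right
          square_integrableD(2) square_integrable_diff sq)+
      also have "\<dots> = ?b n"
      proof -
        have "integrable N (\<lambda>x. (norm (f n x - f' x))\<^sup>2)" "integrable N (\<lambda>x. (norm (g n x - g' x))\<^sup>2)"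
          by (intro square_integrableD(2) square_integrable_diff sq)+
        then show ?thesis by simp
      qed
      finally show "(\<integral>x. (norm ((f n x - g n x) - (f' x - g' x)))\<^sup>2 \<partial>N) \<le> ?b n" .
    qed
  qed auto
  then show ?thesis using sq by (simp add: L2_tendsto_def square_integrable_diff)
qed

section \<open>Paths of finite-state processes\<close>

definition cadlag_path :: "(real \<Rightarrow> 'd) \<Rightarrow> bool" where
  "cadlag_path a \<longleftrightarrow> (\<forall>t\<ge>0. \<forall>\<^sub>F s in at_right t. a s = a t) \<and>
     (\<forall>t>0. \<exists>i. \<forall>\<^sub>F s in at_left t. a s = i)"

lemma left_state_eqI:
  assumes "\<forall>\<^sub>F s in at_left t. \<alpha> s \<omega> = i"
  shows "left_state \<alpha> t \<omega> = i"
  unfolding left_state_def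
proof (rule the_equality)
  fix j assume "\<forall>\<^sub>F s in at_left t. \<alpha> s \<omega> = j"
  with assms have "\<forall>\<^sub>F s in at_left t. i = j" by eventually_elim simp
  then show "j = i" by simp
qed fact

lemma eventually_left_state:
  assumes "cadlag_path (\<lambda>s. \<alpha> s \<omega>)" "t > 0"
  shows "\<forall>\<^sub>F s in at_left t. \<alpha> s \<omega> = left_state \<alpha> t \<omega>"
  using assms left_state_eqI unfolding cadlag_path_def by metis

lemma left_state_eq_of_const:
  assumes "s < t" "\<And>r. s < r \<Longrightarrow> r < t \<Longrightarrow> \<alpha> r \<omega> = i"
  shows "left_state \<alpha> t \<omega> = i"
  by (rule left_state_eqI) (use assms in \<open>auto simp: eventually_at_left_field\<close>)

text \<open>Near every time the path is constant on either side, so jumps cannot accumulate; a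
  bisection argument then bounds their number on a compact interval.\<close>

lemma finite_jumps:
  assumes path: "cadlag_path (\<lambda>s. \<alpha> s \<omega>)"
  shows "finite {s\<in>{0<..t}. left_state \<alpha> s \<omega> \<noteq> \<alpha> s \<omega>}"
proof (cases "0 \<le> t")
  case True
  define J where "J = {s. 0 < s \<and> left_state \<alpha> s \<omega> \<noteq> \<alpha> s \<omega>}"
  have "finite (J \<inter> {0<..t})"
    using True
  proof (induction rule: Bolzano)
    case (trans a b c)
    have "J \<inter> {a<..c} = (J \<inter> {a<..b}) \<union> (J \<inter> {b<..c})" using trans by auto
    then show ?case using trans by simp
  next
    case (local x)
    have "\<exists>d>0. \<forall>s. x < s \<and> s < x + d \<longrightarrow> s \<notin> J"
    proof -
      have "\<forall>\<^sub>F s in at_right x. \<alpha> s \<omega> = \<alpha> x \<omega>"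
        using path local by (simp add: cadlag_path_def)
      then obtain b where b: "b > x" "\<And>s. x < s \<Longrightarrow> s < b \<Longrightarrow> \<alpha> s \<omega> = \<alpha> x \<omega>"
        by (auto simp: eventually_at_right_field)
      have "s \<notin> J" if "x < s" "s < x + (b - x)" for s
        unfolding J_def using left_state_eq_of_const[of x s \<alpha> \<omega> "\<alpha> x \<omega>"] b that by auto
      then show ?thesis using b by (intro exI[of _ "b - x"]) auto
    qed
    then obtain d1 where d1: "d1 > 0" "\<And>s. x < s \<Longrightarrow> s < x + d1 \<Longrightarrow> s \<notin> J" by blast
    have "\<exists>d>0. \<forall>s. x - d < s \<and> s < x \<longrightarrow> s \<notin> J"
    proof (cases "x = 0")
      case True
      then show ?thesis by (intro exI[of _ 1]) (auto simp: J_def)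
    next
      case False
      then have "\<forall>\<^sub>F s in at_left x. \<alpha> s \<omega> = left_state \<alpha> x \<omega>"
        using eventually_left_state[where \<alpha>=\<alpha> and \<omega>=\<omega>, OF path, of x] local by simp
      then obtain b where b: "b < x" "\<And>s. b < s \<Longrightarrow> s < x \<Longrightarrow> \<alpha> s \<omega> = left_state \<alpha> x \<omega>"
        by (auto simp: eventually_at_left_field)
      have "s \<notin> J" if "x - (x - b) < s" "s < x" for s
        unfolding J_def using left_state_eq_of_const[of b s \<alpha> \<omega> "left_state \<alpha> x \<omega>"] b that by auto
      then show ?thesis using b by (intro exI[of _ "x - b"]) auto
    qed
    then obtain d2 where d2: "d2 > 0" "\<And>s. x - d2 < s \<Longrightarrow> s < x \<Longrightarrow> s \<notin> J" by blast
    show ?case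
    proof (intro exI[of _ "min d1 d2"] conjI allI impI)
      fix a b assume ab: "a \<le> x \<and> x \<le> b \<and> b - a < min d1 d2"
      have "J \<inter> {a<..b} \<subseteq> {x}"
      proof
        fix s assume s: "s \<in> J \<inter> {a<..b}"
        show "s \<in> {x}" using d1(2)[of s] d2(2)[of s] s ab by (cases s x rule: linorder_cases) auto
      qed
      then show "finite (J \<inter> {a<..b})" by (rule finite_subset) simp
    qed (use d1 d2 in auto)
  qed
  then show ?thesis by (rule finite_subset[rotated]) (auto simp: J_def)
qed simp

lemma countable_jumps:
  assumes path: "cadlag_path (\<lambda>s. \<alpha> s \<omega>)"
  shows "countable {s. 0 < s \<and> left_state \<alpha> s \<omega> \<noteq> \<alpha> s \<omega>}"
proof -
  have "{s. 0 < s \<and> left_state \<alpha> s \<omega> \<noteq> \<alpha> s \<omega>}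
     \<subseteq> (\<Union>n::nat. {s\<in>{0<..real n}. left_state \<alpha> s \<omega> \<noteq> \<alpha> s \<omega>})"
    using real_arch_simple by auto
  then show ?thesis
    by (rule countable_subset)
      (rule countable_UN, simp, rule countable_finite, rule finite_jumps[where \<alpha>=\<alpha> and \<omega>=\<omega>, OF path])
qed

section \<open>The driving processes\<close>

lemma space_process_sigma [simp]: "space (process_sigma M N X I) = space M"
  by (simp add: process_sigma_def space_measure_of_conv)

lemma sets_process_sigma:
  "sets (process_sigma M N X I)
    = sigma_sets (space M) {X s -` B \<inter> space M | s B. s \<in> I \<and> B \<in> sets N}"
  unfolding process_sigma_def by (rule sets_measure_of) auto

lemma process_sigma_mono: "I \<subseteq> J \<Longrightarrow> sets (process_sigma M N X I) \<subseteq> sets (process_sigma M N X J)"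
  unfolding sets_process_sigma by (rule sigma_sets_mono') auto

lemma process_sigma_subset:
  assumes "\<And>s. s \<in> I \<Longrightarrow> X s \<in> measurable M N"
  shows "sets (process_sigma M N X I) \<subseteq> sets M"
  unfolding sets_process_sigma using assms
  by (intro sets.sigma_sets_subset) (auto intro: measurable_sets)

lemma measurable_process_sigma:
  assumes "s \<in> I" "X s \<in> space M \<rightarrow> space N"
  shows "X s \<in> measurable (process_sigma M N X I) N"
  using assms by (intro measurableI) (auto simp: sets_process_sigma intro!: sigma_sets.Basic)

lemma measurable_sets_mono:
  assumes "f \<in> measurable N K" "sets N \<subseteq> sets N'" "space N' = space N"
  shows "f \<in> measurable N' K"
  using assms by (auto simp: measurable_def)

lemma sigma_sets_vimage_subset:
  assumes "f \<in> measurable N K"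
  shows "sigma_sets (space N) {f -` A \<inter> space N |A. A \<in> sets K} \<subseteq> sets N"
  using assms by (intro sets.sigma_sets_subset) (auto intro: measurable_sets)

lemma set_integrable_of_integrable:
  fixes f :: "'a \<Rightarrow> 'v::euclidean_space"
  shows "integrable N f \<Longrightarrow> X \<in> sets N \<Longrightarrow> set_integrable N X f"
  unfolding set_integrable_def by (rule integrable_mult_indicator)

context regime_switching_space
begin

lemma cadlag_chain: "\<omega> \<in> space M \<Longrightarrow> cadlag_path (\<lambda>s. \<alpha> s \<omega>)"
  using chain by (simp add: markov_chain_def cadlag_path_def)

lemma chain_zero: "\<omega> \<in> space M \<Longrightarrow> \<alpha> 0 \<omega> = i\<^sub>0"
  using chain by (simp add: markov_chain_def)

lemma measurable_chain [measurable]: "t \<ge> 0 \<Longrightarrow> \<alpha> t \<in> measurable M (count_space UNIV)"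
  using chain by (simp add: markov_chain_def)

lemma measurable_brownian [measurable]: "t \<ge> 0 \<Longrightarrow> W t \<in> borel_measurable M"
  using brownian by (simp add: brownian_motion_def)

abbreviation "past_W t \<equiv> process_sigma M borel W {0..t}"
abbreviation "past_chain t \<equiv> process_sigma M (count_space UNIV) \<alpha> {0..t}"
abbreviation "all_W \<equiv> process_sigma M borel W {0..}"
abbreviation "all_chain \<equiv> process_sigma M (count_space UNIV) \<alpha> {0..}"
abbreviation "\<F> \<equiv> filtr M W \<alpha>"

text \<open>The filtration \<open>\<F>\<close> enlarged by the whole future of the chain.  As the chain is independent
  of \<open>W\<close>, the process \<open>W\<close> keeps independent increments; and a weight that depends on
  the chain, at whatever time, may be treated as if it were deterministic.\<close>

definition enlarged :: "real \<Rightarrow> 'w measure" where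
  "enlarged t = sigma (space M) (sets (past_W t) \<union> sets all_chain \<union> null_sets M)"

lemma sets_all_W: "sets all_W \<subseteq> sets M"
  by (rule process_sigma_subset) (simp add: measurable_brownian measurable_chain)

lemma sets_all_chain: "sets all_chain \<subseteq> sets M"
  by (rule process_sigma_subset) (simp add: measurable_brownian measurable_chain)

lemma sets_past_W: "sets (past_W t) \<subseteq> sets M"
  by (rule process_sigma_subset) (simp add: measurable_brownian measurable_chain)

lemma sets_past_chain: "sets (past_chain t) \<subseteq> sets M"
  by (rule process_sigma_subset) (simp add: measurable_brownian measurable_chain)

lemma filtr_generators:
  "sets (past_W t) \<union> sets (past_chain t) \<union> null_sets M \<subseteq> Pow (space M)"
  using sets_past_W[of t] sets_past_chain[of t] sets.space_closed[of M]
  by (auto dest: sets.sets_into_space)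

lemma enlarged_generators:
  "sets (past_W t) \<union> sets all_chain \<union> null_sets M \<subseteq> Pow (space M)"
  using sets_past_W[of t] sets_all_chain sets.space_closed[of M]
  by (auto dest: sets.sets_into_space)

lemma space_filtr [simp]: "space (\<F> t) = space M"
  by (simp add: filtr_def space_measure_of_conv)

lemma space_enlarged [simp]: "space (enlarged t) = space M"
  by (simp add: enlarged_def space_measure_of_conv)

lemma sets_filtr:
  "sets (\<F> t) = sigma_sets (space M) (sets (past_W t) \<union> sets (past_chain t) \<union> null_sets M)"
  unfolding filtr_def by (rule sets_measure_of[OF filtr_generators])

lemma sets_enlarged:
  "sets (enlarged t) = sigma_sets (space M) (sets (past_W t) \<union> sets all_chain \<union> null_sets M)"
  unfolding enlarged_def by (rule sets_measure_of[OF enlarged_generators])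

lemma filtr_subset: "sets (\<F> t) \<subseteq> sets M"
  unfolding sets_filtr using sets_past_W[of t] sets_past_chain[of t]
  by (intro sets.sigma_sets_subset) auto

lemma enlarged_subset: "sets (enlarged t) \<subseteq> sets M"
  unfolding sets_enlarged using sets_past_W[of t] sets_all_chain
  by (intro sets.sigma_sets_subset) auto

lemma filtr_enlarged:
  assumes "s \<le> t"
  shows "sets (\<F> s) \<subseteq> sets (enlarged t)"
  unfolding sets_filtr sets_enlarged
  using process_sigma_mono[of "{0..s}" "{0..t}" M borel W] assms
    process_sigma_mono[of "{0..s}" "{0..}" M "count_space UNIV" \<alpha>]
  by (intro sigma_sets_mono') auto

lemma enlarged_mono:
  assumes "s \<le> t"
  shows "sets (enlarged s) \<subseteq> sets (enlarged t)"
  unfolding sets_enlarged using process_sigma_mono[of "{0..s}" "{0..t}" M borel W] assms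
  by (intro sigma_sets_mono') auto

lemma filtr_mono:
  assumes "s \<le> t"
  shows "sets (\<F> s) \<subseteq> sets (\<F> t)"
  unfolding sets_filtr using assms
    process_sigma_mono[of "{0..s}" "{0..t}" M borel W]
    process_sigma_mono[of "{0..s}" "{0..t}" M "count_space UNIV" \<alpha>]
  by (intro sigma_sets_mono') auto

lemma measurable_filtrD: "f \<in> measurable (\<F> t) N \<Longrightarrow> f \<in> measurable M N"
  by (erule measurable_sets_mono[OF _ filtr_subset]) simp

lemma measurable_enlargedD: "f \<in> measurable (enlarged t) N \<Longrightarrow> f \<in> measurable M N"
  by (erule measurable_sets_mono[OF _ enlarged_subset]) simp

lemma measurable_filtr_enlarged: "f \<in> measurable (\<F> s) N \<Longrightarrow> s \<le> t \<Longrightarrow> f \<in> measurable (enlarged t) N"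
  by (erule measurable_sets_mono[OF _ filtr_enlarged]) simp_all

lemma measurable_enlarged_mono:
  "f \<in> measurable (enlarged s) N \<Longrightarrow> s \<le> t \<Longrightarrow> f \<in> measurable (enlarged t) N"
  by (erule measurable_sets_mono[OF _ enlarged_mono]) simp_all

lemma measurable_chain_past: "0 \<le> s \<Longrightarrow> s \<le> t \<Longrightarrow> \<alpha> s \<in> measurable (past_chain t) (count_space UNIV)"
  by (rule measurable_process_sigma) auto

lemma measurable_chain_all: "0 \<le> s \<Longrightarrow> \<alpha> s \<in> measurable all_chain (count_space UNIV)"
  by (rule measurable_process_sigma) auto

lemma measurable_all_chain_enlarged: "f \<in> measurable all_chain N \<Longrightarrow> f \<in> measurable (enlarged t) N"
  by (erule measurable_sets_mono) (auto simp: sets_enlarged)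

lemma measurable_chain_enlarged: "0 \<le> s \<Longrightarrow> \<alpha> s \<in> measurable (enlarged t) (count_space UNIV)"
  by (intro measurable_all_chain_enlarged measurable_chain_all)

lemma measurable_chain_filtr: "0 \<le> s \<Longrightarrow> s \<le> t \<Longrightarrow> \<alpha> s \<in> measurable (\<F> t) (count_space UNIV)"
  by (rule measurable_sets_mono[OF measurable_chain_past]) (auto simp: sets_filtr)

subsection \<open>Independence of the increments\<close>

text \<open>Intersections of an event of the past of \<open>W\<close>, an event of the chain and an event of probability
  \<open>0\<close> or \<open>1\<close> are closed under intersection and generate the augmented filtrations.  On such
  intersections independence is a product formula, and it extends to the generated
  \<open>\<sigma>\<close>-algebra.\<close>

definition trivial_events :: "'w set set" where
  "trivial_events = {N \<in> sets M. prob N = 0 \<or> prob N = 1}"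

lemma null_sets_trivial: "null_sets M \<subseteq> trivial_events"
  by (auto simp: trivial_events_def null_sets_def measure_def)

lemma space_trivial: "space M \<in> trivial_events"
  by (simp add: trivial_events_def prob_space)

lemma trivial_events_Int:
  assumes "A \<in> trivial_events" "B \<in> trivial_events"
  shows "A \<inter> B \<in> trivial_events"
proof -
  have [measurable]: "A \<in> sets M" "B \<in> sets M" using assms by (auto simp: trivial_events_def)
  consider "prob A = 0" | "prob B = 0" | "prob A = 1" "prob B = 1"
    using assms by (auto simp: trivial_events_def)
  then show ?thesis
  proof cases
    case 1
    then have "prob (A \<inter> B) = 0"
      using finite_measure_mono[of "A \<inter> B" A] by (simp add: measure_le_0_iff)
    then show ?thesis by (simp add: trivial_events_def)
  next
    case 2
    then have "prob (A \<inter> B) = 0"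
      using finite_measure_mono[of "A \<inter> B" B] by (simp add: measure_le_0_iff)
    then show ?thesis by (simp add: trivial_events_def)
  next
    case 3
    then have "AE x in M. x \<in> A" "AE x in M. x \<in> B" by (simp_all add: AE_in_set_eq_1)
    then have "AE x in M. x \<in> A \<inter> B" by eventually_elim auto
    then have "prob (A \<inter> B) = 1" by (subst (asm) AE_in_set_eq_1) auto
    then show ?thesis by (simp add: trivial_events_def)
  qed
qed

lemma prob_Int_trivial:
  assumes "N \<in> trivial_events" and [measurable]: "A \<in> sets M"
  shows "prob (A \<inter> N) = prob A * prob N"
proof -
  have [measurable]: "N \<in> sets M" and "prob N = 0 \<or> prob N = 1"
    using assms by (auto simp: trivial_events_def)
  from this(2) show ?thesis
  proof
    assume "prob N = 0"
    then show ?thesis using finite_measure_mono[of "A \<inter> N" N] by (simp add: measure_le_0_iff)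
  next
    assume 1: "prob N = 1"
    then have "AE x in M. x \<in> N" by (simp add: AE_in_set_eq_1)
    then have "prob (A \<inter> N) = prob A" by (intro finite_measure_eq_AE) auto
    then show ?thesis using 1 by simp
  qed
qed

definition boxes :: "'w set set \<Rightarrow> 'w set set \<Rightarrow> 'w set set" where
  "boxes \<A> \<B> = {A \<inter> B \<inter> N | A B N. A \<in> \<A> \<and> B \<in> \<B> \<and> N \<in> trivial_events}"

lemma Int_stable_boxes:
  assumes "\<And>A A'. A \<in> \<A> \<Longrightarrow> A' \<in> \<A> \<Longrightarrow> A \<inter> A' \<in> \<A>" "\<And>B B'. B \<in> \<B> \<Longrightarrow> B' \<in> \<B> \<Longrightarrow> B \<inter> B' \<in> \<B>"
  shows "Int_stable (boxes \<A> \<B>)"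
proof (rule Int_stableI)
  fix a b assume "a \<in> boxes \<A> \<B>" "b \<in> boxes \<A> \<B>"
  then obtain A B N A' B' N' where *: "a = A \<inter> B \<inter> N" "b = A' \<inter> B' \<inter> N'" "A \<in> \<A>" "A' \<in> \<A>"
    "B \<in> \<B>" "B' \<in> \<B>" "N \<in> trivial_events" "N' \<in> trivial_events"
    by (auto simp: boxes_def)
  have "a \<inter> b = (A \<inter> A') \<inter> (B \<inter> B') \<inter> (N \<inter> N')" using * by auto
  moreover have "A \<inter> A' \<in> \<A>" "B \<inter> B' \<in> \<B>" "N \<inter> N' \<in> trivial_events"
    using * assms trivial_events_Int by auto
  ultimately show "a \<inter> b \<in> boxes \<A> \<B>" unfolding boxes_def by blast
qed

lemma boxes_subset:
  assumes "\<A> \<subseteq> sets M" "\<B> \<subseteq> sets M"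
  shows "boxes \<A> \<B> \<subseteq> sets M"
proof
  fix a assume "a \<in> boxes \<A> \<B>"
  then obtain A B N where "a = A \<inter> B \<inter> N" "A \<in> \<A>" "B \<in> \<B>" "N \<in> trivial_events"
    by (auto simp: boxes_def)
  then show "a \<in> sets M" using subsetD[OF assms(1)] subsetD[OF assms(2)]
    by (auto simp: trivial_events_def)
qed

lemma boxesI: "A \<in> \<A> \<Longrightarrow> B \<in> \<B> \<Longrightarrow> N \<in> trivial_events \<Longrightarrow> A \<inter> B \<inter> N \<in> boxes \<A> \<B>"
  unfolding boxes_def by blast

lemma generators_boxes:
  assumes "\<A> \<subseteq> sets M" "\<B> \<subseteq> sets M" "space M \<in> \<A>" "space M \<in> \<B>"
  shows "\<A> \<union> \<B> \<union> null_sets M \<subseteq> boxes \<A> \<B>"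
proof -
  have "A \<in> boxes \<A> \<B>" if "A \<in> \<A>" for A
    using boxesI[OF that assms(4) space_trivial] sets.sets_into_space[OF subsetD[OF assms(1) that]]
    by (simp add: Int_absorb2)
  moreover have "B \<in> boxes \<A> \<B>" if "B \<in> \<B>" for B
    using boxesI[OF assms(3) that space_trivial] sets.sets_into_space[OF subsetD[OF assms(2) that]]
    by (simp add: Int_absorb1 Int_absorb2)
  moreover have "N \<in> boxes \<A> \<B>" if "N \<in> null_sets M" for N
    using boxesI[OF assms(3,4) subsetD[OF null_sets_trivial that]] sets.sets_into_space[of N M] that
    by (simp add: Int_absorb1 null_setsD2)
  ultimately show ?thesis by auto
qed

text \<open>For \<open>A\<close> in the past of \<open>W\<close>, \<open>B\<close> an event of the chain and \<open>C\<close> an event of the increment, first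
  \<open>A \<inter> C\<close> is separated from \<open>B\<close> by the independence of \<open>W\<close> and \<open>\<alpha>\<close>, then \<open>A\<close> from \<open>C\<close> by the
  independent increments of \<open>W\<close>.\<close>

lemma indep_enlarged_increment:
  assumes "0 \<le> s" "s < r"
  shows "indep_set (sets (enlarged s)) (sets (vimage_algebra (space M) (\<lambda>\<omega>. W r \<omega> - W s \<omega>) borel))"
proof -
  let ?V = "vimage_algebra (space M) (\<lambda>\<omega>. W r \<omega> - W s \<omega>) borel"
  have inc: "(\<lambda>\<omega>. W r \<omega> - W s \<omega>) \<in> borel_measurable all_W"
    using assms measurable_process_sigma[of _ "{0..}" W M borel]
    by (intro borel_measurable_diff) auto
  have V: "sets ?V \<subseteq> sets all_W"
  proof
    fix C assume "C \<in> sets ?V"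
    then obtain B where "B \<in> sets borel" "C = (\<lambda>\<omega>. W r \<omega> - W s \<omega>) -` B \<inter> space M"
      by (auto simp: sets_vimage_algebra2)
    then show "C \<in> sets all_W" using measurable_sets[OF inc] by simp
  qed
  then have VM: "sets ?V \<subseteq> sets M" using sets_all_W by (rule subset_trans)
  have past: "sets (past_W s) \<subseteq> sets all_W" by (rule process_sigma_mono) auto
  let ?B = "boxes (sets (past_W s)) (sets all_chain)"
  have BM: "?B \<subseteq> sets M" using sets_past_W sets_all_chain by (rule boxes_subset)
  have W_incr: "prob (A \<inter> C) = prob A * prob C" if "A \<in> sets (past_W s)" "C \<in> sets ?V" for A C
    using brownian assms that by (intro indep_setD) (auto simp: brownian_motion_def)
  have W_chain: "prob (A \<inter> B) = prob A * prob B" if "A \<in> sets all_W" "B \<in> sets all_chain" for A B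
    using independent that by (intro indep_setD)
  have "indep_set ?B (sets ?V)"
  proof (rule indep_setI)
    fix a C assume "a \<in> ?B" and C: "C \<in> sets ?V"
    then obtain A B N where a: "a = A \<inter> B \<inter> N" and A: "A \<in> sets (past_W s)"
      and B: "B \<in> sets all_chain" and N: "N \<in> trivial_events"
      by (auto simp: boxes_def)
    have M: "A \<in> sets M" "B \<in> sets M" "C \<in> sets M"
      using subsetD[OF sets_past_W A] subsetD[OF sets_all_chain B] subsetD[OF VM C] by auto
    have AW: "A \<in> sets all_W" using subsetD[OF past A] .
    have AC: "A \<inter> C \<in> sets all_W" using AW subsetD[OF V C] by (rule sets.Int)
    have "prob (a \<inter> C) = prob ((A \<inter> C) \<inter> B \<inter> N)"
      unfolding a by (rule arg_cong[where f=prob]) auto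
    also have "\<dots> = prob A * prob C * prob B * prob N"
      using M by (simp add: prob_Int_trivial[OF N] W_chain[OF AC B] W_incr[OF A C])
    also have "\<dots> = prob a * prob C"
      unfolding a using M by (simp add: prob_Int_trivial[OF N] W_chain[OF AW B])
    finally show "prob (a \<inter> C) = prob a * prob C" .
  qed (use BM VM in auto)
  then have ind: "indep_set (sigma_sets (space M) ?B) (sigma_sets (space M) (sets ?V))"
    by (rule indep_set_sigma_sets)
      (auto intro!: Int_stable_boxes sets.Int simp: sets.Int_stable)
  have "sets (enlarged s) \<subseteq> sigma_sets (space M) ?B"
    unfolding sets_enlarged
    using generators_boxes[OF sets_past_W[of s] sets_all_chain] sets.top[of "past_W s"]
      sets.top[of all_chain]
    by (intro sigma_sets_mono') simp
  moreover have "sigma_sets (space M) (sets ?V) = sets ?V"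
    using sets.sigma_sets_eq[of ?V] by simp
  ultimately show ?thesis
    using indep_setD[OF ind] enlarged_subset[of s] VM by (intro indep_setI) auto
qed

lemma indep_var_increment:
  assumes "0 \<le> s" "s < r" and Z: "Z \<in> borel_measurable (enlarged s)"
  shows "indep_var borel Z borel (\<lambda>\<omega>. W r \<omega> - W s \<omega>)"
proof -
  let ?V = "vimage_algebra (space M) (\<lambda>\<omega>. W r \<omega> - W s \<omega>) borel"
  have "sigma_sets (space M) {Z -` A \<inter> space M |A. A \<in> sets borel} \<subseteq> sets (enlarged s)"
    using sigma_sets_vimage_subset[OF Z] by simp
  moreover have "sigma_sets (space M) {(\<lambda>\<omega>. W r \<omega> - W s \<omega>) -` A \<inter> space M |A. A \<in> sets borel} \<subseteq> sets ?V"
    using sigma_sets_vimage_subset[OF measurable_vimage_algebra1, of "\<lambda>\<omega>. W r \<omega> - W s \<omega>" "space M" borel]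
    by simp
  ultimately show ?thesis
    unfolding indep_var_eq
    using assms measurable_enlargedD[OF Z]
      indep_setD[OF indep_enlarged_increment[OF assms(1,2)]]
      indep_setD_ev1[OF indep_enlarged_increment[OF assms(1,2)]]
      indep_setD_ev2[OF indep_enlarged_increment[OF assms(1,2)]]
    by (intro conjI indep_setI) auto
qed

lemma increment_moments:
  assumes "0 \<le> s" "s \<le> r"
  shows "integrable M (\<lambda>\<omega>. W r \<omega> - W s \<omega>)" "expectation (\<lambda>\<omega>. W r \<omega> - W s \<omega>) = 0"
    "integrable M (\<lambda>\<omega>. (W r \<omega> - W s \<omega>)\<^sup>2)" "expectation (\<lambda>\<omega>. (W r \<omega> - W s \<omega>)\<^sup>2) = r - s"
proof -
  have "integrable M (\<lambda>\<omega>. W r \<omega> - W s \<omega>) \<and> expectation (\<lambda>\<omega>. W r \<omega> - W s \<omega>) = 0 \<and>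
    integrable M (\<lambda>\<omega>. (W r \<omega> - W s \<omega>)\<^sup>2) \<and> expectation (\<lambda>\<omega>. (W r \<omega> - W s \<omega>)\<^sup>2) = r - s"
  proof (cases "s = r")
    case False
    then have D: "distributed M lborel (\<lambda>\<omega>. W r \<omega> - W s \<omega>) (normal_density 0 (sqrt (r - s)))"
      and pos: "0 < sqrt (r - s)"
      using brownian assms by (auto simp: brownian_motion_def)
    have 1: "integrable M (\<lambda>\<omega>. W r \<omega> - W s \<omega>)"
      using distributed_integrable[OF D, of "\<lambda>x. x"] integrable_normal_moment[OF pos, of 0 1] by simp
    have 2: "integrable M (\<lambda>\<omega>. (W r \<omega> - W s \<omega>)\<^sup>2)"
      using distributed_integrable[OF D, of "\<lambda>x. x\<^sup>2"] integrable_normal_moment[OF pos, of 0 2] by simp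
    have 3: "expectation (\<lambda>\<omega>. W r \<omega> - W s \<omega>) = 0"
      using normal_distributed_expectation[OF pos D] .
    have "expectation (\<lambda>\<omega>. (W r \<omega> - W s \<omega>)\<^sup>2) = r - s"
      using normal_distributed_variance[OF pos D] 3 assms by simp
    with 1 2 3 show ?thesis by blast
  qed simp
  then show "integrable M (\<lambda>\<omega>. W r \<omega> - W s \<omega>)" "expectation (\<lambda>\<omega>. W r \<omega> - W s \<omega>) = 0"
    "integrable M (\<lambda>\<omega>. (W r \<omega> - W s \<omega>)\<^sup>2)" "expectation (\<lambda>\<omega>. (W r \<omega> - W s \<omega>)\<^sup>2) = r - s"
    by auto
qed

lemma expectation_mult_increment:
  fixes Z :: "'w \<Rightarrow> real"
  assumes "0 \<le> s" "s \<le> r" "Z \<in> borel_measurable (enlarged s)" "integrable M Z"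
  shows "integrable M (\<lambda>\<omega>. Z \<omega> * (W r \<omega> - W s \<omega>))"
    and "expectation (\<lambda>\<omega>. Z \<omega> * (W r \<omega> - W s \<omega>)) = 0"
    and "integrable M (\<lambda>\<omega>. Z \<omega> * (W r \<omega> - W s \<omega>)\<^sup>2)"
    and "expectation (\<lambda>\<omega>. Z \<omega> * (W r \<omega> - W s \<omega>)\<^sup>2) = (r - s) * expectation Z"
proof -
  note m = increment_moments[OF assms(1,2)]
  have *: "integrable M (\<lambda>\<omega>. Z \<omega> * (W r \<omega> - W s \<omega>)) \<and>
    expectation (\<lambda>\<omega>. Z \<omega> * (W r \<omega> - W s \<omega>)) = 0 \<and>
    integrable M (\<lambda>\<omega>. Z \<omega> * (W r \<omega> - W s \<omega>)\<^sup>2) \<and>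
    expectation (\<lambda>\<omega>. Z \<omega> * (W r \<omega> - W s \<omega>)\<^sup>2) = (r - s) * expectation Z"
  proof (cases "s = r")
    case False
    then have ind: "indep_var borel Z borel (\<lambda>\<omega>. W r \<omega> - W s \<omega>)"
      using assms by (intro indep_var_increment) auto
    have ind2: "indep_var borel Z borel (\<lambda>\<omega>. (W r \<omega> - W s \<omega>)\<^sup>2)"
      using indep_var_compose[OF ind, of "\<lambda>x. x" borel "\<lambda>x. x\<^sup>2" borel] by (simp add: comp_def)
    show ?thesis
      using indep_var_integrable[OF ind assms(4) m(1)] indep_var_lebesgue_integral[OF ind assms(4) m(1)]
        indep_var_integrable[OF ind2 assms(4) m(3)] indep_var_lebesgue_integral[OF ind2 assms(4) m(3)]
        m by simp
  qed simp
  show "integrable M (\<lambda>\<omega>. Z \<omega> * (W r \<omega> - W s \<omega>))"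
    "expectation (\<lambda>\<omega>. Z \<omega> * (W r \<omega> - W s \<omega>)) = 0"
    "integrable M (\<lambda>\<omega>. Z \<omega> * (W r \<omega> - W s \<omega>)\<^sup>2)"
    "expectation (\<lambda>\<omega>. Z \<omega> * (W r \<omega> - W s \<omega>)\<^sup>2) = (r - s) * expectation Z"
    using * by auto
qed

subsection \<open>The Markov property\<close>

text \<open>A function of the chain whose conditional mean given the past of the chain vanishes also has
  conditional mean zero given the past of both processes.\<close>

lemma integral_filtr_set_eq_0:
  fixes f :: "'w \<Rightarrow> real"
  assumes f: "f \<in> borel_measurable all_chain" "integrable M f"
    and zero: "\<And>B. B \<in> sets (past_chain t) \<Longrightarrow> (LINT \<omega>:B|M. f \<omega>) = 0"
    and E: "E \<in> sets (\<F> t)"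
  shows "(LINT \<omega>:E|M. f \<omega>) = 0"
proof -
  let ?B = "boxes (sets (past_W t)) (sets (past_chain t))"
  have BM: "?B \<subseteq> sets M" using sets_past_W sets_past_chain by (rule boxes_subset)
  have E': "E \<in> sigma_sets (space M) ?B"
    using E generators_boxes[OF sets_past_W[of t] sets_past_chain[of t]]
      sets.top[of "past_W t"] sets.top[of "past_chain t"]
      sigma_sets_mono'[of "sets (past_W t) \<union> sets (past_chain t) \<union> null_sets M" ?B "space M"]
    unfolding sets_filtr by auto
  have "Int_stable ?B" by (intro Int_stable_boxes) auto
  moreover have "?B \<subseteq> Pow (space M)" using BM sets.space_closed[of M] by (rule subset_trans)
  ultimately have "E \<in> sets M \<and> (LINT \<omega>:E|M. f \<omega>) = 0"
    using E'
  proof (induction rule: sigma_sets_induct_disjoint)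
    case (basic a)
    then obtain A B N where a: "a = A \<inter> B \<inter> N" and A: "A \<in> sets (past_W t)"
      and B: "B \<in> sets (past_chain t)" and N: "N \<in> trivial_events"
      by (auto simp: boxes_def)
    have M [measurable]: "A \<in> sets M" "B \<in> sets M" "N \<in> sets M"
      using subsetD[OF sets_past_W A] subsetD[OF sets_past_chain B] N
      by (auto simp: trivial_events_def)
    have [measurable]: "f \<in> borel_measurable M" using f by auto
    have "(LINT \<omega>:a|M. f \<omega>) = 0"
    proof (cases "prob N = 0")
      case True
      then have "AE \<omega> in M. \<omega> \<notin> N"
        using M by (intro AE_not_in) (auto simp: null_sets_def emeasure_eq_measure)
      then have "(LINT \<omega>:a|M. f \<omega>) = (LINT \<omega>|M. 0)"
        unfolding a set_lebesgue_integral_def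
        by (intro integral_cong_AE) (auto simp: indicator_def)
      then show ?thesis by simp
    next
      case False
      then have "AE \<omega> in M. \<omega> \<in> N" using N by (auto simp: trivial_events_def AE_in_set_eq_1)
      then have "(LINT \<omega>:a|M. f \<omega>) = (LINT \<omega>|M. indicator A \<omega> * (indicator B \<omega> * f \<omega>))"
        unfolding a set_lebesgue_integral_def
        by (intro integral_cong_AE) (auto simp: indicator_def)
      also have "\<dots> = (LINT \<omega>|M. indicator A \<omega>) * (LINT \<omega>|M. indicator B \<omega> * f \<omega>)"
      proof (rule indep_var_lebesgue_integral)
        have A': "A \<in> sets all_W"
          using A process_sigma_mono[of "{0..t}" "{0..}" M borel W] by auto
        have B': "B \<in> sets all_chain"
          using B process_sigma_mono[of "{0..t}" "{0..}" M "count_space UNIV" \<alpha>] by auto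
        have mA: "(indicator A :: _ \<Rightarrow> real) \<in> borel_measurable all_W" using A' by simp
        have mB: "(\<lambda>\<omega>. indicator B \<omega> * f \<omega>) \<in> borel_measurable all_chain" using f(1) B' by simp
        have 1: "sigma_sets (space M) {(indicator A :: _ \<Rightarrow> real) -` Aa \<inter> space M |Aa. Aa \<in> sets borel} \<subseteq> sets all_W"
          using sigma_sets_vimage_subset[OF mA] by simp
        have 2: "sigma_sets (space M) {(\<lambda>\<omega>. indicator B \<omega> * f \<omega>) -` Aa \<inter> space M |Aa. Aa \<in> sets borel} \<subseteq> sets all_chain"
          using sigma_sets_vimage_subset[OF mB] by simp
        show "indep_var borel (indicator A :: _ \<Rightarrow> real) borel (\<lambda>\<omega>. indicator B \<omega> * f \<omega>)"
          unfolding indep_var_eq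
          using 1 2 indep_setD[OF independent] sets_all_W sets_all_chain
          by (intro conjI indep_setI) auto
        show "integrable M (\<lambda>\<omega>. indicator B \<omega> * f \<omega>)"
          using integrable_mult_indicator[OF M(2) f(2)] by simp
        show "integrable M (indicator A :: _ \<Rightarrow> real)"
          by (rule integrable_const_bound[where B=1]) (auto simp: indicator_def)
      qed
      also have "(LINT \<omega>|M. indicator B \<omega> * f \<omega>) = 0"
        using zero[OF B] by (simp add: set_lebesgue_integral_def)
      finally show ?thesis by simp
    qed
    then show ?case using subsetD[OF BM basic] by simp
  next
    case (compl A)
    have tot: "(LINT \<omega>:space M|M. f \<omega>) = 0"
      using zero[of "space M"] sets.top[of "past_chain t"] by simp
    have int: "set_integrable M X f" if "X \<in> sets M" for X
      using f(2) that by (rule set_integrable_of_integrable)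
    have "(LINT \<omega>:space M|M. f \<omega>) = (LINT \<omega>:(space M - A)|M. f \<omega>) + (LINT \<omega>:A|M. f \<omega>)"
      using compl int sets.sets_into_space[of A M]
      by (subst set_integral_Un[symmetric]) (auto intro!: arg_cong2[where f="\<lambda>X. set_lebesgue_integral M X"] simp: Un_absorb2)
    then show ?case using tot compl by auto
  next
    case (union A)
    have int: "set_integrable M X f" if "X \<in> sets M" for X
      using f(2) that by (rule set_integrable_of_integrable)
    have "(LINT \<omega>:(\<Union>i. A i)|M. f \<omega>) = (\<Sum>i. LINT \<omega>:A i|M. f \<omega>)"
      using union by (intro lebesgue_integral_countable_add int) (auto simp: disjoint_family_on_def)
    then show ?case using union by auto
  next
    case empty
    then show ?case by (simp add: set_lebesgue_integral_def)
  qed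
  then show ?thesis by simp
qed

text \<open>The chain is Markov with respect to the filtration that also contains the past of \<open>W\<close>,
  because \<open>W\<close> is independent of the chain.\<close>

lemma markov_property:
  obtains p where "transition_function \<pi> p" "\<And>i j. \<exists>t\<ge>0. 0 < p t i j"
    "\<And>s t j Y. 0 \<le> s \<Longrightarrow> 0 \<le> t \<Longrightarrow> Y \<in> borel_measurable (\<F> s) \<Longrightarrow> integrable M Y \<Longrightarrow>
       expectation (\<lambda>\<omega>. Y \<omega> * of_bool (\<alpha> (s + t) \<omega> = j)) = expectation (\<lambda>\<omega>. Y \<omega> * p t (\<alpha> s \<omega>) j)"
proof -
  obtain p where p: "transition_function \<pi> p" and irr: "\<forall>i j. \<exists>t\<ge>0. 0 < p t i j"
    and mark: "\<forall>s\<ge>0. \<forall>t\<ge>0. \<forall>j. AE \<omega> in M. real_cond_exp M (past_chain s)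
             (indicator {\<omega>'\<in>space M. \<alpha> (s + t) \<omega>' = j}) \<omega> = p t (\<alpha> s \<omega>) j"
    using chain unfolding markov_chain_def by (elim conjE exE) (rule that)
  have "expectation (\<lambda>\<omega>. Y \<omega> * of_bool (\<alpha> (s + t) \<omega> = j)) = expectation (\<lambda>\<omega>. Y \<omega> * p t (\<alpha> s \<omega>) j)"
    if st: "0 \<le> s" "0 \<le> t" and Y: "Y \<in> borel_measurable (\<F> s)" "integrable M Y" for s t j Y
  proof -
    interpret P: finite_measure_subalgebra M "past_chain s"
      by standard (simp add: subalgebra_def sets_past_chain)
    interpret F: finite_measure_subalgebra M "\<F> s"
      by standard (simp add: subalgebra_def filtr_subset)
    define g :: "'w \<Rightarrow> real" where "g = indicator {\<omega>'\<in>space M. \<alpha> (s + t) \<omega>' = j}"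
    define q where "q = (\<lambda>\<omega>. p t (\<alpha> s \<omega>) j)"
    have [measurable]: "\<alpha> s \<in> measurable M (count_space UNIV)" "\<alpha> (s + t) \<in> measurable M (count_space UNIV)"
      using st by auto
    have [measurable]: "g \<in> borel_measurable M" "q \<in> borel_measurable M"
      unfolding g_def q_def by measurable
    have pb: "\<bar>p t i j\<bar> \<le> 1" for i
    proof -
      have "0 \<le> p t i k" for k using p st by (simp add: transition_function_def)
      moreover have "(\<Sum>k\<in>UNIV. p t i k) = 1" using p st by (simp add: transition_function_def)
      ultimately show ?thesis using member_le_sum[of j UNIV "p t i"] by auto
    qed
    have gi: "integrable M g"
      by (rule integrable_const_bound[where B=1]) (auto simp: g_def indicator_def)
    have qi: "integrable M q"
      by (rule integrable_const_bound[where B=1]) (auto simp: q_def pb)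
    have "AE \<omega> in M. real_cond_exp M (\<F> s) g \<omega> = q \<omega>"
    proof (rule F.real_cond_exp_charact)
      fix E assume E: "E \<in> sets (\<F> s)"
      have set_int: "set_integrable M X g" "set_integrable M X q" if "X \<in> sets M" for X
        using set_integrable_of_integrable[OF gi that] set_integrable_of_integrable[OF qi that] by auto
      have gm: "g \<in> borel_measurable all_chain"
      proof -
        have "{\<omega>' \<in> space M. \<alpha> (s + t) \<omega>' = j} = \<alpha> (s + t) -` {j} \<inter> space all_chain" by auto
        also have "\<dots> \<in> sets all_chain" using st by (intro measurable_sets[OF measurable_chain_all]) auto
        finally show ?thesis unfolding g_def by simp
      qed
      have qm: "q \<in> borel_measurable all_chain"
          unfolding q_def by (rule measurable_compose[OF measurable_chain_all[OF st(1)]]) simp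
      have "(LINT \<omega>:E|M. g \<omega> - q \<omega>) = 0"
      proof (rule integral_filtr_set_eq_0[OF _ _ _ E])
        fix B assume B: "B \<in> sets (past_chain s)"
        then have BM [measurable]: "B \<in> sets M" by (rule subsetD[OF sets_past_chain])
        have "(LINT \<omega>:B|M. g \<omega>) = (LINT \<omega>:B|M. real_cond_exp M (past_chain s) g \<omega>)"
          by (rule P.real_cond_exp_intA[OF gi B])
        also have "\<dots> = (LINT \<omega>:B|M. q \<omega>)"
          unfolding set_lebesgue_integral_def using mark[rule_format, OF st, of j]
          by (intro integral_cong_AE) (auto simp: g_def q_def)
        finally show "(LINT \<omega>:B|M. g \<omega> - q \<omega>) = 0" using set_int[OF BM] by simp
      qed (use gm qm gi qi in auto)
      moreover have "E \<in> sets M" using E by (rule subsetD[OF filtr_subset])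
      ultimately show "(LINT \<omega>:E|M. g \<omega>) = (LINT \<omega>:E|M. q \<omega>)" using set_int by simp
    next
      show "q \<in> borel_measurable (\<F> s)"
        unfolding q_def by (rule measurable_compose[OF measurable_chain_filtr[OF st(1) order_refl]]) simp
    qed (use gi qi in auto)
    note ce = this
    have [measurable]: "Y \<in> borel_measurable M" using Y by auto
    have Yg: "integrable M (\<lambda>\<omega>. Y \<omega> * g \<omega>)"
      by (rule Bochner_Integration.integrable_bound[OF Y(2)]) (auto simp: g_def indicator_def)
    have "expectation (\<lambda>\<omega>. Y \<omega> * of_bool (\<alpha> (s + t) \<omega> = j)) = expectation (\<lambda>\<omega>. Y \<omega> * g \<omega>)"
      by (intro Bochner_Integration.integral_cong) (auto simp: g_def indicator_def)
    also have "\<dots> = expectation (\<lambda>\<omega>. Y \<omega> * real_cond_exp M (\<F> s) g \<omega>)"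
      by (rule F.real_cond_exp_intg(2)[OF Yg Y(1), symmetric]) simp
    also have "\<dots> = expectation (\<lambda>\<omega>. Y \<omega> * q \<omega>)"
      using ce by (intro integral_cong_AE) auto
    finally show ?thesis by (simp add: q_def)
  qed
  then show thesis using p irr by (intro that[of p]) auto
qed

subsection \<open>Joint measurability of the chain\<close>

text \<open>By right-continuity the chain is the pointwise limit, attained after finitely many steps, of its
  values at the next point to the right on grids of mesh \<open>1 / (n + 1)\<close>.  The clamped time
  \<open>max 0 s\<close> makes the statement hold on the whole real line.\<close>

lemma measurable_chain_joint:
  "(\<lambda>(s, \<omega>). \<alpha> (max 0 s) \<omega>) \<in> measurable (borel \<Otimes>\<^sub>M M) (count_space UNIV)"
proof -
  define a where "a n = (\<lambda>(s :: real, \<omega>). \<alpha> ((real (nat \<lfloor>s * Suc n\<rfloor>) + 1) / Suc n) \<omega>)" for n :: nat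
  have am: "a n \<in> measurable (borel \<Otimes>\<^sub>M M) (count_space UNIV)" for n
  proof -
    have "(\<lambda>x. (\<lambda>k x. \<alpha> ((real k + 1) / Suc n) (snd x)) (nat \<lfloor>(fst x :: real) * real (Suc n)\<rfloor>) x)
        \<in> measurable (borel \<Otimes>\<^sub>M M) (count_space UNIV)"
    proof (rule measurable_compose_countable[where
          f = "\<lambda>k x. \<alpha> ((real k + 1) / Suc n) (snd x)" and g = "\<lambda>x. nat \<lfloor>(fst x :: real) * real (Suc n)\<rfloor>"])
      fix k :: nat
      show "(\<lambda>x. \<alpha> ((real k + 1) / Suc n) (snd x)) \<in> measurable (borel \<Otimes>\<^sub>M M) (count_space UNIV)"
        by (intro measurable_compose[OF measurable_snd] measurable_chain) simp
    next
      show "(\<lambda>x. nat \<lfloor>(fst x :: real) * real (Suc n)\<rfloor>) \<in> measurable (borel \<Otimes>\<^sub>M M) (count_space UNIV)"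
        by measurable
    qed
    then show ?thesis by (simp add: a_def case_prod_beta')
  qed
  have lim: "\<forall>\<^sub>F n in sequentially. a n (s, \<omega>) = \<alpha> (max 0 s) \<omega>" if \<omega>: "\<omega> \<in> space M" for s \<omega>
  proof -
    define r where "r n = (real (nat \<lfloor>s * Suc n\<rfloor>) + 1) / Suc n" for n :: nat
    have gt: "r n > max 0 s" for n
    proof -
      have "s * Suc n < real (nat \<lfloor>s * Suc n\<rfloor>) + 1" by linarith
      then have "s < r n" by (simp add: r_def field_simps)
      then show ?thesis by (simp add: r_def)
    qed
    have le: "r n \<le> max 0 s + 1 / Suc n" for n
    proof -
      have "real (nat \<lfloor>s * Suc n\<rfloor>) \<le> max 0 (s * Suc n)" by linarith
      also have "\<dots> = max 0 s * Suc n" by (simp add: max_mult_distrib_right)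
      finally show ?thesis by (simp add: r_def divide_simps) 
    qed
    have r_lim: "r \<longlonglongrightarrow> max 0 s"
    proof (rule real_tendsto_sandwich)
      show "\<forall>\<^sub>F n in sequentially. max 0 s \<le> r n" using gt by (auto simp: less_imp_le)
      show "\<forall>\<^sub>F n in sequentially. r n \<le> max 0 s + 1 / Suc n" using le by auto
      show "(\<lambda>n. max 0 s + 1 / Suc n) \<longlonglongrightarrow> max 0 s"
        using tendsto_add[OF tendsto_const LIMSEQ_inverse_real_of_nat, of "max 0 s"]
        by (simp add: inverse_eq_divide)
    qed simp
    have "r n \<in> {max 0 s<..} \<and> r n \<noteq> max 0 s" for n using gt[of n] by (auto simp: max_def)
    with r_lim have "filterlim r (at_right (max 0 s)) sequentially"
      unfolding filterlim_at by simp
    moreover have "\<forall>\<^sub>F t in at_right (max 0 s). \<alpha> t \<omega> = \<alpha> (max 0 s) \<omega>"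
      using cadlag_chain[OF \<omega>] by (simp add: cadlag_path_def)
    ultimately have "\<forall>\<^sub>F n in sequentially. \<alpha> (r n) \<omega> = \<alpha> (max 0 s) \<omega>"
      by (rule eventually_compose_filterlim[rotated])
    then show ?thesis by (simp add: a_def r_def)
  qed
  show ?thesis
  proof (rule measurableI)
    fix A :: "'d set"
    have "(\<lambda>(s, \<omega>). \<alpha> (max 0 s) \<omega>) -` A \<inter> space (borel \<Otimes>\<^sub>M M)
      = {x\<in>space (borel \<Otimes>\<^sub>M M). \<exists>m. \<forall>n\<ge>m. a n x \<in> A}"
    proof (intro set_eqI iffI)
      fix x assume x: "x \<in> (\<lambda>(s, \<omega>). \<alpha> (max 0 s) \<omega>) -` A \<inter> space (borel \<Otimes>\<^sub>M M)"
      obtain s \<omega> where [simp]: "x = (s, \<omega>)" by (cases x)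
      have "\<omega> \<in> space M" using x by (simp add: space_pair_measure)
      from lim[OF this, of s] obtain m where "\<forall>n\<ge>m. a n x = \<alpha> (max 0 s) \<omega>"
        by (auto simp: eventually_sequentially)
      then have "\<forall>n\<ge>m. a n x \<in> A" using x by simp
      then show "x \<in> {x\<in>space (borel \<Otimes>\<^sub>M M). \<exists>m. \<forall>n\<ge>m. a n x \<in> A}" using x by blast
    next
      fix x assume x: "x \<in> {x\<in>space (borel \<Otimes>\<^sub>M M). \<exists>m. \<forall>n\<ge>m. a n x \<in> A}"
      obtain s \<omega> where [simp]: "x = (s, \<omega>)" by (cases x)
      have "\<omega> \<in> space M" using x by (simp add: space_pair_measure)
      from lim[OF this, of s] obtain m where m: "\<And>n. n \<ge> m \<Longrightarrow> a n x = \<alpha> (max 0 s) \<omega>"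
        by (auto simp: eventually_sequentially)
      from x obtain m' where m': "\<And>n. n \<ge> m' \<Longrightarrow> a n x \<in> A" by auto
      show "x \<in> (\<lambda>(s, \<omega>). \<alpha> (max 0 s) \<omega>) -` A \<inter> space (borel \<Otimes>\<^sub>M M)"
        using m[of "max m m'"] m'[of "max m m'"] x by auto
    qed
    also have "\<dots> = (\<Union>m. \<Inter>n\<in>{m..}. a n -` A \<inter> space (borel \<Otimes>\<^sub>M M))"
      by auto
    also have "\<dots> \<in> sets (borel \<Otimes>\<^sub>M M)"
    proof (rule sets.countable_UN, rule image_subsetI)
      fix m :: nat
      show "(\<Inter>n\<in>{m..}. a n -` A \<inter> space (borel \<Otimes>\<^sub>M M)) \<in> sets (borel \<Otimes>\<^sub>M M)"
        by (rule sets.countable_INT', simp, simp, rule image_subsetI, rule measurable_sets[OF am]) simp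
    qed
    finally show "(\<lambda>(s, \<omega>). \<alpha> (max 0 s) \<omega>) -` A \<inter> space (borel \<Otimes>\<^sub>M M) \<in> sets (borel \<Otimes>\<^sub>M M)" .
  qed simp
qed

end

section \<open>Integration over time and paths\<close>

lemma finite_measure_interval: "finite_measure (restrict_space lborel {0..T::real})"
  by (intro finite_measureI)
    (simp add: space_restrict_space emeasure_restrict_space emeasure_lborel_Icc_eq)

context regime_switching_space
begin

definition time_space :: "real \<Rightarrow> (real \<times> 'w) measure" where
  "time_space T = restrict_space lborel {0..T} \<Otimes>\<^sub>M M"

lemma space_time_space [simp]: "space (time_space T) = {0..T} \<times> space M"
  by (simp add: time_space_def space_pair_measure space_restrict_space)

lemma pair_sigma_finite_time: "pair_sigma_finite (restrict_space lborel {0..T::real}) M"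
proof -
  interpret finite_measure "restrict_space lborel {0..T}" by (rule finite_measure_interval)
  show ?thesis ..
qed

lemma finite_measure_time_space: "finite_measure (time_space T)"
proof -
  interpret L: finite_measure "restrict_space lborel {0..T}" by (rule finite_measure_interval)
  show ?thesis unfolding time_space_def
    by (rule finite_measure_pair_measure) (rule finite_measure_axioms | rule L.finite_measure_axioms)+
qed

lemma measurable_time_fst [measurable]: "fst \<in> borel_measurable (time_space T)"
proof -
  have "fst \<in> measurable (time_space T) (restrict_space lborel {0..T})"
    unfolding time_space_def by (rule measurable_fst)
  then show ?thesis
    by (rule measurable_compose) (rule measurable_restrict_space1, simp)
qed

lemma measurable_time_snd [measurable]: "snd \<in> measurable (time_space T) M"
  unfolding time_space_def by (rule measurable_snd)

lemma measurable_time_fst_restrict: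
  "fst \<in> measurable (time_space T) (restrict_space borel {0..T})"
  by (rule measurable_restrict_space2[OF _ measurable_time_fst]) auto

lemma measurable_time_component:
  assumes "f \<in> borel_measurable M"
  shows "(\<lambda>x. f (snd x)) \<in> borel_measurable (time_space T)"
  by (rule measurable_compose[OF measurable_time_snd assms])

lemma measurable_chain_time [measurable]:
  "(\<lambda>x. \<alpha> (fst x) (snd x)) \<in> measurable (time_space T) (count_space UNIV)"
proof -
  have "(\<lambda>x. (fst x, snd x)) \<in> measurable (time_space T) (borel \<Otimes>\<^sub>M M)"
    by measurable
  from measurable_compose[OF this measurable_chain_joint]
  have "(\<lambda>x. \<alpha> (max 0 (fst x)) (snd x)) \<in> measurable (time_space T) (count_space UNIV)"
    by (simp add: case_prod_beta')
  then show ?thesis by (rule measurable_cong[THEN iffD1, rotated]) (auto simp: max_def)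
qed

lemma measurable_regime_coefficient:
  assumes "\<And>i. (\<lambda>t. F t i) \<in> borel_measurable (restrict_space borel {0..T})"
  shows "(\<lambda>x. F (fst x) (\<alpha> (fst x) (snd x))) \<in> borel_measurable (time_space T)"
proof -
  have "(\<lambda>x. (\<lambda>i x. F (fst x) i) (\<alpha> (fst x) (snd x)) x) \<in> borel_measurable (time_space T)"
    by (rule measurable_compose_countable'[where I=UNIV])
      (auto intro!: measurable_compose[OF measurable_time_fst_restrict assms] measurable_chain_time
        countable_finite)
  then show ?thesis by simp
qed

lemma measurable_progressive:
  assumes "progressive \<F> T g" "0 \<le> T"
  shows "(\<lambda>x. g (fst x) (snd x)) \<in> borel_measurable (time_space T)"
proof -
  have g: "(\<lambda>(s, \<omega>). g s \<omega>) \<in> borel_measurable (restrict_space borel {0..T} \<Otimes>\<^sub>M \<F> T)"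
    using assms by (auto simp: progressive_def)
  have "snd \<in> measurable (time_space T) (\<F> T)"
    using measurable_time_snd[of T] filtr_subset[of T] unfolding measurable_def by auto
  then have "(\<lambda>x. (fst x, snd x)) \<in> measurable (time_space T) (restrict_space borel {0..T} \<Otimes>\<^sub>M \<F> T)"
    by (intro measurable_Pair measurable_time_fst_restrict)
  from measurable_compose[OF this g] show ?thesis by (simp add: case_prod_beta')
qed

lemma progressive_adapted:
  assumes "progressive \<F> T g" "t \<in> {0..T}"
  shows "g t \<in> borel_measurable (\<F> t)"
proof -
  have g: "(\<lambda>(s, \<omega>). g s \<omega>) \<in> borel_measurable (restrict_space borel {0..t} \<Otimes>\<^sub>M \<F> t)"
    using assms by (auto simp: progressive_def)
  have "(\<lambda>\<omega>. (t, \<omega>)) \<in> measurable (\<F> t) (restrict_space borel {0..t} \<Otimes>\<^sub>M \<F> t)"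
    using assms by (intro measurable_Pair) (auto simp: space_restrict_space)
  from measurable_compose[OF this g] show ?thesis by simp
qed

lemma integrable_time_component:
  fixes f :: "'w \<Rightarrow> real"
  assumes f: "integrable M f"
  shows "integrable (time_space T) (\<lambda>x. f (snd x))"
proof -
  interpret L: finite_measure "restrict_space lborel {0..T}" by (rule finite_measure_interval)
  interpret P: pair_sigma_finite "restrict_space lborel {0..T}" M by (rule pair_sigma_finite_time)
  show ?thesis unfolding time_space_def
  proof (rule P.Fubini_integrable)
    show "(\<lambda>x. f (snd x)) \<in> borel_measurable (restrict_space lborel {0..T} \<Otimes>\<^sub>M M)"
      using f by (intro measurable_compose[OF measurable_snd]) auto
  qed (use f in auto)
qed

lemma nn_integral_time_space:
  assumes "(\<lambda>x. f (fst x) (snd x)) \<in> borel_measurable (time_space T)"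
  shows "(\<integral>\<^sup>+\<omega>. (\<integral>\<^sup>+t\<in>{0..T}. f t \<omega> \<partial>lborel) \<partial>M) = (\<integral>\<^sup>+x. f (fst x) (snd x) \<partial>time_space T)"
proof -
  interpret P: pair_sigma_finite "restrict_space lborel {0..T}" M by (rule pair_sigma_finite_time)
  have "(\<integral>\<^sup>+\<omega>. (\<integral>\<^sup>+t\<in>{0..T}. f t \<omega> \<partial>lborel) \<partial>M)
     = (\<integral>\<^sup>+\<omega>. (\<integral>\<^sup>+t. f t \<omega> \<partial>restrict_space lborel {0..T}) \<partial>M)"
    by (intro nn_integral_cong) (simp add: nn_integral_restrict_space)
  also have "\<dots> = (\<integral>\<^sup>+x. f (fst x) (snd x) \<partial>time_space T)"
    unfolding time_space_def
    using P.nn_integral_snd[of "\<lambda>x. f (fst x) (snd x)"] assms by (simp add: time_space_def)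
  finally show ?thesis .
qed

lemma integral_time_space:
  fixes f :: "real \<Rightarrow> 'w \<Rightarrow> 'v::euclidean_space"
  assumes "integrable (time_space T) (\<lambda>x. f (fst x) (snd x))"
  shows "integrable M (\<lambda>\<omega>. LINT t:{0..T}|lborel. f t \<omega>)"
    and "expectation (\<lambda>\<omega>. LINT t:{0..T}|lborel. f t \<omega>) = (\<integral>x. f (fst x) (snd x) \<partial>time_space T)"
    and "AE \<omega> in M. set_integrable lborel {0..T} (\<lambda>t. f t \<omega>)"
proof -
  interpret P: pair_sigma_finite "restrict_space lborel {0..T}" M by (rule pair_sigma_finite_time)
  have f: "integrable (restrict_space lborel {0..T} \<Otimes>\<^sub>M M) (\<lambda>(t, \<omega>). f t \<omega>)"
    using assms by (simp add: time_space_def case_prod_beta')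
  have *: "(\<integral>t. f t \<omega> \<partial>restrict_space lborel {0..T}) = (LINT t:{0..T}|lborel. f t \<omega>)" for \<omega>
    by (simp add: integral_restrict_space set_lebesgue_integral_def)
  show "integrable M (\<lambda>\<omega>. LINT t:{0..T}|lborel. f t \<omega>)"
    using P.integrable_snd[OF f] by (simp add: *)
  show "expectation (\<lambda>\<omega>. LINT t:{0..T}|lborel. f t \<omega>) = (\<integral>x. f (fst x) (snd x) \<partial>time_space T)"
    using P.integral_snd[OF f] by (simp add: * time_space_def case_prod_beta')
  show "AE \<omega> in M. set_integrable lborel {0..T} (\<lambda>t. f t \<omega>)"
    using P.AE_integrable_snd[OF f] by (simp add: set_integrable_restrict_space integrable_restrict_space set_integrable_def)
qed

lemma square_integrable_L2_F:
  assumes "g \<in> L2_F M \<F> T H" "0 \<le> T"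
  shows "square_integrable (time_space T) (\<lambda>x. g (fst x) (snd x))"
proof -
  have m: "(\<lambda>x. g (fst x) (snd x)) \<in> borel_measurable (time_space T)"
    using assms by (intro measurable_progressive) (auto simp: L2_F_def)
  have "(\<integral>\<^sup>+x. ennreal ((norm (g (fst x) (snd x)))\<^sup>2) \<partial>time_space T)
     = (\<integral>\<^sup>+\<omega>. (\<integral>\<^sup>+t\<in>{0..T}. ennreal ((norm (g t \<omega>))\<^sup>2) \<partial>lborel) \<partial>M)"
    by (subst nn_integral_time_space) (use m in auto)
  with m assms show ?thesis by (subst square_integrable_iff_nn) (auto simp: L2_F_def)
qed

section \<open>The Ito integral as a martingale of the enlarged filtration\<close>

text \<open>On \<open>(s,t]\<close> a simple integral is the sum over the partition clamped to \<open>[s,t]\<close>.  Coefficients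
  of intervals to the right of \<open>t\<close> are switched off, so that the \<open>k\<close>-th one is known at the \<open>k\<close>-th
  clamped time.\<close>

context
  fixes T s t :: real and N :: nat and p :: "nat \<Rightarrow> real" and \<eta> :: "nat \<Rightarrow> 'w \<Rightarrow> real ^ 'n"
  assumes simple: "is_simple \<F> T N p \<eta>" and st: "0 \<le> s" "s \<le> t" "t \<le> T"
begin

definition clamped :: "nat \<Rightarrow> real" where "clamped k = max s (min t (p k))"

definition live_coeff :: "nat \<Rightarrow> 'w \<Rightarrow> real ^ 'n" where
  "live_coeff k = (if p k < t then \<eta> k else (\<lambda>_. 0))"

lemma simple_times: "k < N \<Longrightarrow> 0 \<le> p k" "k < N \<Longrightarrow> p k \<le> p (Suc k)" "k < N \<Longrightarrow> p (Suc k) \<le> T"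
  using simple by (auto simp: is_simple_def)

lemma simple_times_mono: "k \<le> l \<Longrightarrow> l \<le> N \<Longrightarrow> p k \<le> p l"
proof (induction l rule: dec_induct)
  case (step l)
  then show ?case using simple_times(2)[of l] by auto
qed simp

lemma clamped_bounds: "0 \<le> clamped k" "s \<le> clamped k" "clamped k \<le> t"
  using st by (auto simp: clamped_def)

lemma clamped_mono: "k \<le> l \<Longrightarrow> l \<le> N \<Longrightarrow> clamped k \<le> clamped l"
  using simple_times_mono[of k l] by (auto simp: clamped_def)

lemma measurable_live_coeff:
  assumes "k < N"
  shows "live_coeff k \<in> borel_measurable (enlarged (clamped k))"
proof (cases "p k < t")
  case True
  then have "p k \<le> clamped k" by (auto simp: clamped_def)
  moreover have "\<eta> k \<in> borel_measurable (\<F> (p k))" using simple assms by (simp add: is_simple_def)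
  ultimately show ?thesis
    using True unfolding live_coeff_def by (simp add: measurable_filtr_enlarged)
qed (simp add: live_coeff_def)

lemma live_coeff_bounded:
  assumes "k < N"
  shows "\<exists>c\<ge>0. \<forall>\<omega>\<in>space M. norm (live_coeff k \<omega>) \<le> c"
proof -
  have "\<exists>c. \<forall>\<omega>\<in>space M. norm (\<eta> k \<omega>) \<le> c"
    using simple assms by (simp add: is_simple_def)
  then obtain c where c: "\<And>\<omega>. \<omega> \<in> space M \<Longrightarrow> norm (\<eta> k \<omega>) \<le> c" by blast
  have "norm (live_coeff k \<omega>) \<le> max 0 c" if "\<omega> \<in> space M" for \<omega>
    using c[OF that] by (auto simp: live_coeff_def)
  then show ?thesis by (intro exI[of _ "max 0 c"]) auto
qed

lemma simple_integral_increment: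
  "simple_integral W N p \<eta> t \<omega> - simple_integral W N p \<eta> s \<omega>
    = (\<Sum>k<N. (W (clamped (Suc k)) \<omega> - W (clamped k) \<omega>) *\<^sub>R live_coeff k \<omega>)"
proof -
  have W: "W (min t u) \<omega> - W (min s u) \<omega> = W (max s (min t u)) \<omega> - W s \<omega>" for u
    using st by (auto simp: min_def max_def)
  have "simple_integral W N p \<eta> t \<omega> - simple_integral W N p \<eta> s \<omega>
    = (\<Sum>k<N. ((W (min t (p (Suc k))) \<omega> - W (min s (p (Suc k))) \<omega>)
         - (W (min t (p k)) \<omega> - W (min s (p k)) \<omega>)) *\<^sub>R \<eta> k \<omega>)"
    unfolding simple_integral_def sum_subtractf[symmetric]
    by (intro sum.cong) (auto simp: algebra_simps)
  also have "\<dots> = (\<Sum>k<N. (W (clamped (Suc k)) \<omega> - W (clamped k) \<omega>) *\<^sub>R live_coeff k \<omega>)"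
  proof (intro sum.cong refl)
    fix k assume "k \<in> {..<N}"
    then have "p k \<le> p (Suc k)" using simple_times(2) by simp
    then show "((W (min t (p (Suc k))) \<omega> - W (min s (p (Suc k))) \<omega>)
         - (W (min t (p k)) \<omega> - W (min s (p k)) \<omega>)) *\<^sub>R \<eta> k \<omega>
       = (W (clamped (Suc k)) \<omega> - W (clamped k) \<omega>) *\<^sub>R live_coeff k \<omega>"
      unfolding W using st by (auto simp: clamped_def live_coeff_def)
  qed
  finally show ?thesis .
qed

lemma expectation_inner_simple_increment:
  assumes Z: "Z \<in> borel_measurable (enlarged s)" "integrable M (\<lambda>\<omega>. norm (Z \<omega>))"
  shows "expectation (\<lambda>\<omega>. Z \<omega> \<bullet> (simple_integral W N p \<eta> t \<omega> - simple_integral W N p \<eta> s \<omega>)) = 0"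
proof -
  let ?dW = "\<lambda>k \<omega>. W (clamped (Suc k)) \<omega> - W (clamped k) \<omega>"
  have *: "integrable M (\<lambda>\<omega>. (Z \<omega> \<bullet> live_coeff k \<omega>) * ?dW k \<omega>)
      \<and> expectation (\<lambda>\<omega>. (Z \<omega> \<bullet> live_coeff k \<omega>) * ?dW k \<omega>) = 0" if k: "k < N" for k
  proof -
    have cm: "clamped k \<le> clamped (Suc k)" using clamped_mono[of k "Suc k"] k by auto
    have Zm: "Z \<in> borel_measurable (enlarged (clamped k))"
      using measurable_enlarged_mono[OF Z(1) clamped_bounds(2)] .
    have m: "(\<lambda>\<omega>. Z \<omega> \<bullet> live_coeff k \<omega>) \<in> borel_measurable (enlarged (clamped k))"
      using Zm measurable_live_coeff[OF k] by (rule borel_measurable_inner)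
    obtain c where c: "0 \<le> c" "\<And>\<omega>. \<omega> \<in> space M \<Longrightarrow> norm (live_coeff k \<omega>) \<le> c"
      using live_coeff_bounded[OF k] by blast
    have "integrable M (\<lambda>\<omega>. Z \<omega> \<bullet> live_coeff k \<omega>)"
    proof (rule Bochner_Integration.integrable_bound)
      show "integrable M (\<lambda>\<omega>. c * norm (Z \<omega>))" using Z(2) by simp
      show "(\<lambda>\<omega>. Z \<omega> \<bullet> live_coeff k \<omega>) \<in> borel_measurable M" using measurable_enlargedD[OF m] .
      show "AE \<omega> in M. norm (Z \<omega> \<bullet> live_coeff k \<omega>) \<le> norm (c * norm (Z \<omega>))"
      proof (rule AE_I2)
        fix \<omega> assume "\<omega> \<in> space M"
        have "\<bar>Z \<omega> \<bullet> live_coeff k \<omega>\<bar> \<le> norm (Z \<omega>) * norm (live_coeff k \<omega>)"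
          by (rule Cauchy_Schwarz_ineq2)
        also have "\<dots> \<le> norm (Z \<omega>) * c"
          using c \<open>\<omega> \<in> space M\<close> by (intro mult_left_mono) auto
        finally show "norm (Z \<omega> \<bullet> live_coeff k \<omega>) \<le> norm (c * norm (Z \<omega>))"
          using c by (simp add: mult.commute abs_mult)
      qed
    qed
    then show ?thesis
      using expectation_mult_increment(1,2)[OF clamped_bounds(1) cm m] by blast
  qed
  have "expectation (\<lambda>\<omega>. Z \<omega> \<bullet> (simple_integral W N p \<eta> t \<omega> - simple_integral W N p \<eta> s \<omega>))
    = expectation (\<lambda>\<omega>. \<Sum>k<N. (Z \<omega> \<bullet> live_coeff k \<omega>) * ?dW k \<omega>)"
    unfolding simple_integral_increment by (simp add: inner_sum_right mult.commute)
  also have "\<dots> = (\<Sum>k<N. expectation (\<lambda>\<omega>. (Z \<omega> \<bullet> live_coeff k \<omega>) * ?dW k \<omega>))"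
    using * by (intro Bochner_Integration.integral_sum) auto
  also have "\<dots> = 0" using * by simp
  finally show ?thesis .
qed

lemma square_integrable_simple_increment:
  "square_integrable M (\<lambda>\<omega>. simple_integral W N p \<eta> t \<omega> - simple_integral W N p \<eta> s \<omega>)"
  unfolding simple_integral_increment
proof (rule square_integrable_sum)
  fix k assume "k \<in> {..<N}"
  then have k: "k < N" by simp
  have cm: "clamped k \<le> clamped (Suc k)" using clamped_mono[of k "Suc k"] k by auto
  obtain c where c: "0 \<le> c" "\<And>\<omega>. \<omega> \<in> space M \<Longrightarrow> norm (live_coeff k \<omega>) \<le> c"
    using live_coeff_bounded[OF k] by blast
  have [measurable]: "live_coeff k \<in> borel_measurable M"
    by (rule measurable_enlargedD[OF measurable_live_coeff[OF k]])
  have [measurable]: "W (clamped j) \<in> borel_measurable M" for j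
    using clamped_bounds by (intro measurable_brownian)
  show "square_integrable M (\<lambda>\<omega>. (W (clamped (Suc k)) \<omega> - W (clamped k) \<omega>) *\<^sub>R live_coeff k \<omega>)"
  proof (rule square_integrable_bound)
    show "integrable M (\<lambda>\<omega>. c\<^sup>2 * (W (clamped (Suc k)) \<omega> - W (clamped k) \<omega>)\<^sup>2)"
      using increment_moments(3)[OF clamped_bounds(1) cm] by simp
    show "AE \<omega> in M. (norm ((W (clamped (Suc k)) \<omega> - W (clamped k) \<omega>) *\<^sub>R live_coeff k \<omega>))\<^sup>2
       \<le> c\<^sup>2 * (W (clamped (Suc k)) \<omega> - W (clamped k) \<omega>)\<^sup>2"
    proof (rule AE_I2)
      fix \<omega> assume "\<omega> \<in> space M"
      then have "(norm (live_coeff k \<omega>))\<^sup>2 \<le> c\<^sup>2" using c by (intro power_mono) auto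
      then show "(norm ((W (clamped (Suc k)) \<omega> - W (clamped k) \<omega>) *\<^sub>R live_coeff k \<omega>))\<^sup>2
         \<le> c\<^sup>2 * (W (clamped (Suc k)) \<omega> - W (clamped k) \<omega>)\<^sup>2"
        by (simp add: power_mult_distrib mult.commute mult_right_mono)
    qed
  qed measurable
qed

text \<open>Off the diagonal the later increment is independent of everything else in the product, on
  the diagonal it contributes the length of its interval: the Ito isometry, with a matrix weight.\<close>

lemma expectation_form_simple_increment:
  assumes P: "P \<in> borel_measurable (enlarged s)" "\<And>\<omega>. \<omega> \<in> space M \<Longrightarrow> norm (P \<omega>) \<le> c"
  shows "expectation (\<lambda>\<omega>. (simple_integral W N p \<eta> t \<omega> - simple_integral W N p \<eta> s \<omega>)
           \<bullet> (P \<omega> *v (simple_integral W N p \<eta> t \<omega> - simple_integral W N p \<eta> s \<omega>)))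
     = (\<Sum>k<N. (clamped (Suc k) - clamped k) * expectation (\<lambda>\<omega>. live_coeff k \<omega> \<bullet> (P \<omega> *v live_coeff k \<omega>)))"
proof -
  let ?dW = "\<lambda>k \<omega>. W (clamped (Suc k)) \<omega> - W (clamped k) \<omega>"
  define Y where "Y k l \<omega> = live_coeff k \<omega> \<bullet> (P \<omega> *v live_coeff l \<omega>)" for k l \<omega>
  have dWm: "?dW k \<in> borel_measurable M" for k
    using clamped_bounds by (intro borel_measurable_diff measurable_brownian)
  have cm: "clamped k \<le> clamped (Suc k)" if "k < N" for k
    using clamped_mono[of k "Suc k"] that by auto
  have Ym: "Y k l \<in> borel_measurable (enlarged u)"
    if "k < N" "l < N" "clamped k \<le> u" "clamped l \<le> u" for k l u
    unfolding Y_def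
    using measurable_enlarged_mono[OF measurable_live_coeff that(3)]
      measurable_enlarged_mono[OF measurable_live_coeff that(4)]
      measurable_enlarged_mono[OF P(1), of u] that clamped_bounds(2)[of k]
    by (intro borel_measurable_inner borel_measurable_matrix_vector_mult) auto
  have Yb: "\<exists>b. \<forall>\<omega>\<in>space M. \<bar>Y k l \<omega>\<bar> \<le> b" if kl: "k < N" "l < N" for k l
  proof -
    obtain c1 where c1: "0 \<le> c1" "\<And>\<omega>. \<omega> \<in> space M \<Longrightarrow> norm (live_coeff k \<omega>) \<le> c1"
      using live_coeff_bounded[OF kl(1)] by blast
    obtain c2 where c2: "0 \<le> c2" "\<And>\<omega>. \<omega> \<in> space M \<Longrightarrow> norm (live_coeff l \<omega>) \<le> c2"
      using live_coeff_bounded[OF kl(2)] by blast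
    have "\<bar>Y k l \<omega>\<bar> \<le> c1 * (c * c2)" if w: "\<omega> \<in> space M" for \<omega>
    proof -
      have c0: "0 \<le> c" using P(2)[OF w] norm_ge_zero order_trans by blast
      have "\<bar>Y k l \<omega>\<bar> \<le> norm (live_coeff k \<omega>) * norm (P \<omega> *v live_coeff l \<omega>)"
        unfolding Y_def by (rule Cauchy_Schwarz_ineq2)
      also have "\<dots> \<le> c1 * (c * c2)"
        using order_trans[OF norm_matrix_vector_mult_le mult_mono[OF P(2)[OF w] c2(2)[OF w]]] c0 c1 w
        by (intro mult_mono) auto
      finally show ?thesis .
    qed
    then show ?thesis by blast
  qed
  have Yi: "integrable M (\<lambda>\<omega>. Y k l \<omega> * f \<omega>)" if kl: "k < N" "l < N" and f: "integrable M f" for k l f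
  proof -
    obtain b where b: "\<And>\<omega>. \<omega> \<in> space M \<Longrightarrow> \<bar>Y k l \<omega>\<bar> \<le> b" using Yb[OF kl] by blast
    have [measurable]: "Y k l \<in> borel_measurable M"
      using measurable_enlargedD[OF Ym[OF kl, of "max (clamped k) (clamped l)"]] by simp
    have [measurable]: "f \<in> borel_measurable M" using f by auto
    show ?thesis
    proof (rule Bochner_Integration.integrable_bound)
      show "integrable M (\<lambda>\<omega>. b * norm (f \<omega>))" using f by simp
      show "AE \<omega> in M. norm (Y k l \<omega> * f \<omega>) \<le> norm (b * norm (f \<omega>))"
      proof (rule AE_I2)
        fix \<omega> assume "\<omega> \<in> space M"
        from b[OF this] have "\<bar>Y k l \<omega>\<bar> * \<bar>f \<omega>\<bar> \<le> \<bar>b\<bar> * \<bar>f \<omega>\<bar>"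
          by (intro mult_right_mono) auto
        then show "norm (Y k l \<omega> * f \<omega>) \<le> norm (b * norm (f \<omega>))" by (simp add: abs_mult)
      qed
    qed measurable
  qed
  have off: "integrable M (\<lambda>\<omega>. Y a b \<omega> * ?dW k \<omega> * ?dW l \<omega>)
      \<and> expectation (\<lambda>\<omega>. Y a b \<omega> * ?dW k \<omega> * ?dW l \<omega>) = 0"
    if kl: "k < l" "l < N" "a \<le> l" "b \<le> l" for a b k l
  proof -
    have le: "clamped a \<le> clamped l" "clamped b \<le> clamped l" "clamped (Suc k) \<le> clamped l" "clamped k \<le> clamped l"
      using kl by (auto intro!: clamped_mono)
    have W: "W (clamped j) \<in> borel_measurable (enlarged (clamped l))" if "clamped j \<le> clamped l" for j
      using that clamped_bounds(1)[of j]
      by (intro measurable_sets_mono[OF measurable_process_sigma[of _ "{0..clamped l}" W M borel]])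
        (auto simp: sets_enlarged)
    have m: "(\<lambda>\<omega>. Y a b \<omega> * ?dW k \<omega>) \<in> borel_measurable (enlarged (clamped l))"
      using W[OF le(3)] W[OF le(4)] Ym[of a b "clamped l"] le kl by (intro borel_measurable_times borel_measurable_diff) auto
    have i: "integrable M (\<lambda>\<omega>. Y a b \<omega> * ?dW k \<omega>)"
      using Yi[of a b "?dW k"] increment_moments(1)[OF clamped_bounds(1) cm[of k]] kl by auto
    show ?thesis
      using expectation_mult_increment(1,2)[OF clamped_bounds(1) cm[OF kl(2)] m i] by blast
  qed
  have diag: "integrable M (\<lambda>\<omega>. Y k k \<omega> * (?dW k \<omega>)\<^sup>2)
      \<and> expectation (\<lambda>\<omega>. Y k k \<omega> * (?dW k \<omega>)\<^sup>2) = (clamped (Suc k) - clamped k) * expectation (Y k k)"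
    if k: "k < N" for k
    using expectation_mult_increment(3,4)[OF clamped_bounds(1) cm[OF k] Ym[of k k]] Yi[of k k "\<lambda>_. 1"] k
    by simp
  have all: "integrable M (\<lambda>\<omega>. Y k l \<omega> * ?dW k \<omega> * ?dW l \<omega>) \<and>
     expectation (\<lambda>\<omega>. Y k l \<omega> * ?dW k \<omega> * ?dW l \<omega>)
      = (if k = l then (clamped (Suc k) - clamped k) * expectation (Y k k) else 0)"
    if "k < N" "l < N" for k l
  proof (cases k l rule: linorder_cases)
    case less
    then show ?thesis using off[of k l k l] that by simp
  next
    case equal
    then show ?thesis using diag[of l] that by (simp add: power2_eq_square mult.assoc)
  next
    case greater
    then have "(\<lambda>\<omega>. Y k l \<omega> * ?dW k \<omega> * ?dW l \<omega>) = (\<lambda>\<omega>. Y k l \<omega> * ?dW l \<omega> * ?dW k \<omega>)"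
      by (simp add: mult_ac)
    then show ?thesis using off[of l k k l] that greater by simp
  qed
  have "expectation (\<lambda>\<omega>. (simple_integral W N p \<eta> t \<omega> - simple_integral W N p \<eta> s \<omega>)
           \<bullet> (P \<omega> *v (simple_integral W N p \<eta> t \<omega> - simple_integral W N p \<eta> s \<omega>)))
    = expectation (\<lambda>\<omega>. \<Sum>k<N. \<Sum>l<N. Y k l \<omega> * ?dW k \<omega> * ?dW l \<omega>)"
  proof (intro Bochner_Integration.integral_cong refl)
    fix \<omega>
    define v where "v k = ?dW k \<omega> *\<^sub>R live_coeff k \<omega>" for k
    have "(\<Sum>k<N. v k) \<bullet> (P \<omega> *v (\<Sum>k<N. v k)) = (\<Sum>k<N. \<Sum>l<N. v k \<bullet> (P \<omega> *v v l))"
      by (simp only: linear_sum[OF matrix_vector_mul_linear] inner_sum_left inner_sum_right)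
        (rule sum.swap)
    also have "\<dots> = (\<Sum>k<N. \<Sum>l<N. Y k l \<omega> * ?dW k \<omega> * ?dW l \<omega>)"
      by (intro sum.cong refl) (simp add: v_def Y_def matrix_vector_mult_scaleR)
    finally show "(simple_integral W N p \<eta> t \<omega> - simple_integral W N p \<eta> s \<omega>)
           \<bullet> (P \<omega> *v (simple_integral W N p \<eta> t \<omega> - simple_integral W N p \<eta> s \<omega>))
        = (\<Sum>k<N. \<Sum>l<N. Y k l \<omega> * ?dW k \<omega> * ?dW l \<omega>)"
      unfolding simple_integral_increment v_def .
  qed
  also have "\<dots> = (\<Sum>k<N. \<Sum>l<N. expectation (\<lambda>\<omega>. Y k l \<omega> * ?dW k \<omega> * ?dW l \<omega>))"
  proof -
    have i: "integrable M (\<lambda>\<omega>. Y k l \<omega> * ?dW k \<omega> * ?dW l \<omega>)" if "k < N" "l < N" for k l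
      using all[OF that] by (rule conjunct1)
    have "expectation (\<lambda>\<omega>. \<Sum>k<N. \<Sum>l<N. Y k l \<omega> * ?dW k \<omega> * ?dW l \<omega>)
      = (\<Sum>k<N. expectation (\<lambda>\<omega>. \<Sum>l<N. Y k l \<omega> * ?dW k \<omega> * ?dW l \<omega>))"
      by (intro Bochner_Integration.integral_sum Bochner_Integration.integrable_sum i) auto
    also have "\<dots> = (\<Sum>k<N. \<Sum>l<N. expectation (\<lambda>\<omega>. Y k l \<omega> * ?dW k \<omega> * ?dW l \<omega>))"
      by (intro sum.cong refl Bochner_Integration.integral_sum i) auto
    finally show ?thesis .
  qed
  also have "\<dots> = (\<Sum>k<N. \<Sum>l<N. if k = l then (clamped (Suc k) - clamped k) * expectation (Y k k) else 0)"
    using all by (intro sum.cong refl) auto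
  also have "\<dots> = (\<Sum>k<N. (clamped (Suc k) - clamped k) * expectation (Y k k))"
    by (intro sum.cong refl) (simp add: sum.delta')
  finally show ?thesis by (simp only: Y_def[abs_def])
qed

lemma square_integrable_simple_process:
  "square_integrable (time_space T) (\<lambda>x. simple_process N p \<eta> (fst x) (snd x))"
  unfolding simple_process_def
proof (rule square_integrable_sum)
  fix k assume "k \<in> {..<N}"
  then have k: "\<eta> k \<in> borel_measurable (\<F> (p k))" "\<exists>c. \<forall>\<omega>\<in>space M. norm (\<eta> k \<omega>) \<le> c"
    using simple by (auto simp: is_simple_def)
  then obtain c where c: "\<And>\<omega>. \<omega> \<in> space M \<Longrightarrow> norm (\<eta> k \<omega>) \<le> c" by blast
  have [measurable]: "\<eta> k \<in> borel_measurable M" by (rule measurable_filtrD[OF k(1)])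
  show "square_integrable (time_space T) (\<lambda>x. indicat_real {p k<..p (Suc k)} (fst x) *\<^sub>R \<eta> k (snd x))"
  proof (rule square_integrable_bounded[OF finite_measure_time_space])
    fix x assume "x \<in> space (time_space T)"
    then have "norm (\<eta> k (snd x)) \<le> c" by (intro c) auto
    moreover have "0 \<le> c" using calculation norm_ge_zero order_trans by blast
    ultimately show "norm (indicat_real {p k<..p (Suc k)} (fst x) *\<^sub>R \<eta> k (snd x)) \<le> c"
      by (auto simp: indicator_def)
  qed measurable
qed

lemma integral_form_simple_process:
  assumes P: "P \<in> borel_measurable M" "\<And>\<omega>. \<omega> \<in> space M \<Longrightarrow> norm (P \<omega>) \<le> c"
  shows "(\<integral>x. simple_process N p \<eta> (fst x) (snd x) \<bullet>
            ((indicator {s<..t} (fst x) *\<^sub>R P (snd x)) *v simple_process N p \<eta> (fst x) (snd x)) \<partial>time_space T)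
     = (\<Sum>k<N. (clamped (Suc k) - clamped k) * expectation (\<lambda>\<omega>. live_coeff k \<omega> \<bullet> (P \<omega> *v live_coeff k \<omega>)))"
proof -
  interpret L: finite_measure "restrict_space lborel {0..T}" by (rule finite_measure_interval)
  define Y where "Y k \<omega> = live_coeff k \<omega> \<bullet> (P \<omega> *v live_coeff k \<omega>)" for k \<omega>
  have pt: "simple_process N p \<eta> r \<omega> \<bullet> ((indicator {s<..t} r *\<^sub>R P \<omega>) *v simple_process N p \<eta> r \<omega>)
     = (\<Sum>k<N. indicator {clamped k<..clamped (Suc k)} r * Y k \<omega>)" for r \<omega>
  proof (cases "r \<in> {s<..t}")
    case False
    then have "indicator {clamped k<..clamped (Suc k)} r = (0::real)" for k
      using clamped_bounds[of k] clamped_bounds[of "Suc k"] by (auto simp: indicator_def)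
    then show ?thesis using False by simp
  next
    case True
    have ind: "indicator {p k<..p (Suc k)} r = (indicator {clamped k<..clamped (Suc k)} r :: real)" for k
      using True by (auto simp: clamped_def indicator_def)
    have coeff: "indicator {p k<..p (Suc k)} r *\<^sub>R \<eta> k \<omega> = (indicator {p k<..p (Suc k)} r :: real) *\<^sub>R live_coeff k \<omega>" for k
      using True by (auto simp: live_coeff_def indicator_def)
    show ?thesis
    proof (cases "\<exists>k<N. r \<in> {p k<..p (Suc k)}")
      case ex: True
      then obtain k where k: "k < N" "r \<in> {p k<..p (Suc k)}" by blast
      have uniq: "l = k" if "l < N" "r \<in> {p l<..p (Suc l)}" for l
      proof (rule ccontr)
        assume "l \<noteq> k"
        then consider "Suc l \<le> k" | "Suc k \<le> l" by linarith
        then show False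
        proof cases
          case 1
          then show False using simple_times_mono[of "Suc l" k] k that by auto
        next
          case 2
          then show False using simple_times_mono[of "Suc k" l] k that by auto
        qed
      qed
      have i: "indicator {p l<..p (Suc l)} r = (if l = k then 1 else 0 :: real)" if "l < N" for l
      proof (cases "l = k")
        case False
        then have "r \<notin> {p l<..p (Suc l)}" using uniq[OF that] by metis
        then show ?thesis using False by (simp del: greaterThanAtMost_iff)
      qed (simp only: indicator_simps(1)[OF k(2)] simp_thms if_True)
      have "simple_process N p \<eta> r \<omega> = (\<Sum>l<N. if l = k then live_coeff k \<omega> else 0)"
        unfolding simple_process_def coeff by (intro sum.cong) (auto simp: i)
      also have "\<dots> = live_coeff k \<omega>" using k by simp
      finally have "simple_process N p \<eta> r \<omega> = live_coeff k \<omega>" .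
      moreover have "(\<Sum>l<N. indicator {clamped l<..clamped (Suc l)} r * Y l \<omega>)
         = (\<Sum>l<N. if l = k then Y k \<omega> else 0)"
        unfolding ind[symmetric] by (intro sum.cong) (auto simp: i)
      ultimately show ?thesis using k True by (simp add: Y_def)
    next
      case False
      then have "indicator {p k<..p (Suc k)} r = (0::real)" if "k < N" for k
        using that by (auto simp: indicator_def)
      then show ?thesis unfolding simple_process_def ind[symmetric] by simp
    qed
  qed
  have Yi: "integrable M (Y k)" if k: "k < N" for k
  proof -
    have m [measurable]: "live_coeff k \<in> borel_measurable M" "P \<in> borel_measurable M"
      using measurable_enlargedD[OF measurable_live_coeff[OF k]] P by auto
    obtain c1 where c1: "0 \<le> c1" "\<And>\<omega>. \<omega> \<in> space M \<Longrightarrow> norm (live_coeff k \<omega>) \<le> c1"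
      using live_coeff_bounded[OF k] by blast
    have sq: "square_integrable M (live_coeff k)"
      by (rule square_integrable_bounded[OF finite_measure_axioms m(1) c1(2)])
    show ?thesis unfolding Y_def
      by (intro integrable_inner_square_integrable sq
          square_integrable_matrix_mult[OF sq m(2), of c] AE_I2 P(2))
  qed
  have sub: "{clamped k<..clamped (Suc k)} \<subseteq> {0..T}" for k
    using clamped_bounds(1)[of k] clamped_bounds(3)[of "Suc k"] st by auto
  have cell: "integrable (time_space T) (\<lambda>x. indicator {clamped k<..clamped (Suc k)} (fst x) * Y k (snd x)) \<and>
     (\<integral>x. indicator {clamped k<..clamped (Suc k)} (fst x) * Y k (snd x) \<partial>time_space T)
       = (clamped (Suc k) - clamped k) * expectation (Y k)" if k: "k < N" for k
  proof -
    have cm: "clamped k \<le> clamped (Suc k)" using clamped_mono[of k "Suc k"] k by auto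
    have [measurable]: "Y k \<in> borel_measurable M" using Yi[OF k] by auto
    have meas: "(\<lambda>x. indicator {clamped k<..clamped (Suc k)} (fst x) * Y k (snd x)) \<in> borel_measurable (time_space T)"
      by measurable
    have Yt: "integrable (time_space T) (\<lambda>x. Y k (snd x))"
      by (rule integrable_time_component[OF Yi[OF k]])
    have int: "integrable (time_space T) (\<lambda>x. indicator {clamped k<..clamped (Suc k)} (fst x) * Y k (snd x))"
      by (rule Bochner_Integration.integrable_bound[OF Yt meas]) (auto simp: indicator_def)
    have "(\<integral>x. indicator {clamped k<..clamped (Suc k)} (fst x) * Y k (snd x) \<partial>time_space T)
      = expectation (\<lambda>\<omega>. LINT r:{0..T}|lborel. indicator {clamped k<..clamped (Suc k)} r * Y k \<omega>)"
      using integral_time_space(2)[of T "\<lambda>r \<omega>. indicator {clamped k<..clamped (Suc k)} r * Y k \<omega>"] int by simp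
    also have "(\<lambda>\<omega>. LINT r:{0..T}|lborel. indicator {clamped k<..clamped (Suc k)} r * Y k \<omega>)
      = (\<lambda>\<omega>. (clamped (Suc k) - clamped k) * Y k \<omega>)"
    proof
      fix \<omega>
      have "(LINT r:{0..T}|lborel. indicator {clamped k<..clamped (Suc k)} r * Y k \<omega>)
        = (LINT r|lborel. indicator {clamped k<..clamped (Suc k)} r * Y k \<omega>)"
        unfolding set_lebesgue_integral_def using sub[of k]
        by (intro Bochner_Integration.integral_cong) (auto simp: indicator_def)
      also have "\<dots> = (clamped (Suc k) - clamped k) * Y k \<omega>" using cm by simp
      finally show "(LINT r:{0..T}|lborel. indicator {clamped k<..clamped (Suc k)} r * Y k \<omega>)
        = (clamped (Suc k) - clamped k) * Y k \<omega>" .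
    qed
    finally show ?thesis using int by simp
  qed
  show ?thesis
    unfolding pt Y_def[symmetric]
    by (subst Bochner_Integration.integral_sum) (simp_all add: cell del: indicator_simps)
qed

end

lemma simple_integral_zero:
  assumes "is_simple \<F> T N p \<eta>"
  shows "simple_integral W N p \<eta> 0 \<omega> = 0"
proof -
  have "0 \<le> p k" "0 \<le> p (Suc k)" if "k < N" for k
    using assms that unfolding is_simple_def by force+
  then show ?thesis by (simp add: simple_integral_def)
qed

text \<open>Orthogonality and isometry pass to the limit from simple integrands, because the weights are
  bounded or square-integrable.\<close>

context
  fixes T :: real and H :: "real \<Rightarrow> 'w \<Rightarrow> real ^ 'n" and I :: "real \<Rightarrow> 'w \<Rightarrow> real ^ 'n"
  assumes T: "0 \<le> T" and ito: "has_ito_integral M \<F> W T H I"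
begin

lemma ito_approximation:
  obtains N p \<eta> where "\<And>k. is_simple \<F> T (N k) (p k) (\<eta> k)"
    "L2_tendsto (time_space T) (\<lambda>k x. simple_process (N k) (p k) (\<eta> k) (fst x) (snd x)) (\<lambda>x. H (fst x) (snd x))"
    "\<And>t. t \<in> {0..T} \<Longrightarrow> L2_tendsto M (\<lambda>k. simple_integral W (N k) (p k) (\<eta> k) t) (I t)"
proof -
  obtain N p \<eta> where simple: "\<And>k::nat. is_simple \<F> T (N k) (p k) (\<eta> k)"
    and lim1: "(\<lambda>k. \<integral>\<^sup>+\<omega>. (\<integral>\<^sup>+t\<in>{0..T}.
            ennreal ((norm (H t \<omega> - simple_process (N k) (p k) (\<eta> k) t \<omega>))\<^sup>2) \<partial>lborel) \<partial>M)
          \<longlonglongrightarrow> 0"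
    and lim2: "\<And>t. t\<in>{0..T} \<Longrightarrow> (\<lambda>k. \<integral>\<^sup>+\<omega>.
            ennreal ((norm (I t \<omega> - simple_integral W (N k) (p k) (\<eta> k) t \<omega>))\<^sup>2) \<partial>M)
          \<longlonglongrightarrow> 0"
    using ito unfolding has_ito_integral_def by blast
  have Hm: "(\<lambda>x. H (fst x) (snd x)) \<in> borel_measurable (time_space T)"
    using ito T by (intro measurable_progressive) (auto simp: has_ito_integral_def L2_F_def)
  have sqp: "square_integrable (time_space T) (\<lambda>x. simple_process (N k) (p k) (\<eta> k) (fst x) (snd x))" for k
    using square_integrable_simple_process[OF simple, where s=0 and t=T] T by simp
  have pm: "(\<lambda>x. ennreal ((norm (H (fst x) (snd x) - simple_process (N k) (p k) (\<eta> k) (fst x) (snd x)))\<^sup>2))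
     \<in> borel_measurable (time_space T)" for k
    using Hm square_integrableD(1)[OF sqp[of k]] by measurable
  show thesis
  proof (rule that[OF simple])
    show "L2_tendsto (time_space T) (\<lambda>k x. simple_process (N k) (p k) (\<eta> k) (fst x) (snd x)) (\<lambda>x. H (fst x) (snd x))"
      using lim1 unfolding nn_integral_time_space[OF pm] by (intro L2_tendsto_nnI sqp Hm)
    fix t assume t: "t \<in> {0..T}"
    have "square_integrable M (simple_integral W (N k) (p k) (\<eta> k) t)" for k
      using square_integrable_simple_increment[OF simple[of k], of 0 t] t
      by (simp add: simple_integral_zero[OF simple])
    moreover have "I t \<in> borel_measurable M"
      using ito t unfolding has_ito_integral_def by (blast intro: measurable_filtrD)
    ultimately show "L2_tendsto M (\<lambda>k. simple_integral W (N k) (p k) (\<eta> k) t) (I t)"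
      using lim2[OF t] by (intro L2_tendsto_nnI)
  qed
qed

lemma square_integrable_ito: "t \<in> {0..T} \<Longrightarrow> square_integrable M (I t)"
  by (rule ito_approximation) (auto simp: L2_tendsto_def)

lemma ito_zero: "AE \<omega> in M. I 0 \<omega> = 0"
proof (rule ito_approximation)
  fix N p \<eta> assume simple: "\<And>k::nat. is_simple \<F> T (N k) (p k) (\<eta> k)"
    and *: "\<And>t. t \<in> {0..T} \<Longrightarrow> L2_tendsto M (\<lambda>k. simple_integral W (N k) (p k) (\<eta> k) t) (I t)"
  have "L2_tendsto M (\<lambda>k \<omega>. 0 :: real ^ 'n) (I 0)"
    using *[of 0] T by (simp add: simple_integral_zero[OF simple, abs_def])
  then have sq: "square_integrable M (I 0)" and "(\<lambda>k::nat. \<integral>\<omega>. (norm (I 0 \<omega>))\<^sup>2 \<partial>M) \<longlonglongrightarrow> 0"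
    by (auto simp: L2_tendsto_def)
  then have "(\<integral>\<omega>. (norm (I 0 \<omega>))\<^sup>2 \<partial>M) = 0"
    using LIMSEQ_unique[OF tendsto_const] by metis
  then have "AE \<omega> in M. (norm (I 0 \<omega>))\<^sup>2 = 0"
    using sq by (subst (asm) integral_nonneg_eq_0_iff_AE) auto
  then show ?thesis by eventually_elim simp
qed

lemma ito_increment_orthogonal:
  assumes st: "0 \<le> s" "s \<le> t" "t \<le> T"
    and Z: "Z \<in> borel_measurable (enlarged s)" "square_integrable M Z"
  shows "expectation (\<lambda>\<omega>. Z \<omega> \<bullet> (I t \<omega> - I s \<omega>)) = 0"
proof (rule ito_approximation)
  fix N p \<eta> assume simple: "\<And>k::nat. is_simple \<F> T (N k) (p k) (\<eta> k)"
    and *: "\<And>t. t \<in> {0..T} \<Longrightarrow> L2_tendsto M (\<lambda>k. simple_integral W (N k) (p k) (\<eta> k) t) (I t)"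
  let ?J = "\<lambda>k \<omega>. simple_integral W (N k) (p k) (\<eta> k) t \<omega> - simple_integral W (N k) (p k) (\<eta> k) s \<omega>"
  have J: "L2_tendsto M ?J (\<lambda>\<omega>. I t \<omega> - I s \<omega>)"
    using st by (intro L2_tendsto_diff *) auto
  have "integrable M (\<lambda>\<omega>. norm (Z \<omega>))"
  proof (rule Bochner_Integration.integrable_bound)
    show "integrable M (\<lambda>\<omega>. 1 + (norm (Z \<omega>))\<^sup>2)" using Z by auto
    have "a \<le> 1 + a\<^sup>2" if "a \<ge> 0" for a :: real
      using sum_squares_bound[of a 1] that by simp
    then show "AE \<omega> in M. norm (norm (Z \<omega>)) \<le> norm (1 + (norm (Z \<omega>))\<^sup>2)" by simp
  qed (use Z in auto)
  then have z: "(\<integral>\<omega>. Z \<omega> \<bullet> (mat 1 *v ?J k \<omega>) \<partial>M) = 0" for k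
    using expectation_inner_simple_increment[OF simple st Z(1)] by simp
  have "(\<lambda>k. \<integral>\<omega>. Z \<omega> \<bullet> (mat 1 *v ?J k \<omega>) \<partial>M) \<longlonglongrightarrow> (\<integral>\<omega>. Z \<omega> \<bullet> (mat 1 *v (I t \<omega> - I s \<omega>)) \<partial>M)"
    by (rule tendsto_integral_matrix_form[OF L2_tendsto_const[OF Z(2)] J, where c = "norm (mat 1 :: real ^ 'n ^ 'n)"]) auto
  then show ?thesis
    unfolding z using LIMSEQ_unique[OF tendsto_const] by force
qed

lemma ito_increment_isometry:
  assumes st: "0 \<le> s" "s \<le> t" "t \<le> T"
    and P: "P \<in> borel_measurable (enlarged s)" "\<And>\<omega>. \<omega> \<in> space M \<Longrightarrow> norm (P \<omega>) \<le> c"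
  shows "expectation (\<lambda>\<omega>. (I t \<omega> - I s \<omega>) \<bullet> (P \<omega> *v (I t \<omega> - I s \<omega>)))
    = (\<integral>x. H (fst x) (snd x) \<bullet> ((indicator {s<..t} (fst x) *\<^sub>R P (snd x)) *v H (fst x) (snd x)) \<partial>time_space T)"
proof (rule ito_approximation)
  fix N p \<eta> assume simple: "\<And>k::nat. is_simple \<F> T (N k) (p k) (\<eta> k)"
    and S: "L2_tendsto (time_space T) (\<lambda>k x. simple_process (N k) (p k) (\<eta> k) (fst x) (snd x)) (\<lambda>x. H (fst x) (snd x))"
    and *: "\<And>t. t \<in> {0..T} \<Longrightarrow> L2_tendsto M (\<lambda>k. simple_integral W (N k) (p k) (\<eta> k) t) (I t)"
  let ?J = "\<lambda>k \<omega>. simple_integral W (N k) (p k) (\<eta> k) t \<omega> - simple_integral W (N k) (p k) (\<eta> k) s \<omega>"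
  have J: "L2_tendsto M ?J (\<lambda>\<omega>. I t \<omega> - I s \<omega>)"
    using st by (intro L2_tendsto_diff *) auto
  have PM [measurable]: "P \<in> borel_measurable M" by (rule measurable_enlargedD[OF P(1)])
  obtain \<omega>0 where "\<omega>0 \<in> space M" using not_empty by blast
  then have c: "0 \<le> c" using P(2)[of \<omega>0] norm_ge_zero order_trans by blast
  let ?P = "\<lambda>x. indicator {s<..t} (fst x) *\<^sub>R P (snd x)"
  have Pm: "?P \<in> borel_measurable (time_space T)"
    by measurable
  have Pb: "AE x in time_space T. norm (?P x) \<le> c"
    using P(2) c by (intro AE_I2) (auto simp: indicator_def)
  have 1: "(\<lambda>k. \<integral>\<omega>. ?J k \<omega> \<bullet> (P \<omega> *v ?J k \<omega>) \<partial>M) \<longlonglongrightarrow> (\<integral>\<omega>. (I t \<omega> - I s \<omega>) \<bullet> (P \<omega> *v (I t \<omega> - I s \<omega>)) \<partial>M)"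
    using P(2) c by (intro tendsto_integral_matrix_form[OF J J, where c=c] PM AE_I2) auto
  have 2: "(\<lambda>k. \<integral>x. simple_process (N k) (p k) (\<eta> k) (fst x) (snd x) \<bullet>
       (?P x *v simple_process (N k) (p k) (\<eta> k) (fst x) (snd x)) \<partial>time_space T)
     \<longlonglongrightarrow> (\<integral>x. H (fst x) (snd x) \<bullet> (?P x *v H (fst x) (snd x)) \<partial>time_space T)"
    using c Pb by (intro tendsto_integral_matrix_form[OF S S, where c=c] Pm) auto
  have "(\<integral>\<omega>. ?J k \<omega> \<bullet> (P \<omega> *v ?J k \<omega>) \<partial>M) = (\<integral>x. simple_process (N k) (p k) (\<eta> k) (fst x) (snd x) \<bullet>
       (?P x *v simple_process (N k) (p k) (\<eta> k) (fst x) (snd x)) \<partial>time_space T)" for k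
    by (rule trans[OF expectation_form_simple_increment[OF simple st P]
          integral_form_simple_process[OF simple st PM P(2), symmetric]])
  with 1 show ?thesis by (simp add: LIMSEQ_unique[OF _ 2])
qed

end

end

section \<open>Integrals over short time intervals\<close>

text \<open>Jensen's inequality for the average over an interval, obtained by integrating
  \<open>2 * m * \<parallel>f\<parallel> \<le> m\<^sup>2 + \<parallel>f\<parallel>\<^sup>2\<close> for the mean \<open>m\<close> of \<open>\<parallel>f\<parallel>\<close>.\<close>

lemma norm_set_integral_square_le:
  fixes f :: "real \<Rightarrow> 'v::euclidean_space"
  assumes st: "s \<le> t" and f: "set_integrable lborel {s<..t} f"
    and f2: "set_integrable lborel {s<..t} (\<lambda>r. (norm (f r))\<^sup>2)"
  shows "(norm (LINT r:{s<..t}|lborel. f r))\<^sup>2 \<le> (t - s) * (LINT r:{s<..t}|lborel. (norm (f r))\<^sup>2)"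
proof (cases "s = t")
  case True
  then show ?thesis by (simp add: set_lebesgue_integral_def)
next
  case False
  define h m where "h = t - s" and "m = (LINT r:{s<..t}|lborel. norm (f r)) / h"
  have h: "h > 0" using st False by (simp add: h_def)
  have n: "set_integrable lborel {s<..t} (\<lambda>r. norm (f r))" using f by (rule set_integrable_norm)
  have c: "set_integrable lborel {s<..t} (\<lambda>r. m\<^sup>2)"
    unfolding set_integrable_def
    using st by (intro integrable_scaleR_left integrable_real_indicator) auto
  have "(LINT r:{s<..t}|lborel. 2 * m * norm (f r)) \<le> (LINT r:{s<..t}|lborel. m\<^sup>2 + (norm (f r))\<^sup>2)"
  proof (rule set_integral_mono)
    show "set_integrable lborel {s<..t} (\<lambda>r. 2 * m * norm (f r))"
      using n by (intro set_integrable_mult_right)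
    show "2 * m * norm (f r) \<le> m\<^sup>2 + (norm (f r))\<^sup>2" for r
      by (rule sum_squares_bound)
  qed (use c f2 in auto)
  also have "\<dots> = (LINT r:{s<..t}|lborel. m\<^sup>2) + (LINT r:{s<..t}|lborel. (norm (f r))\<^sup>2)"
    using c f2 by (rule set_integral_add(2))
  also have "(LINT r:{s<..t}|lborel. m\<^sup>2) = h * m\<^sup>2"
    using st by (simp add: set_lebesgue_integral_def h_def)
  also have "(LINT r:{s<..t}|lborel. 2 * m * norm (f r)) = 2 * m * (h * m)"
    using h by (simp add: m_def)
  finally have 1: "h * m\<^sup>2 \<le> (LINT r:{s<..t}|lborel. (norm (f r))\<^sup>2)"
    by (simp add: power2_eq_square mult_ac)
  have "norm (LINT r:{s<..t}|lborel. f r) \<le> h * m"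
    using set_integral_norm_bound[OF f] h by (simp add: m_def)
  then have "(norm (LINT r:{s<..t}|lborel. f r))\<^sup>2 \<le> (h * m)\<^sup>2"
    by (intro power_mono) auto
  also have "\<dots> = h * (h * m\<^sup>2)" by (simp add: power2_eq_square mult_ac)
  also have "\<dots> \<le> h * (LINT r:{s<..t}|lborel. (norm (f r))\<^sup>2)"
    using h 1 by (intro mult_left_mono) auto
  finally show ?thesis by (simp add: h_def)
qed

lemma set_integral_split:
  fixes f :: "real \<Rightarrow> 'v::euclidean_space"
  assumes "0 \<le> s" "s \<le> t" and f: "set_integrable lborel {0..t} f"
  shows "(LINT r:{0..t}|lborel. f r) = (LINT r:{0..s}|lborel. f r) + (LINT r:{s<..t}|lborel. f r)"
proof -
  have u: "{0..t} = {0..s} \<union> {s<..t}" using assms by auto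
  have "set_integrable lborel {0..s} f" "set_integrable lborel {s<..t} f"
    using assms by (auto intro!: set_integrable_subset[OF f])
  then show ?thesis unfolding u by (intro set_integral_Un) auto
qed

context regime_switching_space
begin

text \<open>The exceptional set may be examined path by path: Fubini exchanges the two quantifiers once it is
  known to be measurable.\<close>

lemma AE_time_space:
  assumes m: "{z\<in>space (time_space T). P (fst z) (snd z)} \<in> sets (time_space T)"
    and ae: "AE \<omega> in M. AE t in lborel. t \<in> {0..T} \<longrightarrow> P t \<omega>"
  shows "AE z in time_space T. P (fst z) (snd z)"
proof -
  interpret P: pair_sigma_finite "restrict_space lborel {0..T}" M by (rule pair_sigma_finite_time)
  have "AE \<omega> in M. AE t in restrict_space lborel {0..T}. P t \<omega>"
    using ae by (simp add: AE_restrict_space_iff)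
  then have "AE t in restrict_space lborel {0..T}. AE \<omega> in M. P t \<omega>"
    using P.AE_commute[of P] m by (simp add: time_space_def)
  then show ?thesis
    unfolding time_space_def
    by (intro P.AE_pair_measure) (use m in \<open>auto simp: time_space_def\<close>)
qed

lemma AE_time_space_deterministic:
  assumes "AE t in lborel. t \<in> {0..T} \<longrightarrow> P t"
  shows "AE z in time_space T. P (fst z)"
proof -
  obtain N where N: "N \<in> null_sets lborel" "{t. \<not> (t \<in> {0..T} \<longrightarrow> P t)} \<subseteq> N"
    using assms by (auto simp: eventually_ae_filter)
  have "AE z in time_space T. fst z \<notin> N"
  proof (rule AE_time_space)
    have "{z\<in>space (time_space T). fst z \<notin> N} = space (time_space T) - fst -` N \<inter> space (time_space T)"
      by auto
    also have "\<dots> \<in> sets (time_space T)"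
      using N by (intro sets.Diff sets.top measurable_sets[OF measurable_time_fst]) auto
    finally show "{z\<in>space (time_space T). fst z \<notin> N} \<in> sets (time_space T)" .
    have "AE t in lborel. t \<in> {0..T} \<longrightarrow> t \<notin> N"
      using AE_not_in[OF N(1)] by eventually_elim simp
    then show "AE \<omega> in M. AE t in lborel. t \<in> {0..T} \<longrightarrow> t \<notin> N" by (rule AE_I2)
  qed
  with AE_space show ?thesis by eventually_elim (use N in auto)
qed

lemma square_integrable_time_component:
  assumes "square_integrable M f"
  shows "square_integrable (time_space T) (\<lambda>z. f (snd z))"
  using assms integrable_time_component[of "\<lambda>\<omega>. (norm (f \<omega>))\<^sup>2" T]
  by (auto simp: square_integrable_def intro: measurable_time_component)

definition cell_energy :: "real \<Rightarrow> (real \<Rightarrow> 'w \<Rightarrow> 'v::euclidean_space) \<Rightarrow> real \<Rightarrow> real \<Rightarrow> real" where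
  "cell_energy T f s t = (\<integral>z. indicator {s<..t} (fst z) * (norm (f (fst z) (snd z)))\<^sup>2 \<partial>time_space T)"

lemma integrable_cell:
  fixes g :: "real \<times> 'w \<Rightarrow> real"
  assumes "integrable (time_space T) g"
  shows "integrable (time_space T) (\<lambda>z. indicator {s<..t::real} (fst z) * g z)"
proof (rule Bochner_Integration.integrable_bound[OF assms])
  show "(\<lambda>z. indicator {s<..t::real} (fst z) * g z) \<in> borel_measurable (time_space T)"
    using assms measurable_time_fst[of T] by measurable
qed (auto simp: indicator_def)

lemma set_integrable_cell:
  fixes f :: "real \<Rightarrow> 'v::euclidean_space"
  assumes "set_integrable lborel {0..T} f" "0 \<le> s" "t \<le> T"
  shows "set_integrable lborel {s<..t} f"
  using assms by (intro set_integrable_subset[OF assms(1)]) auto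

lemma set_integral_cell:
  fixes f :: "real \<Rightarrow> 'v::euclidean_space"
  assumes "0 \<le> s" "t \<le> T"
  shows "(LINT r:{0..T}|lborel. indicator {s<..t} r *\<^sub>R f r) = (LINT r:{s<..t}|lborel. f r)"
  unfolding set_lebesgue_integral_def
  using assms by (intro Bochner_Integration.integral_cong) (auto simp: indicator_def)

lemma finite_measure_integrable_square:
  assumes "square_integrable N f" "finite_measure N"
  shows "integrable N f"
proof -
  have "integrable N (\<lambda>x. norm (f x))"
  proof (rule Bochner_Integration.integrable_bound)
    show "integrable N (\<lambda>x. 1 + (norm (f x))\<^sup>2)"
      using square_integrableD(2)[OF assms(1)] finite_measure.integrable_const[OF assms(2), of "1 :: real"]
      by (intro Bochner_Integration.integrable_add)
    have "a \<le> 1 + a\<^sup>2" if "a \<ge> 0" for a :: real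
      using sum_squares_bound[of a 1] that by simp
    then show "AE x in N. norm (norm (f x)) \<le> norm (1 + (norm (f x))\<^sup>2)" by simp
  qed (use assms in auto)
  then show ?thesis using assms by (subst integrable_norm_iff[symmetric]) auto
qed

section \<open>State dynamics\<close>

definition drift :: "(real \<Rightarrow> 'w \<Rightarrow> 'v::euclidean_space) \<Rightarrow> real \<Rightarrow> real \<Rightarrow> 'w \<Rightarrow> 'v" where
  "drift a s t \<omega> = (LINT r:{s<..t}|lborel. a r \<omega>)"

end

text \<open>A process \<open>x\<close> with \<open>dx = a dt + H dW\<close> on \<open>[0,T]\<close> that starts at \<open>\<xi>\<close>; \<open>I\<close> is its martingale part.\<close>

locale ito_process = regime_switching_space M W \<alpha> \<pi> i\<^sub>0
  for M :: "'w measure" and W :: "real \<Rightarrow> 'w \<Rightarrow> real" and \<alpha> :: "real \<Rightarrow> 'w \<Rightarrow> 'd::finite"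
    and \<pi> :: "'d \<Rightarrow> 'd \<Rightarrow> real" and i\<^sub>0 :: 'd +
  fixes T :: real and a x H I :: "real \<Rightarrow> 'w \<Rightarrow> real ^ 'n" and \<xi> :: "real ^ 'n"
  assumes T: "0 < T" and a: "square_integrable (time_space T) (\<lambda>z. a (fst z) (snd z))"
    and x_adapted: "\<And>t. t \<in> {0..T} \<Longrightarrow> x t \<in> borel_measurable (\<F> t)"
    and x_sq: "square_integrable (time_space T) (\<lambda>z. x (fst z) (snd z))"
    and ito: "has_ito_integral M \<F> W T H I"
    and dynamics: "AE \<omega> in M. \<forall>t\<in>{0..T}. x t \<omega> = \<xi> + (LINT s:{0..t}|lborel. a s \<omega>) + I t \<omega>"
begin

lemma drift_cell:
  fixes s t :: real
  assumes st: "0 \<le> s" "s \<le> t" "t \<le> T"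
  shows "square_integrable M (drift a s t)"
    and "expectation (\<lambda>\<omega>. (norm (drift a s t \<omega>))\<^sup>2) \<le> (t - s) * cell_energy T a s t"
    and "square_integrable M Z \<Longrightarrow> expectation (\<lambda>\<omega>. Z \<omega> \<bullet> drift a s t \<omega>)
       = (\<integral>z. indicator {s<..t} (fst z) * (Z (snd z) \<bullet> a (fst z) (snd z)) \<partial>time_space T)"
proof -
  have ai: "integrable (time_space T) (\<lambda>z. a (fst z) (snd z))"
    by (rule finite_measure_integrable_square[OF a finite_measure_time_space])
  have a2: "integrable (time_space T) (\<lambda>z. (norm (a (fst z) (snd z)))\<^sup>2)" using a by auto
  have cell: "integrable (time_space T) (\<lambda>z. indicator {s<..t} (fst z) *\<^sub>R a (fst z) (snd z))"
  proof (rule Bochner_Integration.integrable_bound[OF ai])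
    show "(\<lambda>z. indicator {s<..t} (fst z) *\<^sub>R a (fst z) (snd z)) \<in> borel_measurable (time_space T)"
      using ai measurable_time_fst[of T] by measurable
  qed (auto simp: indicator_def)
  have d: "(LINT r:{0..T}|lborel. indicator {s<..t} r *\<^sub>R a r \<omega>) = drift a s t \<omega>" for \<omega>
    unfolding drift_def using st by (intro set_integral_cell) auto
  have dm [measurable]: "drift a s t \<in> borel_measurable M"
    using integral_time_space(1)[of T "\<lambda>r \<omega>. indicator {s<..t} r *\<^sub>R a r \<omega>", OF cell]
    unfolding d by auto
  have c2: "integrable (time_space T) (\<lambda>z. indicator {s<..t} (fst z) * (norm (a (fst z) (snd z)))\<^sup>2)"
    by (rule integrable_cell[OF a2])
  note E = integral_time_space[of T "\<lambda>r \<omega>. indicator {s<..t} r *\<^sub>R (norm (a r \<omega>))\<^sup>2", simplified, OF c2]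
  have E_eq: "(LINT r:{0..T}|lborel. indicator {s<..t} r * (norm (a r \<omega>))\<^sup>2)
      = (LINT r:{s<..t}|lborel. (norm (a r \<omega>))\<^sup>2)" for \<omega>
    using set_integral_cell[of s t T "\<lambda>r. (norm (a r \<omega>))\<^sup>2"] st by simp
  have path: "AE \<omega> in M. (norm (drift a s t \<omega>))\<^sup>2
      \<le> (t - s) * (LINT r:{0..T}|lborel. indicator {s<..t} r * (norm (a r \<omega>))\<^sup>2)"
    using integral_time_space(3)[OF ai] integral_time_space(3)[OF a2]
  proof eventually_elim
    case (elim \<omega>)
    then show ?case
      unfolding drift_def E_eq using st
      by (intro norm_set_integral_square_le set_integrable_cell[of T]) auto
  qed
  have bnd: "integrable M (\<lambda>\<omega>. (t - s) * (LINT r:{0..T}|lborel. indicator {s<..t} r * (norm (a r \<omega>))\<^sup>2))"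
    using E(1) by simp
  show sq: "square_integrable M (drift a s t)"
    by (rule square_integrable_bound[OF bnd dm path])
  have "expectation (\<lambda>\<omega>. (norm (drift a s t \<omega>))\<^sup>2)
     \<le> expectation (\<lambda>\<omega>. (t - s) * (LINT r:{0..T}|lborel. indicator {s<..t} r * (norm (a r \<omega>))\<^sup>2))"
    using sq bnd path by (intro integral_mono_AE) auto
  then show "expectation (\<lambda>\<omega>. (norm (drift a s t \<omega>))\<^sup>2) \<le> (t - s) * cell_energy T a s t"
    using E(2) by (simp add: cell_energy_def)
  assume Z: "square_integrable M Z"
  have Za: "integrable (time_space T) (\<lambda>z. Z (snd z) \<bullet> a (fst z) (snd z))"
    by (intro integrable_inner_square_integrable square_integrable_time_component Z a)
  have "AE \<omega> in M. Z \<omega> \<bullet> drift a s t \<omega>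
     = (LINT r:{0..T}|lborel. indicator {s<..t} r * (Z \<omega> \<bullet> a r \<omega>))"
    using integral_time_space(3)[OF ai]
  proof eventually_elim
    case (elim \<omega>)
    then have i: "set_integrable lborel {s<..t} (\<lambda>r. a r \<omega>)"
      using st by (intro set_integrable_cell[of T]) auto
    have "(LINT r:{0..T}|lborel. indicator {s<..t} r * (Z \<omega> \<bullet> a r \<omega>))
       = (LINT r:{s<..t}|lborel. Z \<omega> \<bullet> a r \<omega>)"
      using set_integral_cell[of s t T "\<lambda>r. Z \<omega> \<bullet> a r \<omega>"] st by simp
    also have "\<dots> = Z \<omega> \<bullet> drift a s t \<omega>"
    proof -
      have "(LINT r|lborel. Z \<omega> \<bullet> (indicator {s<..t} r *\<^sub>R a r \<omega>))
         = Z \<omega> \<bullet> (LINT r|lborel. indicator {s<..t} r *\<^sub>R a r \<omega>)"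
        by (rule integral_inner_right) (use i in \<open>simp add: set_integrable_def\<close>)
      then show ?thesis by (simp add: drift_def set_lebesgue_integral_def)
    qed
    finally show ?case by simp
  qed
  then have "expectation (\<lambda>\<omega>. Z \<omega> \<bullet> drift a s t \<omega>)
    = expectation (\<lambda>\<omega>. LINT r:{0..T}|lborel. indicator {s<..t} r * (Z \<omega> \<bullet> a r \<omega>))"
    using integral_time_space(1)[of T "\<lambda>r \<omega>. indicator {s<..t} r * (Z \<omega> \<bullet> a r \<omega>)",
        OF integrable_cell[OF Za]] square_integrableD(1)[OF Z]
    by (intro integral_cong_AE) auto
  also have "\<dots> = (\<integral>z. indicator {s<..t} (fst z) * (Z (snd z) \<bullet> a (fst z) (snd z)) \<partial>time_space T)"
    by (rule integral_time_space(2)[of T "\<lambda>r \<omega>. indicator {s<..t} r * (Z \<omega> \<bullet> a r \<omega>)",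
        OF integrable_cell[OF Za]])
  finally show "expectation (\<lambda>\<omega>. Z \<omega> \<bullet> drift a s t \<omega>)
       = (\<integral>z. indicator {s<..t} (fst z) * (Z (snd z) \<bullet> a (fst z) (snd z)) \<partial>time_space T)" .
qed

lemma H_sq: "square_integrable (time_space T) (\<lambda>z. H (fst z) (snd z))"
  using ito T by (intro square_integrable_L2_F) (auto simp: has_ito_integral_def)

lemma state_zero: "AE \<omega> in M. x 0 \<omega> = \<xi>"
  using dynamics ito_zero[OF less_imp_le[OF T] ito]
proof eventually_elim
  case (elim \<omega>)
  have "(LINT s:{0..0}|lborel. a s \<omega>) = 0"
    unfolding set_lebesgue_integral_def
  proof (rule integral_eq_zero_AE)
    show "AE s in lborel. indicator {0..0} s *\<^sub>R a s \<omega> = 0"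
      using AE_lborel_singleton[of "0::real"] by eventually_elim simp
  qed
  then show ?case using elim T by auto
qed

lemma state_increment:
  assumes st: "0 \<le> s" "s \<le> t" "t \<le> T"
  shows "AE \<omega> in M. x t \<omega> - x s \<omega> = drift a s t \<omega> + (I t \<omega> - I s \<omega>)"
proof -
  have "integrable (time_space T) (\<lambda>z. a (fst z) (snd z))"
    by (rule finite_measure_integrable_square[OF a finite_measure_time_space])
  from integral_time_space(3)[OF this] dynamics show ?thesis
  proof eventually_elim
    case (elim \<omega>)
    have "set_integrable lborel {0..t} (\<lambda>r. a r \<omega>)"
      using st by (intro set_integrable_subset[OF elim(1)]) auto
    from set_integral_split[OF st(1,2) this] elim(2) st show ?case by (simp add: drift_def)
  qed
qed

lemma square_integrable_state: "t \<in> {0..T} \<Longrightarrow> square_integrable M (x t)"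
proof -
  assume t: "t \<in> {0..T}"
  have eq: "AE \<omega> in M. x t \<omega> = \<xi> + drift a 0 t \<omega> + (I t \<omega> - I 0 \<omega>)"
    using state_increment[of 0 t] state_zero t by (auto elim!: eventually_elim2 simp: algebra_simps)
  have sq: "square_integrable M (\<lambda>\<omega>. \<xi> + drift a 0 t \<omega> + (I t \<omega> - I 0 \<omega>))"
    using t T drift_cell(1)[of 0 t]
    by (intro square_integrable_add square_integrable_diff square_integrable_ito[OF less_imp_le[OF T] ito]
        square_integrable_bounded[OF finite_measure_axioms, where f="\<lambda>_. \<xi>" and c="norm \<xi>"]) auto
  have [measurable]: "x t \<in> borel_measurable M" by (rule measurable_filtrD[OF x_adapted[OF t]])
  show ?thesis
    using sq eq by (intro square_integrable_bound[OF square_integrableD(2)[OF sq]]) (auto elim: eventually_mono)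
qed

lemma ito_increment_energy:
  assumes st: "0 \<le> s" "s \<le> t" "t \<le> T"
  shows "expectation (\<lambda>\<omega>. (norm (I t \<omega> - I s \<omega>))\<^sup>2) = cell_energy T H s t"
proof -
  have "expectation (\<lambda>\<omega>. (I t \<omega> - I s \<omega>) \<bullet> (mat 1 *v (I t \<omega> - I s \<omega>)))
    = (\<integral>z. H (fst z) (snd z) \<bullet> ((indicator {s<..t} (fst z) *\<^sub>R mat 1) *v H (fst z) (snd z)) \<partial>time_space T)"
    by (rule ito_increment_isometry[OF less_imp_le[OF T] ito st, of "\<lambda>_. mat 1" "norm (mat 1 :: real ^ 'n ^ 'n)"]) auto
  then show ?thesis
    by (simp add: cell_energy_def power2_norm_eq_inner scaleR_matrix_vector_assoc[symmetric])
qed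

lemma state_increment_energy:
  assumes st: "0 \<le> s" "s \<le> t" "t \<le> T"
  shows "expectation (\<lambda>\<omega>. (norm (x t \<omega> - x s \<omega>))\<^sup>2)
    \<le> 2 * ((t - s) * cell_energy T a s t + cell_energy T H s t)"
proof -
  have sq: "square_integrable M (drift a s t)" "square_integrable M (\<lambda>\<omega>. I t \<omega> - I s \<omega>)"
    "square_integrable M (\<lambda>\<omega>. x t \<omega> - x s \<omega>)"
    using st by (auto intro!: drift_cell square_integrable_diff square_integrable_ito[OF less_imp_le[OF T] ito] square_integrable_state)
  have "expectation (\<lambda>\<omega>. (norm (x t \<omega> - x s \<omega>))\<^sup>2)
    \<le> expectation (\<lambda>\<omega>. 2 * (norm (drift a s t \<omega>))\<^sup>2 + 2 * (norm (I t \<omega> - I s \<omega>))\<^sup>2)"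
  proof (rule integral_mono_AE)
    show "AE \<omega> in M. (norm (x t \<omega> - x s \<omega>))\<^sup>2 \<le> 2 * (norm (drift a s t \<omega>))\<^sup>2 + 2 * (norm (I t \<omega> - I s \<omega>))\<^sup>2"
      using state_increment[OF st]
    proof eventually_elim
      case (elim \<omega>)
      show ?case unfolding elim by (rule norm_add_square_le)
    qed
  qed (use sq[THEN square_integrableD(2)] in auto)
  also have "\<dots> = 2 * expectation (\<lambda>\<omega>. (norm (drift a s t \<omega>))\<^sup>2) + 2 * cell_energy T H s t"
    using sq[THEN square_integrableD(2)] by (simp add: ito_increment_energy[OF st])
  finally show ?thesis using drift_cell(2)[OF st] by simp
qed

end

section \<open>Regime-dependent quadratic weights\<close>

text \<open>A quadratic weight \<open>k t i\<close> for each regime, absolutely continuous in time with value \<open>\<kappa> i\<close> at time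
  \<open>0\<close> and bounded derivative \<open>\<theta>\<close>.\<close>

locale weighted_ito_process = ito_process M W \<alpha> \<pi> i\<^sub>0 T a x H I \<xi>
  for M :: "'w measure" and W :: "real \<Rightarrow> 'w \<Rightarrow> real" and \<alpha> :: "real \<Rightarrow> 'w \<Rightarrow> 'd::finite"
    and \<pi> :: "'d \<Rightarrow> 'd \<Rightarrow> real" and i\<^sub>0 :: 'd and T :: real
    and a x H I :: "real \<Rightarrow> 'w \<Rightarrow> real ^ 'n" and \<xi> :: "real ^ 'n" +
  fixes \<kappa> :: "'d \<Rightarrow> real ^ 'n ^ 'n" and \<theta> :: "real \<Rightarrow> 'd \<Rightarrow> real ^ 'n ^ 'n" and c :: real
  assumes \<theta>_measurable: "\<And>i. (\<lambda>t. \<theta> t i) \<in> borel_measurable borel"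
    and \<theta>_bound: "\<And>t i. norm (\<theta> t i) \<le> c"
begin

definition k :: "real \<Rightarrow> 'd \<Rightarrow> real ^ 'n ^ 'n" where
  "k t i = \<kappa> i + (LINT s:{0..t}|lborel. \<theta> s i)"

definition k_bound :: real where "k_bound = (\<Sum>i\<in>UNIV. norm (\<kappa> i)) + c * T"

lemma c_nonneg: "0 \<le> c"
  using \<theta>_bound[of 0 i\<^sub>0] norm_ge_zero order_trans by blast

lemma set_integrable_\<theta>:
  assumes "A \<in> sets lborel" "emeasure lborel A < \<infinity>"
  shows "set_integrable lborel A (\<lambda>r. \<theta> r i)"
  unfolding set_integrable_def
  by (rule integrableI_bounded_set_indicator[where B=c]) (use assms \<theta>_measurable \<theta>_bound in auto)

lemma k_increment: "0 \<le> s \<Longrightarrow> s \<le> t \<Longrightarrow> k t i = k s i + (LINT r:{s<..t}|lborel. \<theta> r i)"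
  using set_integral_split[of s t "\<lambda>r. \<theta> r i"] set_integrable_\<theta>[of "{0..t}" i]
  by (simp add: k_def)

lemma k_lipschitz:
  assumes "0 \<le> s" "s \<le> t"
  shows "norm (k t i - k s i) \<le> c * (t - s)"
proof -
  have int: "set_integrable lborel {s<..t} (\<lambda>r. \<theta> r i)" using assms by (intro set_integrable_\<theta>) auto
  have "norm (k t i - k s i) \<le> (LINT r:{s<..t}|lborel. norm (\<theta> r i))"
    using set_integral_norm_bound[OF int] k_increment[OF assms] by simp
  also have "\<dots> \<le> (LINT r:{s<..t}|lborel. c)"
  proof (rule set_integral_mono)
    show "set_integrable lborel {s<..t} (\<lambda>r. c)"
      unfolding set_integrable_def
      using assms by (intro integrable_scaleR_left integrable_real_indicator) auto
  qed (use int \<theta>_bound in \<open>auto intro: set_integrable_norm\<close>)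
  also have "\<dots> = c * (t - s)" using assms by (simp add: set_lebesgue_integral_def)
  finally show ?thesis .
qed

lemma k_zero: "k 0 i = \<kappa> i"
proof -
  have "(LINT s:{0..0}|lborel. \<theta> s i) = 0"
    unfolding set_lebesgue_integral_def
  proof (rule integral_eq_zero_AE)
    show "AE s in lborel. indicator {0..0} s *\<^sub>R \<theta> s i = 0"
      using AE_lborel_singleton[of "0::real"] by eventually_elim simp
  qed
  then show ?thesis by (simp add: k_def)
qed

lemma k_bounded:
  assumes "t \<in> {0..T}"
  shows "norm (k t i) \<le> k_bound"
proof -
  have "norm (k t i) \<le> norm (k t i - k 0 i) + norm (\<kappa> i)"
    using norm_triangle_ineq[of "k t i - k 0 i" "k 0 i"] by (simp add: k_zero)
  also have "norm (k t i - k 0 i) \<le> c * t" using k_lipschitz[of 0 t i] assms by simp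
  also have "c * t \<le> c * T" using c_nonneg assms by (intro mult_left_mono) auto
  also have "norm (\<kappa> i) \<le> (\<Sum>i\<in>UNIV. norm (\<kappa> i))" by (rule member_le_sum) auto
  finally show ?thesis by (simp add: k_bound_def)
qed

lemma k_bound_nonneg: "0 \<le> k_bound"
  using order_trans[OF norm_ge_zero k_bounded[of 0 i\<^sub>0]] T by simp

lemma k_continuous: "continuous_on {0..T} (\<lambda>t. k t i)"
proof (rule continuous_onI)
  fix t e :: real assume t: "t \<in> {0..T}" and e: "e > 0"
  have "dist (k s i) (k t i) \<le> e" if s: "s \<in> {0..T}" and d: "dist s t < e / (c + 1)" for s
  proof -
    have "dist (k s i) (k t i) \<le> c * dist s t"
      using k_lipschitz[of s t i] k_lipschitz[of t s i] s t
      by (cases "s \<le> t") (auto simp: dist_norm norm_minus_commute abs_real_def)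
    also have "\<dots> \<le> (c + 1) * (e / (c + 1))" using c_nonneg d by (intro mult_mono) auto
    finally show ?thesis using c_nonneg by simp
  qed
  then show "\<exists>d>0. \<forall>s\<in>{0..T}. dist s t < d \<longrightarrow> dist (k s i) (k t i) \<le> e"
    using e c_nonneg by (intro exI[of _ "e / (c + 1)"]) auto
qed

lemma k_tendsto:
  assumes s: "\<And>n. s n \<in> {0..T}" "s \<longlonglongrightarrow> t" and t: "t \<in> {0..T}"
  shows "(\<lambda>n. k (s n) i) \<longlonglongrightarrow> k t i"
  using continuous_on_tendsto_compose[OF k_continuous s(2) t] s(1) by simp

lemma measurable_weight_chain:
  assumes "0 \<le> t"
  shows "(\<lambda>\<omega>. k t (\<alpha> t \<omega>)) \<in> borel_measurable (enlarged s)"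
  by (rule measurable_compose[OF measurable_chain_enlarged[OF assms]]) simp

definition difference_quotient :: "(real \<Rightarrow> 'd \<Rightarrow> 'd \<Rightarrow> real) \<Rightarrow> real \<Rightarrow> 'd \<Rightarrow> 'd \<Rightarrow> real" where
  "difference_quotient p h i j = (p h i j - of_bool (i = j)) / h"

text \<open>With \<open>p\<close> the transition function, \<open>chain_rate\<close> is the mean rate of change of \<open>k t (\<alpha> t)\<close> over
  \<open>(s,t]\<close> given the state at time \<open>s\<close>: the derivative of the weight in the regime at time \<open>s\<close>, plus the
  generator with its derivative at zero replaced by a difference quotient.  The function \<open>cell_rate\<close>
  is the density of the exact change of \<open>E (x t \<bullet> k t (\<alpha> t) x t)\<close> over that interval.\<close>

definition chain_rate :: "(real \<Rightarrow> 'd \<Rightarrow> 'd \<Rightarrow> real) \<Rightarrow> real \<Rightarrow> real \<Rightarrow> real \<times> 'w \<Rightarrow> real ^ 'n ^ 'n" where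
  "chain_rate p s t z = \<theta> (fst z) (\<alpha> s (snd z)) + (\<Sum>j\<in>UNIV. difference_quotient p (t - s) (\<alpha> s (snd z)) j *\<^sub>R k t j)"

definition cell_rate :: "(real \<Rightarrow> 'd \<Rightarrow> 'd \<Rightarrow> real) \<Rightarrow> real \<Rightarrow> real \<Rightarrow> real \<times> 'w \<Rightarrow> real" where
  "cell_rate p s t z =
     x s (snd z) \<bullet> (k t (\<alpha> t (snd z)) *v a (fst z) (snd z))
     + a (fst z) (snd z) \<bullet> (k t (\<alpha> t (snd z)) *v x t (snd z))
     + (I t (snd z) - I s (snd z)) \<bullet> (k t (\<alpha> t (snd z)) *v a (fst z) (snd z))
     + H (fst z) (snd z) \<bullet> (k t (\<alpha> t (snd z)) *v H (fst z) (snd z))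
     + x s (snd z) \<bullet> (chain_rate p s t z *v x s (snd z))"

context
  fixes p :: "real \<Rightarrow> 'd \<Rightarrow> 'd \<Rightarrow> real"
  assumes p: "transition_function \<pi> p"
    and markov: "\<And>s t j Y. 0 \<le> s \<Longrightarrow> 0 \<le> t \<Longrightarrow> Y \<in> borel_measurable (\<F> s) \<Longrightarrow> integrable M Y \<Longrightarrow>
       expectation (\<lambda>\<omega>. Y \<omega> * of_bool (\<alpha> (s + t) \<omega> = j)) = expectation (\<lambda>\<omega>. Y \<omega> * p t (\<alpha> s \<omega>) j)"
begin

lemma measurable_\<theta>_regime:
  assumes "g \<in> measurable (time_space T) (count_space UNIV)"
  shows "(\<lambda>z. \<theta> (fst z) (g z)) \<in> borel_measurable (time_space T)"
  by (rule measurable_compose_countable'[where I=UNIV and f = "\<lambda>i z. \<theta> (fst z) i" and g = g])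
    (auto intro!: measurable_compose[OF measurable_time_fst \<theta>_measurable] assms countable_finite)

lemma measurable_chain_rate:
  assumes "0 \<le> s"
  shows "chain_rate p s t \<in> borel_measurable (time_space T)"
proof -
  have "(\<lambda>z. \<alpha> s (snd z)) \<in> measurable (time_space T) (count_space UNIV)"
    using assms by (intro measurable_compose[OF measurable_time_snd] measurable_chain)
  note * = measurable_\<theta>_regime[OF this] measurable_compose[OF this]
  show ?thesis unfolding chain_rate_def
    by (intro borel_measurable_add borel_measurable_sum borel_measurable_scaleR *) auto
qed

lemma difference_quotient_sum_bound:
  assumes "t \<in> {0..T}"
  shows "norm (\<Sum>j\<in>UNIV. difference_quotient p h i j *\<^sub>R k t j) \<le> (\<Sum>i\<in>UNIV. \<Sum>j\<in>UNIV. \<bar>difference_quotient p h i j\<bar>) * k_bound"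
proof -
  have "norm (\<Sum>j\<in>UNIV. difference_quotient p h i j *\<^sub>R k t j) \<le> (\<Sum>j\<in>UNIV. \<bar>difference_quotient p h i j\<bar> * k_bound)"
    using k_bounded[OF assms] by (intro sum_norm_le) (auto intro: mult_left_mono)
  also have "\<dots> = (\<Sum>j\<in>UNIV. \<bar>difference_quotient p h i j\<bar>) * k_bound" by (simp add: sum_distrib_right)
  also have "\<dots> \<le> (\<Sum>i\<in>UNIV. \<Sum>j\<in>UNIV. \<bar>difference_quotient p h i j\<bar>) * k_bound"
    by (intro mult_right_mono k_bound_nonneg member_le_sum) (auto intro: sum_nonneg)
  finally show ?thesis .
qed

lemma chain_rate_bound:
  assumes "t \<in> {0..T}"
  shows "norm (chain_rate p s t z) \<le> c + (\<Sum>i\<in>UNIV. \<Sum>j\<in>UNIV. \<bar>difference_quotient p (t - s) i j\<bar>) * k_bound"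
  unfolding chain_rate_def using \<theta>_bound difference_quotient_sum_bound[OF assms]
  by (intro norm_triangle_le add_mono)

text \<open>By the Markov property the conditional mean of the change of the weight over a cell is the
  integral of \<open>chain_rate\<close>.\<close>

lemma expectation_weight_change:
  assumes st: "0 \<le> s" "s < t" "t \<le> T"
  shows "expectation (\<lambda>\<omega>. x s \<omega> \<bullet> (k t (\<alpha> t \<omega>) *v x s \<omega>)) - expectation (\<lambda>\<omega>. x s \<omega> \<bullet> (k s (\<alpha> s \<omega>) *v x s \<omega>))
    = (\<integral>z. indicator {s<..t} (fst z) * (x s (snd z) \<bullet> (chain_rate p s t z *v x s (snd z))) \<partial>time_space T)"
    (is "?A - ?B = ?C")
    and "integrable (time_space T) (\<lambda>z. x s (snd z) \<bullet> (chain_rate p s t z *v x s (snd z)))"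
proof -
  have sT: "s \<in> {0..T}" "t \<in> {0..T}" using st by auto
  have sq: "square_integrable M (x s)" by (rule square_integrable_state[OF sT(1)])
  have xF: "x s \<in> borel_measurable (\<F> s)" by (rule x_adapted[OF sT(1)])
  define Y where "Y j \<omega> = x s \<omega> \<bullet> (k t j *v x s \<omega>)" for j \<omega>
  have YF: "Y j \<in> borel_measurable (\<F> s)" for j
    unfolding Y_def using xF by (intro borel_measurable_inner borel_measurable_matrix_vector_mult) auto
  have Yi: "integrable M (Y j)" for j
    unfolding Y_def
    by (intro integrable_inner_square_integrable sq square_integrable_matrix_mult[OF sq, where c = k_bound])
      (auto intro: k_bounded[OF sT(2)])
  define R where "R i = (\<Sum>j\<in>UNIV. p (t - s) i j *\<^sub>R k t j)" for i
  have [measurable]: "Y j \<in> borel_measurable M" for j using Yi by auto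
  have [measurable]: "\<alpha> t \<in> measurable M (count_space UNIV)" "\<alpha> s \<in> measurable M (count_space UNIV)"
    using st by auto
  have "?A = expectation (\<lambda>\<omega>. \<Sum>j\<in>UNIV. Y j \<omega> * of_bool (\<alpha> t \<omega> = j))"
    by (intro Bochner_Integration.integral_cong refl) (simp add: Y_def of_bool_def sum.delta if_distrib cong: if_cong)
  also have "\<dots> = (\<Sum>j\<in>UNIV. expectation (\<lambda>\<omega>. Y j \<omega> * of_bool (\<alpha> t \<omega> = j)))"
  proof (rule Bochner_Integration.integral_sum)
    fix j
    show "integrable M (\<lambda>\<omega>. Y j \<omega> * of_bool (\<alpha> t \<omega> = j))"
      by (rule Bochner_Integration.integrable_bound[OF Yi[of j]]) (auto simp: of_bool_def)
  qed
  also have "\<dots> = (\<Sum>j\<in>UNIV. expectation (\<lambda>\<omega>. Y j \<omega> * p (t - s) (\<alpha> s \<omega>) j))"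
    using markov[OF st(1) _ YF Yi, of "t - s"] st by simp
  also have "\<dots> = expectation (\<lambda>\<omega>. \<Sum>j\<in>UNIV. Y j \<omega> * p (t - s) (\<alpha> s \<omega>) j)"
  proof (rule Bochner_Integration.integral_sum[symmetric])
    fix j
    show "integrable M (\<lambda>\<omega>. Y j \<omega> * p (t - s) (\<alpha> s \<omega>) j)"
    proof (rule Bochner_Integration.integrable_bound)
      show "integrable M (\<lambda>\<omega>. Y j \<omega> * (\<Sum>i\<in>UNIV. \<bar>p (t - s) i j\<bar>))" using Yi by simp
      have "\<bar>p (t - s) i j\<bar> \<le> (\<Sum>i\<in>UNIV. \<bar>p (t - s) i j\<bar>)" for i by (rule member_le_sum) auto
      then show "AE \<omega> in M. norm (Y j \<omega> * p (t - s) (\<alpha> s \<omega>) j) \<le> norm (Y j \<omega> * (\<Sum>i\<in>UNIV. \<bar>p (t - s) i j\<bar>))"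
        by (auto simp: abs_mult sum_nonneg intro!: AE_I2 mult_left_mono)
      show "(\<lambda>\<omega>. Y j \<omega> * p (t - s) (\<alpha> s \<omega>) j) \<in> borel_measurable M"
        by (intro borel_measurable_times measurable_compose[OF _ measurable_count_space]) auto
    qed
  qed
  also have "(\<lambda>\<omega>. \<Sum>j\<in>UNIV. Y j \<omega> * p (t - s) (\<alpha> s \<omega>) j) = (\<lambda>\<omega>. x s \<omega> \<bullet> (R (\<alpha> s \<omega>) *v x s \<omega>))"
  proof
    fix \<omega>
    have "R i *v v = (\<Sum>j\<in>UNIV. p (t - s) i j *\<^sub>R (k t j *v v))" for i v
      unfolding R_def
      using linear_sum[OF bounded_linear.linear[OF bounded_bilinear.bounded_linear_left
            [OF bounded_bilinear_matrix_vector_mult, of v]], of "\<lambda>j. p (t - s) i j *\<^sub>R k t j" UNIV]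
      by (simp add: scaleR_matrix_vector_assoc)
    then show "(\<Sum>j\<in>UNIV. Y j \<omega> * p (t - s) (\<alpha> s \<omega>) j) = x s \<omega> \<bullet> (R (\<alpha> s \<omega>) *v x s \<omega>)"
      by (simp add: Y_def inner_sum_right mult.commute)
  qed
  finally have A: "?A = expectation (\<lambda>\<omega>. x s \<omega> \<bullet> (R (\<alpha> s \<omega>) *v x s \<omega>))" .
  have Psi_int: "set_integrable lborel {s<..t} (\<lambda>r. chain_rate p s t (r, \<omega>))"
    and Psi: "(LINT r:{s<..t}|lborel. chain_rate p s t (r, \<omega>)) = R (\<alpha> s \<omega>) - k s (\<alpha> s \<omega>)" for \<omega>
  proof -
    define i where "i = \<alpha> s \<omega>"
    define q where "q = (\<Sum>j\<in>UNIV. difference_quotient p (t - s) i j *\<^sub>R k t j)"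
    have 1: "set_integrable lborel {s<..t} (\<lambda>r. \<theta> r i)" using st by (intro set_integrable_\<theta>) auto
    have 2: "set_integrable lborel {s<..t} (\<lambda>r. q)"
      unfolding set_integrable_def
      using st by (intro integrable_scaleR_left integrable_real_indicator) auto
    have cr: "chain_rate p s t (r, \<omega>) = \<theta> r i + q" for r by (simp add: chain_rate_def i_def q_def)
    show "set_integrable lborel {s<..t} (\<lambda>r. chain_rate p s t (r, \<omega>))"
      unfolding cr using 1 2 by (rule set_integral_add)
    have "(LINT r:{s<..t}|lborel. chain_rate p s t (r, \<omega>)) = (k t i - k s i) + (t - s) *\<^sub>R q"
      unfolding cr using 1 2 k_increment[of s t i] st
      by (simp add: set_integral_add) (simp add: set_lebesgue_integral_def)
    also have "(t - s) *\<^sub>R q = (\<Sum>j\<in>UNIV. p (t - s) i j *\<^sub>R k t j - (if i = j then k t j else 0))"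
      unfolding q_def scaleR_sum_right using st
      by (intro sum.cong) (auto simp: difference_quotient_def scaleR_diff_left)
    also have "\<dots> = R i - k t i" by (simp add: sum_subtractf R_def)
    finally show "(LINT r:{s<..t}|lborel. chain_rate p s t (r, \<omega>)) = R (\<alpha> s \<omega>) - k s (\<alpha> s \<omega>)"
      by (simp add: i_def)
  qed
  have sq': "square_integrable (time_space T) (\<lambda>z. x s (snd z))"
    by (rule square_integrable_time_component[OF sq])
  show int: "integrable (time_space T) (\<lambda>z. x s (snd z) \<bullet> (chain_rate p s t z *v x s (snd z)))"
    using chain_rate_bound[of t s] st
    by (intro integrable_inner_square_integrable sq' measurable_chain_rate AE_I2
        square_integrable_matrix_mult[OF sq',
          where c = "c + (\<Sum>i\<in>UNIV. \<Sum>j\<in>UNIV. \<bar>difference_quotient p (t - s) i j\<bar>) * k_bound"]) auto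
  have "?C = expectation (\<lambda>\<omega>. LINT r:{0..T}|lborel. indicator {s<..t} r * (x s \<omega> \<bullet> (chain_rate p s t (r, \<omega>) *v x s \<omega>)))"
    using integral_time_space(2)[of T "\<lambda>r \<omega>. indicator {s<..t} r * (x s \<omega> \<bullet> (chain_rate p s t (r, \<omega>) *v x s \<omega>))"]
      integrable_cell[OF int, of s t] by simp
  also have "(\<lambda>\<omega>. LINT r:{0..T}|lborel. indicator {s<..t} r * (x s \<omega> \<bullet> (chain_rate p s t (r, \<omega>) *v x s \<omega>)))
     = (\<lambda>\<omega>. x s \<omega> \<bullet> ((R (\<alpha> s \<omega>) - k s (\<alpha> s \<omega>)) *v x s \<omega>))"
  proof
    fix \<omega>
    have bl: "bounded_linear (\<lambda>P. x s \<omega> \<bullet> (P *v x s \<omega>))"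
      by (rule bounded_linear_compose[OF bounded_linear_inner_right
          bounded_bilinear.bounded_linear_left[OF bounded_bilinear_matrix_vector_mult]])
    have "(LINT r:{0..T}|lborel. indicator {s<..t} r * (x s \<omega> \<bullet> (chain_rate p s t (r, \<omega>) *v x s \<omega>)))
      = (LINT r:{s<..t}|lborel. x s \<omega> \<bullet> (chain_rate p s t (r, \<omega>) *v x s \<omega>))"
      using set_integral_cell[of s t T "\<lambda>r. x s \<omega> \<bullet> (chain_rate p s t (r, \<omega>) *v x s \<omega>)"] st by simp
    also have "\<dots> = (LINT r|lborel. x s \<omega> \<bullet> ((indicator {s<..t} r *\<^sub>R chain_rate p s t (r, \<omega>)) *v x s \<omega>))"
      by (simp add: set_lebesgue_integral_def scaleR_matrix_vector_assoc[symmetric])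
    also have "\<dots> = x s \<omega> \<bullet> ((LINT r:{s<..t}|lborel. chain_rate p s t (r, \<omega>)) *v x s \<omega>)"
      unfolding set_lebesgue_integral_def
      using integral_bounded_linear[OF bl] Psi_int[of \<omega>] by (simp add: set_integrable_def)
    finally show "(LINT r:{0..T}|lborel. indicator {s<..t} r * (x s \<omega> \<bullet> (chain_rate p s t (r, \<omega>) *v x s \<omega>)))
      = x s \<omega> \<bullet> ((R (\<alpha> s \<omega>) - k s (\<alpha> s \<omega>)) *v x s \<omega>)"
      unfolding Psi .
  qed
  also have "expectation (\<lambda>\<omega>. x s \<omega> \<bullet> ((R (\<alpha> s \<omega>) - k s (\<alpha> s \<omega>)) *v x s \<omega>)) = ?A - ?B"
  proof -
    have form: "integrable M (\<lambda>\<omega>. x s \<omega> \<bullet> (F (\<alpha> s \<omega>) *v x s \<omega>))" for F :: "'d \<Rightarrow> real ^ 'n ^ 'n"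
    proof -
      have "norm (F i) \<le> (\<Sum>i\<in>UNIV. norm (F i))" for i by (rule member_le_sum) auto
      then show ?thesis
        by (intro integrable_inner_square_integrable sq
            square_integrable_matrix_mult[OF sq, where c = "\<Sum>i\<in>UNIV. norm (F i)"]) auto
    qed
    show ?thesis unfolding A using form[of R] form[of "k s"]
      by (simp add: matrix_vector_mult_diff_rdistrib inner_diff_right)
  qed
  finally show "?A - ?B = ?C" by simp
qed

text \<open>The exact change of \<open>\<lambda>t. E (x t \<bullet> k t (\<alpha> t) x t)\<close> over a cell.  The two expectations in
  which the martingale increment meets \<open>x s\<close> vanish although the weight looks at the chain at
  the later time \<open>t\<close>, since the enlarged filtration knows the whole chain.\<close>

lemma one_step:
  assumes st: "0 \<le> s" "s < t" "t \<le> T"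
  shows "expectation (\<lambda>\<omega>. x t \<omega> \<bullet> (k t (\<alpha> t \<omega>) *v x t \<omega>)) - expectation (\<lambda>\<omega>. x s \<omega> \<bullet> (k s (\<alpha> s \<omega>) *v x s \<omega>))
    = (\<integral>z. indicator {s<..t} (fst z) * cell_rate p s t z \<partial>time_space T)"
proof -
  have sT: "s \<in> {0..T}" "t \<in> {0..T}" "s \<le> t" using st by auto
  define K where "K \<omega> = k t (\<alpha> t \<omega>)" for \<omega>
  define J where "J \<omega> = I t \<omega> - I s \<omega>" for \<omega>
  define D where "D = drift a s t"
  have KG: "K \<in> borel_measurable (enlarged s)"
    unfolding K_def using st by (intro measurable_weight_chain) auto
  have KM: "K \<in> borel_measurable M" by (rule measurable_enlargedD[OF KG])
  have Kb: "norm (K \<omega>) \<le> k_bound" for \<omega> unfolding K_def by (rule k_bounded[OF sT(2)])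
  have xs: "square_integrable M (x s)" and xt: "square_integrable M (x t)"
    using square_integrable_state sT by auto
  have Jsq: "square_integrable M J"
    unfolding J_def using sT by (intro square_integrable_diff square_integrable_ito[OF less_imp_le[OF T] ito])
  have Dsq: "square_integrable M D" unfolding D_def using st by (intro drift_cell) auto
  have Ksq: "square_integrable M (\<lambda>\<omega>. K \<omega> *v f \<omega>)" if "square_integrable M f" for f
    by (rule square_integrable_matrix_mult[OF that KM AE_I2[OF Kb]])
  have Ktsq: "square_integrable M (\<lambda>\<omega>. transpose (K \<omega>) *v f \<omega>)" if "square_integrable M f" for f
    using Kb by (intro square_integrable_matrix_mult[OF that borel_measurable_transpose[OF KM], of k_bound] AE_I2)
      (simp add: norm_transpose)
  have int: "integrable M (\<lambda>\<omega>. f \<omega> \<bullet> (K \<omega> *v g \<omega>))" if "square_integrable M f" "square_integrable M g" for f g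
    by (intro integrable_inner_square_integrable Ksq that)
  have xsG: "x s \<in> borel_measurable (enlarged s)"
    using x_adapted[OF sT(1)] by (rule measurable_filtr_enlarged) simp
  \<comment> \<open>Expanding the first factor of \<open>x t \<bullet> K x t\<close> completely but keeping \<open>x t\<close> next to \<open>D\<close> leaves no
    quadratic term in \<open>D\<close>: every term is exactly an integral over the cell.\<close>
  have dyn: "AE \<omega> in M. x t \<omega> = x s \<omega> + D \<omega> + J \<omega>"
    using state_increment[OF st(1) sT(3) st(3)] by eventually_elim (simp add: D_def J_def algebra_simps)
  have tr: "u \<bullet> (P *v v) = (transpose P *v u) \<bullet> v" for u v :: "real ^ 'n" and P
    by (simp add: dot_lmul_matrix[symmetric] vector_transpose_matrix transpose_transpose)
  have 0: "expectation (\<lambda>\<omega>. x s \<omega> \<bullet> (K \<omega> *v J \<omega>)) = 0" "expectation (\<lambda>\<omega>. J \<omega> \<bullet> (K \<omega> *v x s \<omega>)) = 0"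
  proof -
    have "expectation (\<lambda>\<omega>. (transpose (K \<omega>) *v x s \<omega>) \<bullet> (I t \<omega> - I s \<omega>)) = 0"
      using st by (intro ito_increment_orthogonal[OF less_imp_le[OF T] ito] Ktsq xs
          borel_measurable_matrix_vector_mult borel_measurable_transpose KG xsG) auto
    then show "expectation (\<lambda>\<omega>. x s \<omega> \<bullet> (K \<omega> *v J \<omega>)) = 0" by (simp add: tr J_def)
    have "expectation (\<lambda>\<omega>. (K \<omega> *v x s \<omega>) \<bullet> (I t \<omega> - I s \<omega>)) = 0"
      using st by (intro ito_increment_orthogonal[OF less_imp_le[OF T] ito] Ksq xs
          borel_measurable_matrix_vector_mult KG xsG) auto
    then show "expectation (\<lambda>\<omega>. J \<omega> \<bullet> (K \<omega> *v x s \<omega>)) = 0" by (simp add: J_def inner_commute)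
  qed
  have "expectation (\<lambda>\<omega>. x t \<omega> \<bullet> (K \<omega> *v x t \<omega>))
     = expectation (\<lambda>\<omega>. x s \<omega> \<bullet> (K \<omega> *v x s \<omega>) + x s \<omega> \<bullet> (K \<omega> *v D \<omega>) + x s \<omega> \<bullet> (K \<omega> *v J \<omega>)
        + D \<omega> \<bullet> (K \<omega> *v x t \<omega>) + J \<omega> \<bullet> (K \<omega> *v x s \<omega>) + J \<omega> \<bullet> (K \<omega> *v D \<omega>) + J \<omega> \<bullet> (K \<omega> *v J \<omega>))"
    (is "_ = expectation ?rhs")
  proof (rule integral_cong_AE)
    show "AE \<omega> in M. x t \<omega> \<bullet> (K \<omega> *v x t \<omega>) = ?rhs \<omega>"
      using dyn
    proof eventually_elim
      case (elim \<omega>)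
      have "x t \<omega> \<bullet> (K \<omega> *v x t \<omega>) = (x s \<omega> + J \<omega>) \<bullet> (K \<omega> *v x t \<omega>) + D \<omega> \<bullet> (K \<omega> *v x t \<omega>)"
        by (subst (1) elim) (simp add: inner_simps)
      also have "(x s \<omega> + J \<omega>) \<bullet> (K \<omega> *v x t \<omega>) = (x s \<omega> + J \<omega>) \<bullet> (K \<omega> *v (x s \<omega> + D \<omega> + J \<omega>))"
        unfolding elim ..
      finally show ?case by (simp add: inner_simps matrix_vector_right_distrib)
    qed
    show "(\<lambda>\<omega>. x t \<omega> \<bullet> (K \<omega> *v x t \<omega>)) \<in> borel_measurable M"
      by (rule borel_measurable_integrable[OF int[OF xt xt]])
    show "?rhs \<in> borel_measurable M"
      by (intro borel_measurable_integrable Bochner_Integration.integrable_add int xs xt Dsq Jsq)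
  qed
  also have "\<dots> = expectation (\<lambda>\<omega>. x s \<omega> \<bullet> (K \<omega> *v x s \<omega>)) + expectation (\<lambda>\<omega>. x s \<omega> \<bullet> (K \<omega> *v D \<omega>))
     + expectation (\<lambda>\<omega>. D \<omega> \<bullet> (K \<omega> *v x t \<omega>)) + expectation (\<lambda>\<omega>. J \<omega> \<bullet> (K \<omega> *v D \<omega>))
     + expectation (\<lambda>\<omega>. J \<omega> \<bullet> (K \<omega> *v J \<omega>))"
    using int[OF xs xs] int[OF xs Dsq] int[OF xs Jsq] int[OF Dsq xt] int[OF Jsq xs] int[OF Jsq Dsq] int[OF Jsq Jsq] 0
    by simp
  finally have split: "expectation (\<lambda>\<omega>. x t \<omega> \<bullet> (K \<omega> *v x t \<omega>)) = \<dots>" .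
  let ?i = "\<lambda>z. indicator {s<..t} (fst z) :: real"
  let ?a = "\<lambda>z. a (fst z) (snd z)" and ?H = "\<lambda>z. H (fst z) (snd z)"
  have drift_term: "expectation (\<lambda>\<omega>. f \<omega> \<bullet> (K \<omega> *v D \<omega>)) = (\<integral>z. ?i z * (f (snd z) \<bullet> (K (snd z) *v ?a z)) \<partial>time_space T)"
    if "square_integrable M f" for f
    using drift_cell(3)[OF st(1) sT(3) st(3) Ktsq[OF that]] unfolding D_def tr .
  have drift_term': "expectation (\<lambda>\<omega>. D \<omega> \<bullet> (K \<omega> *v f \<omega>)) = (\<integral>z. ?i z * (?a z \<bullet> (K (snd z) *v f (snd z))) \<partial>time_space T)"
    if "square_integrable M f" for f
    using drift_cell(3)[OF st(1) sT(3) st(3) Ksq[OF that]] unfolding D_def by (simp add: inner_commute)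
  have iso: "expectation (\<lambda>\<omega>. J \<omega> \<bullet> (K \<omega> *v J \<omega>)) = (\<integral>z. ?i z * (?H z \<bullet> (K (snd z) *v ?H z)) \<partial>time_space T)"
    using ito_increment_isometry[OF less_imp_le[OF T] ito st(1) sT(3) st(3) KG Kb]
    by (simp add: J_def scaleR_matrix_vector_assoc[symmetric])
  have KT: "(\<lambda>z. K (snd z)) \<in> borel_measurable (time_space T)" by (rule measurable_time_component[OF KM])
  have intT: "integrable (time_space T) (\<lambda>z. ?i z * (f z \<bullet> (K (snd z) *v g z)))"
    if "square_integrable (time_space T) f" "square_integrable (time_space T) g" for f g
    by (intro integrable_cell integrable_inner_square_integrable that
        square_integrable_matrix_mult[OF that(2) KT AE_I2[OF Kb]])
  note l = square_integrable_time_component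
  have "(\<integral>z. ?i z * cell_rate p s t z \<partial>time_space T)
     = (\<integral>z. ?i z * (x s (snd z) \<bullet> (K (snd z) *v ?a z)) + ?i z * (?a z \<bullet> (K (snd z) *v x t (snd z)))
        + ?i z * (J (snd z) \<bullet> (K (snd z) *v ?a z)) + ?i z * (?H z \<bullet> (K (snd z) *v ?H z))
        + ?i z * (x s (snd z) \<bullet> (chain_rate p s t z *v x s (snd z))) \<partial>time_space T)"
    unfolding cell_rate_def K_def J_def by (simp only: distrib_left)
  also have "\<dots> = (\<integral>z. ?i z * (x s (snd z) \<bullet> (K (snd z) *v ?a z)) \<partial>time_space T)
      + (\<integral>z. ?i z * (?a z \<bullet> (K (snd z) *v x t (snd z))) \<partial>time_space T)
      + (\<integral>z. ?i z * (J (snd z) \<bullet> (K (snd z) *v ?a z)) \<partial>time_space T)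
      + (\<integral>z. ?i z * (?H z \<bullet> (K (snd z) *v ?H z)) \<partial>time_space T)
      + (\<integral>z. ?i z * (x s (snd z) \<bullet> (chain_rate p s t z *v x s (snd z))) \<partial>time_space T)"
    using intT[OF l[OF xs] a] intT[OF a l[OF xt]] intT[OF l[OF Jsq] a] intT[OF H_sq H_sq]
      integrable_cell[OF expectation_weight_change(2)[OF st], of s t]
    by simp
  also have "\<dots> = expectation (\<lambda>\<omega>. x t \<omega> \<bullet> (K \<omega> *v x t \<omega>)) - expectation (\<lambda>\<omega>. x s \<omega> \<bullet> (k s (\<alpha> s \<omega>) *v x s \<omega>))"
    unfolding split drift_term[OF xs] drift_term'[OF xt] drift_term[OF Jsq] iso
      expectation_weight_change(1)[OF st, symmetric] by (simp add: K_def)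
  finally show ?thesis by (simp add: K_def)
qed

end

end

section \<open>Refining the partition\<close>

context weighted_ito_process
begin

definition mesh :: "nat \<Rightarrow> real" where "mesh n = T / real n"

text \<open>The minimum with \<open>n\<close> keeps all end points of cells inside \<open>[0,T]\<close> whatever the argument, so that
  step processes are measurable without restriction on the time.\<close>

definition cell_index :: "nat \<Rightarrow> real \<Rightarrow> nat" where
  "cell_index n r = min n (nat \<lceil>r / mesh n\<rceil>)"

text \<open>The end points of the cell \<open>(mesh n * k, mesh n * (k + 1)]\<close> that contains \<open>r\<close>; both are \<open>0\<close> for
  \<open>r = 0\<close>.\<close>

definition lower :: "nat \<Rightarrow> real \<Rightarrow> real" where "lower n r = mesh n * real (cell_index n r - 1)"

definition upper :: "nat \<Rightarrow> real \<Rightarrow> real" where "upper n r = mesh n * real (cell_index n r)"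

lemma mesh_pos: "n > 0 \<Longrightarrow> mesh n > 0"
  using T by (simp add: mesh_def)

lemma mesh_mult: "n > 0 \<Longrightarrow> mesh n * real n = T"
  by (simp add: mesh_def)

lemma cell_index_eq:
  assumes "n > 0" "j < n" "mesh n * real j < r" "r \<le> mesh n * real (Suc j)"
  shows "cell_index n r = Suc j"
proof -
  note h = mesh_pos[OF assms(1)]
  have "real j < r / mesh n" "r / mesh n \<le> real (Suc j)"
    using assms h by (simp_all add: field_simps)
  then have "\<lceil>r / mesh n\<rceil> = int (Suc j)" by (intro ceiling_unique) auto
  then show ?thesis using assms by (simp add: cell_index_def)
qed

lemma cell_exists:
  assumes n: "n > 0" and r: "0 < r" "r \<le> T"
  obtains j where "j < n" "mesh n * real j < r" "r \<le> mesh n * real (Suc j)"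
proof -
  note h = mesh_pos[OF n]
  define j where "j = nat (\<lceil>r / mesh n\<rceil> - 1)"
  have pos: "0 < r / mesh n" using r h by simp
  then have c: "\<lceil>r / mesh n\<rceil> \<ge> 1" by linarith
  have j: "real j = real_of_int \<lceil>r / mesh n\<rceil> - 1" using c by (simp add: j_def)
  have "r / mesh n \<le> real n" using r h mesh_mult[OF n] by (simp add: divide_le_eq mult.commute)
  then have "\<lceil>r / mesh n\<rceil> \<le> int n" by (simp add: ceiling_le_iff)
  moreover have "int j = \<lceil>r / mesh n\<rceil> - 1" unfolding j_def using c by simp
  ultimately have "j < n" by linarith
  moreover have "real j < r / mesh n" unfolding j by linarith
  then have "mesh n * real j < r" using h by (simp add: less_divide_eq mult.commute)
  moreover have "r / mesh n \<le> real (Suc j)" using j by simp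
  then have "r \<le> mesh n * real (Suc j)" using h by (simp add: divide_le_eq mult.commute)
  ultimately show thesis by (rule that)
qed

lemma cell_bounds:
  assumes n: "n > 0" and r: "r \<in> {0..T}"
  shows "0 \<le> lower n r" "lower n r \<le> r" "r \<le> upper n r" "upper n r \<le> T"
    "upper n r - lower n r \<le> mesh n" "0 < r \<Longrightarrow> lower n r < r"
    "0 < r \<Longrightarrow> upper n r - lower n r = mesh n"
proof -
  note h = mesh_pos[OF n]
  have "0 \<le> lower n r \<and> lower n r \<le> r \<and> r \<le> upper n r \<and> upper n r \<le> T \<and> upper n r - lower n r \<le> mesh n
    \<and> (0 < r \<longrightarrow> lower n r < r \<and> upper n r - lower n r = mesh n)"
  proof (cases "r = 0")
    case True
    then have "cell_index n r = 0" by (simp add: cell_index_def)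
    then show ?thesis using True h T by (simp add: lower_def upper_def)
  next
    case False
    then obtain j where j: "j < n" "mesh n * real j < r" "r \<le> mesh n * real (Suc j)"
      using cell_exists[OF n, of r] r by auto
    note i = cell_index_eq[OF n j]
    have "mesh n * real (Suc j) \<le> mesh n * real n" using j h by (intro mult_left_mono) auto
    then show ?thesis using i j h mesh_mult[OF n] by (simp add: lower_def upper_def algebra_simps)
  qed
  then show "0 \<le> lower n r" "lower n r \<le> r" "r \<le> upper n r" "upper n r \<le> T"
    "upper n r - lower n r \<le> mesh n" "0 < r \<Longrightarrow> lower n r < r"
    "0 < r \<Longrightarrow> upper n r - lower n r = mesh n" by auto
qed

lemma cell_ends:
  assumes "n > 0" "r \<in> {0..T}"
  shows "lower n r \<in> {0..T}" "upper n r \<in> {0..T}"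
  using cell_bounds[OF assms] assms by auto

lemma index_times:
  assumes "n > 0" "m \<le> n"
  shows "mesh n * real m \<in> {0..T}"
proof -
  have "mesh n * real m \<le> mesh n * real n" using assms mesh_pos[of n] by (intro mult_left_mono) auto
  then show ?thesis using mesh_pos[OF assms(1)] mesh_mult[OF assms(1)] by simp
qed

lemma measurable_step:
  assumes "\<And>m. m \<le> n \<Longrightarrow> f m \<in> measurable M N"
  shows "(\<lambda>z. f (cell_index n (fst z)) (snd z)) \<in> measurable (time_space T) N"
proof (rule measurable_compose_countable'[where I="{..n}" and f = "\<lambda>m z. f m (snd z)" and g = "\<lambda>z. cell_index n (fst z)"])
  show "(\<lambda>z. f m (snd z)) \<in> measurable (time_space T) N" if "m \<in> {..n}" for m
    using assms that by (intro measurable_compose[OF measurable_time_snd]) auto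
  have "(\<lambda>r. cell_index n r) \<in> measurable borel (count_space UNIV)"
    unfolding cell_index_def by measurable
  then have "(\<lambda>z. cell_index n (fst z)) \<in> measurable (time_space T) (count_space UNIV)"
    by (rule measurable_compose[OF measurable_time_fst])
  then show "(\<lambda>z. cell_index n (fst z)) \<in> measurable (time_space T) (count_space {..n})"
    using measurable_sets[of "\<lambda>z. cell_index n (fst z)" "time_space T" "count_space UNIV" "{m}" for m]
    by (subst measurable_count_space_eq2) (simp_all add: Pi_iff, simp add: cell_index_def)
qed auto

lemma measurable_upper:
  assumes "n > 0" "\<And>t. t \<in> {0..T} \<Longrightarrow> f t \<in> measurable M N"
  shows "(\<lambda>z. f (upper n (fst z)) (snd z)) \<in> measurable (time_space T) N"
  unfolding upper_def using assms index_times
  by (intro measurable_step[where f = "\<lambda>m. f (mesh n * real m)"]) auto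

lemma measurable_lower:
  assumes "n > 0" "\<And>t. t \<in> {0..T} \<Longrightarrow> f t \<in> measurable M N"
  shows "(\<lambda>z. f (lower n (fst z)) (snd z)) \<in> measurable (time_space T) N"
  unfolding lower_def using assms index_times[OF assms(1), of "m - 1" for m]
  by (intro measurable_step[where f = "\<lambda>m. f (mesh n * real (m - 1))"]) auto

lemma AE_time_pos: "AE z in time_space T. 0 < fst z"
proof -
  have "AE z in time_space T. fst z \<noteq> 0"
    by (rule AE_time_space_deterministic) (use AE_lborel_singleton[of "0::real"] in \<open>auto elim: eventually_mono\<close>)
  with AE_space show ?thesis by eventually_elim auto
qed

lemma sum_cell_indicators:
  assumes "n > 0"
  shows "(\<Sum>j<m. indicator {mesh n * real j<..mesh n * real (Suc j)} r) = (indicator {0<..mesh n * real m} r :: real)"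
proof (induction m)
  case (Suc m)
  have "mesh n * real m \<le> mesh n * real (Suc m)" "0 \<le> mesh n * real m" using mesh_pos[OF assms] by auto
  then show ?case using Suc by (auto simp: indicator_def)
qed simp

lemma integral_sum_cells:
  fixes G :: "real \<times> 'w \<Rightarrow> real"
  assumes n: "n > 0" and G: "integrable (time_space T) G"
  shows "(\<Sum>j<n. \<integral>z. indicator {mesh n * real j<..mesh n * real (Suc j)} (fst z) * G z \<partial>time_space T)
    = (\<integral>z. G z \<partial>time_space T)"
proof -
  have "(\<Sum>j<n. \<integral>z. indicator {mesh n * real j<..mesh n * real (Suc j)} (fst z) * G z \<partial>time_space T)
    = (\<integral>z. (\<Sum>j<n. indicator {mesh n * real j<..mesh n * real (Suc j)} (fst z) * G z) \<partial>time_space T)"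
    by (intro Bochner_Integration.integral_sum[symmetric] integrable_cell G)
  also have "\<dots> = (\<integral>z. indicator {0<..T} (fst z) * G z \<partial>time_space T)"
    unfolding sum_distrib_right[symmetric] sum_cell_indicators[OF n] mesh_mult[OF n] ..
  also have "\<dots> = (\<integral>z. G z \<partial>time_space T)"
  proof (rule integral_cong_AE)
    show "AE z in time_space T. indicator {0<..T} (fst z) * G z = G z"
      using AE_time_pos AE_space by eventually_elim auto
  qed (use G integrable_cell[OF G, of 0 T] in auto)
  finally show ?thesis .
qed

lemma cell_energy_nonneg: "0 \<le> cell_energy T f s t"
  unfolding cell_energy_def by (intro integral_nonneg_AE) auto

lemma cell_energy_mono:
  assumes f: "square_integrable (time_space T) (\<lambda>z. f (fst z) (snd z))" and "s' \<le> s" "t \<le> t'"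
  shows "cell_energy T f s t \<le> cell_energy T f s' t'"
  unfolding cell_energy_def using assms
  by (intro integral_mono integrable_cell square_integrableD(2)[OF f]) (auto simp: indicator_def)

definition total_drift :: "real" where
  "total_drift = (\<integral>z. (norm (a (fst z) (snd z)))\<^sup>2 \<partial>time_space T)"

definition total_noise :: "real" where
  "total_noise = (\<integral>z. (norm (H (fst z) (snd z)))\<^sup>2 \<partial>time_space T)"

definition cell_bound :: "nat \<Rightarrow> real \<Rightarrow> real" where
  "cell_bound n r = 2 * (mesh n * cell_energy T a (lower n r) (upper n r) + cell_energy T H (lower n r) (upper n r))"

text \<open>If the mean square of \<open>f\<close> at each time is at most the energy of the cell around it,
  integration over time gains one factor \<open>mesh n\<close>.\<close>

lemma step_energy:
  assumes n: "n > 0" and f: "f \<in> borel_measurable (time_space T)"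
    and bound: "\<And>r. r \<in> {0<..T} \<Longrightarrow> (\<integral>\<^sup>+\<omega>. ennreal ((norm (f (r, \<omega>)))\<^sup>2) \<partial>M) \<le> ennreal (cell_bound n r)"
  shows "(\<integral>\<^sup>+z. ennreal ((norm (f z))\<^sup>2) \<partial>time_space T) \<le> ennreal (2 * mesh n * (mesh n * total_drift + total_noise))"
proof -
  let ?L = "restrict_space lborel {0..T}"
  note h = mesh_pos[OF n]
  interpret L: finite_measure ?L by (rule finite_measure_interval)
  define e where "e j = 2 * (mesh n * cell_energy T a (mesh n * real j) (mesh n * real (Suc j))
     + cell_energy T H (mesh n * real j) (mesh n * real (Suc j)))" for j
  define cell where "cell j = {mesh n * real j<..mesh n * real (Suc j)}" for j
  have e0: "0 \<le> e j" for j using h by (simp add: e_def cell_energy_nonneg)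
  have fm: "(\<lambda>z. ennreal ((norm (f z))\<^sup>2)) \<in> borel_measurable (?L \<Otimes>\<^sub>M M)"
    using f by (simp add: time_space_def)
  have cm: "(\<lambda>r. indicator (cell j) r * e j) \<in> borel_measurable ?L" for j
    by (rule measurable_restrict_space1) (simp add: cell_def)
  have "(\<integral>\<^sup>+z. ennreal ((norm (f z))\<^sup>2) \<partial>time_space T) = (\<integral>\<^sup>+r. (\<integral>\<^sup>+\<omega>. ennreal ((norm (f (r, \<omega>)))\<^sup>2) \<partial>M) \<partial>?L)"
    unfolding time_space_def by (rule nn_integral_fst[OF fm, symmetric])
  also have "\<dots> \<le> (\<integral>\<^sup>+r. ennreal (\<Sum>j<n. indicator (cell j) r * e j) \<partial>?L)"
  proof (rule nn_integral_mono_AE)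
    have "AE r in lborel. r \<in> {0..T} \<longrightarrow> r \<noteq> 0"
      using AE_lborel_singleton[of "0::real"] by eventually_elim simp
    then have "AE r in ?L. r \<noteq> 0" by (simp add: AE_restrict_space_iff)
    with AE_space show "AE r in ?L. (\<integral>\<^sup>+\<omega>. ennreal ((norm (f (r, \<omega>)))\<^sup>2) \<partial>M) \<le> ennreal (\<Sum>j<n. indicator (cell j) r * e j)"
    proof eventually_elim
      case (elim r)
      then have r: "0 < r" "r \<le> T" by (auto simp: space_restrict_space)
      obtain j where j: "j < n" "mesh n * real j < r" "r \<le> mesh n * real (Suc j)" by (rule cell_exists[OF n r])
      have "cell_bound n r = e j"
        using cell_index_eq[OF n j] by (simp add: cell_bound_def e_def lower_def upper_def)
      also have "e j = indicator (cell j) r * e j" using j by (simp add: cell_def)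
      also have "\<dots> \<le> (\<Sum>j<n. indicator (cell j) r * e j)"
        using j e0 by (intro member_le_sum) auto
      finally show ?case using bound[of r] r by (auto intro: order_trans ennreal_leI)
    qed
  qed
  also have "\<dots> = ennreal (\<integral>r. (\<Sum>j<n. indicator (cell j) r * e j) \<partial>?L)"
  proof (rule nn_integral_eq_integral)
    show "integrable ?L (\<lambda>r. \<Sum>j<n. indicator (cell j) r * e j)"
      using cm by (intro Bochner_Integration.integrable_sum L.integrable_const_bound[where B = "e j" for j])
        (auto simp: e0 indicator_def)
    show "AE r in ?L. 0 \<le> (\<Sum>j<n. indicator (cell j) r * e j)" using e0 by (auto intro!: sum_nonneg)
  qed
  also have "(\<integral>r. (\<Sum>j<n. indicator (cell j) r * e j) \<partial>?L) = (\<Sum>j<n. mesh n * e j)"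
  proof -
    have "(\<integral>r. (\<Sum>j<n. indicator (cell j) r * e j) \<partial>?L) = (\<Sum>j<n. \<integral>r. indicator (cell j) r * e j \<partial>?L)"
      using cm by (intro Bochner_Integration.integral_sum L.integrable_const_bound[where B = "e j" for j])
        (auto simp: e0 indicator_def)
    also have "\<dots> = (\<Sum>j<n. mesh n * e j)"
    proof (intro sum.cong refl)
      fix j assume "j \<in> {..<n}"
      then have sub: "cell j \<subseteq> {0..T}"
        using index_times[OF n, of j] index_times[OF n, of "Suc j"] by (auto simp: cell_def)
      have "(\<integral>r. indicator (cell j) r * e j \<partial>?L) = (\<integral>r. indicator {0..T} r * (indicator (cell j) r * e j) \<partial>lborel)"
        by (subst integral_restrict_space) auto
      also have "\<dots> = (\<integral>r. indicator (cell j) r * e j \<partial>lborel)"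
        using sub by (intro Bochner_Integration.integral_cong) (auto simp: indicator_def)
      also have "\<dots> = mesh n * e j" using h by (simp add: cell_def algebra_simps)
      finally show "(\<integral>r. indicator (cell j) r * e j \<partial>?L) = mesh n * e j" .
    qed
    finally show ?thesis .
  qed
  also have "(\<Sum>j<n. mesh n * e j) = 2 * mesh n * (mesh n * (\<Sum>j<n. cell_energy T a (mesh n * real j) (mesh n * real (Suc j)))
     + (\<Sum>j<n. cell_energy T H (mesh n * real j) (mesh n * real (Suc j))))"
    unfolding e_def by (simp add: sum_distrib_left sum.distrib algebra_simps)
  also have "\<dots> = 2 * mesh n * (mesh n * total_drift + total_noise)"
    unfolding cell_energy_def total_drift_def total_noise_def
    using integral_sum_cells[OF n square_integrableD(2)[OF a]] integral_sum_cells[OF n square_integrableD(2)[OF H_sq]]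
    by simp
  finally show ?thesis .
qed

lemma mesh_tendsto: "(\<lambda>n. mesh (Suc n)) \<longlonglongrightarrow> 0"
  unfolding mesh_def
  using tendsto_mult[OF tendsto_const LIMSEQ_inverse_real_of_nat, of T] by (simp add: divide_inverse)

lemma L2_tendsto_step:
  fixes y :: "nat \<Rightarrow> real \<times> 'w \<Rightarrow> real ^ 'n"
  assumes g: "square_integrable (time_space T) g"
    and y: "\<And>n. y n \<in> borel_measurable (time_space T)"
    and bound: "\<And>n r. r \<in> {0<..T} \<Longrightarrow>
      (\<integral>\<^sup>+\<omega>. ennreal ((norm (g (r, \<omega>) - y n (r, \<omega>)))\<^sup>2) \<partial>M) \<le> ennreal (cell_bound (Suc n) r)"
  shows "L2_tendsto (time_space T) y g"
proof (rule L2_tendsto_nnI)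
  let ?e = "\<lambda>n. 2 * mesh (Suc n) * (mesh (Suc n) * total_drift + total_noise)"
  have gm: "g \<in> borel_measurable (time_space T)" using g by auto
  show "g \<in> borel_measurable (time_space T)" by fact
  have d: "(\<lambda>z. g z - y n z) \<in> borel_measurable (time_space T)" for n
    using gm y by (intro borel_measurable_diff)
  have le: "(\<integral>\<^sup>+z. ennreal ((norm (g z - y n z))\<^sup>2) \<partial>time_space T) \<le> ennreal (?e n)" for n
    by (rule step_energy[OF _ d bound]) auto
  show "square_integrable (time_space T) (y n)" for n
  proof -
    have "square_integrable (time_space T) (\<lambda>z. g z - y n z)"
      unfolding square_integrable_iff_nn[OF d] infinity_ennreal_def
      by (rule le_less_trans[OF le[of n] ennreal_less_top])
    from square_integrable_diff[OF g this] show ?thesis by simp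
  qed
  have "?e \<longlonglongrightarrow> 2 * 0 * (0 * total_drift + total_noise)"
    by (intro tendsto_intros mesh_tendsto)
  then have e: "(\<lambda>n. ennreal (?e n)) \<longlonglongrightarrow> ennreal 0" by (intro tendsto_ennrealI) simp
  show "(\<lambda>n. \<integral>\<^sup>+z. ennreal ((norm (g z - y n z))\<^sup>2) \<partial>time_space T) \<longlonglongrightarrow> 0"
  proof (rule tendsto_sandwich[where f = "\<lambda>_. 0" and h = "\<lambda>n. ennreal (?e n)"])
    show "\<forall>\<^sub>F n in sequentially. 0 \<le> (\<integral>\<^sup>+z. ennreal ((norm (g z - y n z))\<^sup>2) \<partial>time_space T)" by simp
    show "\<forall>\<^sub>F n in sequentially. (\<integral>\<^sup>+z. ennreal ((norm (g z - y n z))\<^sup>2) \<partial>time_space T) \<le> ennreal (?e n)"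
      using le by (intro always_eventually allI)
    show "(\<lambda>n. ennreal (?e n)) \<longlonglongrightarrow> 0" using e by simp
  qed simp
qed

lemma nn_integral_square_le:
  assumes "square_integrable M f" "expectation (\<lambda>\<omega>. (norm (f \<omega>))\<^sup>2) \<le> b"
  shows "(\<integral>\<^sup>+\<omega>. ennreal ((norm (f \<omega>))\<^sup>2) \<partial>M) \<le> ennreal b"
  using assms by (subst nn_integral_eq_integral) (auto intro: ennreal_leI)

lemma state_cell_bound:
  assumes n: "n > 0" and r: "r \<in> {0..T}" and st: "lower n r \<le> s" "s \<le> t" "t \<le> upper n r"
  shows "expectation (\<lambda>\<omega>. (norm (x t \<omega> - x s \<omega>))\<^sup>2) \<le> cell_bound n r"
proof -
  note b = cell_bounds[OF n r]
  have "expectation (\<lambda>\<omega>. (norm (x t \<omega> - x s \<omega>))\<^sup>2)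
    \<le> 2 * ((t - s) * cell_energy T a s t + cell_energy T H s t)"
    using b st by (intro state_increment_energy) auto
  also have "\<dots> \<le> cell_bound n r"
    unfolding cell_bound_def using b st
    by (intro mult_left_mono add_mono mult_mono cell_energy_mono a H_sq cell_energy_nonneg) auto
  finally show ?thesis .
qed

lemma square_integrable_state_diff:
  "s \<in> {0..T} \<Longrightarrow> t \<in> {0..T} \<Longrightarrow> square_integrable M (\<lambda>\<omega>. x t \<omega> - x s \<omega>)"
  by (intro square_integrable_diff square_integrable_state)

lemma measurable_state: "t \<in> {0..T} \<Longrightarrow> x t \<in> borel_measurable M"
  by (rule measurable_filtrD[OF x_adapted])

lemma state_upper: "L2_tendsto (time_space T) (\<lambda>n z. x (upper (Suc n) (fst z)) (snd z)) (\<lambda>z. x (fst z) (snd z))"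
proof (rule L2_tendsto_step[OF x_sq])
  show "(\<lambda>z. x (upper (Suc n) (fst z)) (snd z)) \<in> borel_measurable (time_space T)" for n
    by (intro measurable_upper measurable_state) auto
  fix n r assume "r \<in> {0<..T}"
  then have r: "r \<in> {0..T}" by auto
  note b = cell_bounds[OF _ r, of "Suc n"]
  have "(\<integral>\<^sup>+\<omega>. ennreal ((norm (x (upper (Suc n) r) \<omega> - x r \<omega>))\<^sup>2) \<partial>M) \<le> ennreal (cell_bound (Suc n) r)"
    using b r by (intro nn_integral_square_le square_integrable_state_diff state_cell_bound) auto
  then show "(\<integral>\<^sup>+\<omega>. ennreal ((norm (x (fst (r, \<omega>)) (snd (r, \<omega>)) - x (upper (Suc n) (fst (r, \<omega>))) (snd (r, \<omega>))))\<^sup>2) \<partial>M)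
      \<le> ennreal (cell_bound (Suc n) r)"
    by (simp add: norm_minus_commute)
qed

lemma state_lower: "L2_tendsto (time_space T) (\<lambda>n z. x (lower (Suc n) (fst z)) (snd z)) (\<lambda>z. x (fst z) (snd z))"
proof (rule L2_tendsto_step[OF x_sq])
  show "(\<lambda>z. x (lower (Suc n) (fst z)) (snd z)) \<in> borel_measurable (time_space T)" for n
    by (intro measurable_lower measurable_state) auto
  fix n r assume "r \<in> {0<..T}"
  then have r: "r \<in> {0..T}" by auto
  note b = cell_bounds[OF _ r, of "Suc n"]
  have "(\<integral>\<^sup>+\<omega>. ennreal ((norm (x r \<omega> - x (lower (Suc n) r) \<omega>))\<^sup>2) \<partial>M) \<le> ennreal (cell_bound (Suc n) r)"
    using b r by (intro nn_integral_square_le square_integrable_state_diff state_cell_bound) auto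
  then show "(\<integral>\<^sup>+\<omega>. ennreal ((norm (x (fst (r, \<omega>)) (snd (r, \<omega>)) - x (lower (Suc n) (fst (r, \<omega>))) (snd (r, \<omega>))))\<^sup>2) \<partial>M)
      \<le> ennreal (cell_bound (Suc n) r)"
    by simp
qed

lemma noise_step: "L2_tendsto (time_space T)
   (\<lambda>n z. I (upper (Suc n) (fst z)) (snd z) - I (lower (Suc n) (fst z)) (snd z)) (\<lambda>z. 0)"
proof (rule L2_tendsto_step)
  have Im: "I t \<in> borel_measurable M" if "t \<in> {0..T}" for t
    using square_integrable_ito[OF less_imp_le[OF T] ito that] by auto
  show "(\<lambda>z. I (upper (Suc n) (fst z)) (snd z) - I (lower (Suc n) (fst z)) (snd z)) \<in> borel_measurable (time_space T)" for n
    by (intro borel_measurable_diff measurable_lower measurable_upper Im) auto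
  show "square_integrable (time_space T) (\<lambda>z. 0 :: real ^ 'n)" by (simp add: square_integrable_def)
  fix n r assume "r \<in> {0<..T}"
  then have r: "r \<in> {0..T}" by auto
  note b = cell_bounds[OF _ r, of "Suc n"]
  have "expectation (\<lambda>\<omega>. (norm (I (upper (Suc n) r) \<omega> - I (lower (Suc n) r) \<omega>))\<^sup>2)
     = cell_energy T H (lower (Suc n) r) (upper (Suc n) r)"
    using b by (intro ito_increment_energy) auto
  also have "\<dots> \<le> cell_bound (Suc n) r"
    using cell_energy_nonneg[of H] mult_nonneg_nonneg[OF less_imp_le[OF mesh_pos[of "Suc n"]] cell_energy_nonneg[of a]]
    by (simp add: cell_bound_def)
  finally have "(\<integral>\<^sup>+\<omega>. ennreal ((norm (I (upper (Suc n) r) \<omega> - I (lower (Suc n) r) \<omega>))\<^sup>2) \<partial>M) \<le> ennreal (cell_bound (Suc n) r)"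
    using b by (intro nn_integral_square_le square_integrable_diff square_integrable_ito[OF less_imp_le[OF T] ito]) auto
  then show "(\<integral>\<^sup>+\<omega>. ennreal ((norm (0 - (I (upper (Suc n) (fst (r, \<omega>))) (snd (r, \<omega>)) - I (lower (Suc n) (fst (r, \<omega>))) (snd (r, \<omega>)))))\<^sup>2) \<partial>M)
      \<le> ennreal (cell_bound (Suc n) r)"
    by (simp add: norm_minus_commute)
qed

lemma upper_tendsto:
  assumes r: "r \<in> {0..T}"
  shows "(\<lambda>n. upper (Suc n) r) \<longlonglongrightarrow> r"
proof (rule tendsto_sandwich)
  show "\<forall>\<^sub>F n in sequentially. r \<le> upper (Suc n) r" using cell_bounds(3)[OF _ r] by simp
  show "\<forall>\<^sub>F n in sequentially. upper (Suc n) r \<le> r + mesh (Suc n)"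
  proof (intro always_eventually allI)
    show "upper (Suc n) r \<le> r + mesh (Suc n)" for n
      using cell_bounds(2,5)[OF _ r, of "Suc n"] by simp
  qed
  show "(\<lambda>n. r + mesh (Suc n)) \<longlonglongrightarrow> r" using tendsto_add[OF tendsto_const mesh_tendsto, of r] by simp
qed simp

lemma lower_tendsto:
  assumes r: "r \<in> {0..T}"
  shows "(\<lambda>n. lower (Suc n) r) \<longlonglongrightarrow> r"
proof (rule tendsto_sandwich)
  show "\<forall>\<^sub>F n in sequentially. lower (Suc n) r \<le> r" using cell_bounds(2)[OF _ r] by simp
  show "\<forall>\<^sub>F n in sequentially. r - mesh (Suc n) \<le> lower (Suc n) r"
  proof (intro always_eventually allI)
    show "r - mesh (Suc n) \<le> lower (Suc n) r" for n
      using cell_bounds(3,5)[OF _ r, of "Suc n"] by simp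
  qed
  show "(\<lambda>n. r - mesh (Suc n)) \<longlonglongrightarrow> r" using tendsto_diff[OF tendsto_const mesh_tendsto, of r] by simp
qed simp

lemma chain_upper_eventually:
  assumes r: "r \<in> {0..T}" and \<omega>: "\<omega> \<in> space M"
  shows "\<forall>\<^sub>F n in sequentially. \<alpha> (upper (Suc n) r) \<omega> = \<alpha> r \<omega>"
proof -
  have "\<forall>\<^sub>F s in at_right r. \<alpha> s \<omega> = \<alpha> r \<omega>"
    using cadlag_chain[OF \<omega>] r by (simp add: cadlag_path_def)
  then obtain b where b: "b > r" "\<And>s. r < s \<Longrightarrow> s < b \<Longrightarrow> \<alpha> s \<omega> = \<alpha> r \<omega>"
    by (auto simp: eventually_at_right_field)
  have "\<forall>\<^sub>F n in sequentially. upper (Suc n) r < b"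
    using upper_tendsto[OF r] b(1) by (rule order_tendstoD)
  then show ?thesis
  proof eventually_elim
    case (elim n)
    then show ?case using b(2)[of "upper (Suc n) r"] cell_bounds(3)[OF _ r, of "Suc n"]
      by (cases "upper (Suc n) r = r") auto
  qed
qed

lemma chain_lower_eventually:
  assumes r: "r \<in> {0<..T}" and \<omega>: "\<omega> \<in> space M" and no_jump: "left_state \<alpha> r \<omega> = \<alpha> r \<omega>"
  shows "\<forall>\<^sub>F n in sequentially. \<alpha> (lower (Suc n) r) \<omega> = \<alpha> r \<omega>"
proof -
  have r': "r \<in> {0..T}" using r by auto
  have "\<forall>\<^sub>F s in at_left r. \<alpha> s \<omega> = \<alpha> r \<omega>"
    using eventually_left_state[where \<alpha>=\<alpha> and \<omega>=\<omega>, OF cadlag_chain[OF \<omega>], of r] r no_jump by simp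
  then obtain b where b: "b < r" "\<And>s. b < s \<Longrightarrow> s < r \<Longrightarrow> \<alpha> s \<omega> = \<alpha> r \<omega>"
    by (auto simp: eventually_at_left_field)
  have "\<forall>\<^sub>F n in sequentially. b < lower (Suc n) r"
    using lower_tendsto[OF r'] b(1) by (rule order_tendstoD)
  then show ?thesis
    by eventually_elim (use b(2) cell_bounds(6)[OF _ r'] r in auto)
qed

text \<open>Approaching \<open>r\<close> from below, the chain has the limit \<open>left_state \<alpha> r\<close>, which is its value at \<open>r\<close> except
  at the countably many jump times.\<close>

lemma AE_chain_lower:
  "AE z in time_space T. \<forall>\<^sub>F n in sequentially. \<alpha> (lower (Suc n) (fst z)) (snd z) = \<alpha> (fst z) (snd z)"
proof (rule AE_time_space)
  have ae: "AE t in lborel. t \<in> {0..T} \<longrightarrow> (\<forall>\<^sub>F n in sequentially. \<alpha> (lower (Suc n) t) \<omega> = \<alpha> t \<omega>)"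
    if \<omega>: "\<omega> \<in> space M" for \<omega>
  proof -
    let ?J = "{s. 0 < s \<and> left_state \<alpha> s \<omega> \<noteq> \<alpha> s \<omega>} \<union> {0}"
    have "countable ?J"
      using countable_jumps[where \<alpha>=\<alpha> and \<omega>=\<omega>, OF cadlag_chain[OF \<omega>]] by simp
    then have "?J \<in> null_sets lborel" by (rule countable_imp_null_set_lborel)
    from AE_not_in[OF this] show ?thesis
      by eventually_elim (use chain_lower_eventually[OF _ \<omega>] in auto)
  qed
  then show "AE \<omega> in M. AE t in lborel. t \<in> {0..T} \<longrightarrow> (\<forall>\<^sub>F n in sequentially. \<alpha> (lower (Suc n) t) \<omega> = \<alpha> t \<omega>)"
    by (rule AE_I2)
  have eqm: "{z\<in>space (time_space T). f z = g z} \<in> sets (time_space T)"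
    if f: "f \<in> measurable (time_space T) (count_space UNIV)" and g: "g \<in> measurable (time_space T) (count_space UNIV)"
    for f g :: "real \<times> 'w \<Rightarrow> 'd"
  proof -
    have "{z\<in>space (time_space T). f z = g z} = (\<Union>i\<in>UNIV. (f -` {i} \<inter> space (time_space T)) \<inter> (g -` {i} \<inter> space (time_space T)))"
      by auto
    also have "\<dots> \<in> sets (time_space T)"
      by (intro sets.finite_UN sets.Int measurable_sets[OF f] measurable_sets[OF g]) auto
    finally show ?thesis .
  qed
  have lm: "(\<lambda>z. \<alpha> (lower (Suc n) (fst z)) (snd z)) \<in> measurable (time_space T) (count_space UNIV)" for n
    by (intro measurable_lower measurable_chain) auto
  have "{z\<in>space (time_space T). \<forall>\<^sub>F n in sequentially. \<alpha> (lower (Suc n) (fst z)) (snd z) = \<alpha> (fst z) (snd z)}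
    = (\<Union>m. \<Inter>n\<in>{m..}. {z\<in>space (time_space T). \<alpha> (lower (Suc n) (fst z)) (snd z) = \<alpha> (fst z) (snd z)})"
    unfolding eventually_sequentially by (rule set_eqI, simp only: mem_Collect_eq UN_iff INT_iff atLeast_iff) blast
  also have "\<dots> \<in> sets (time_space T)"
  proof (rule sets.countable_UN, rule image_subsetI)
    fix m :: nat
    show "(\<Inter>n\<in>{m..}. {z\<in>space (time_space T). \<alpha> (lower (Suc n) (fst z)) (snd z) = \<alpha> (fst z) (snd z)}) \<in> sets (time_space T)"
      by (rule sets.countable_INT', simp, simp, rule image_subsetI, rule eqm[OF lm measurable_chain_time])
  qed
  finally show "{z\<in>space (time_space T). \<forall>\<^sub>F n in sequentially. \<alpha> (lower (Suc n) (fst z)) (snd z) = \<alpha> (fst z) (snd z)}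
     \<in> sets (time_space T)" .
qed

section \<open>The verification identity\<close>

lemma measurable_k_time: "(\<lambda>z. k (fst z) (\<alpha> (fst z) (snd z))) \<in> borel_measurable (time_space T)"
  by (rule measurable_regime_coefficient)
    (rule borel_measurable_continuous_on_restrict[OF k_continuous])

text \<open>Summing the exact one-step identity over the cells gives the same left-hand side for every
  mesh; the right-hand side converges as the mesh tends to zero.\<close>

theorem verification_identity:
  "expectation (\<lambda>\<omega>. x T \<omega> \<bullet> (k T (\<alpha> T \<omega>) *v x T \<omega>)) - \<xi> \<bullet> (\<kappa> i\<^sub>0 *v \<xi>)
   = (\<integral>z. x (fst z) (snd z) \<bullet> (k (fst z) (\<alpha> (fst z) (snd z)) *v a (fst z) (snd z)) \<partial>time_space T)
   + (\<integral>z. a (fst z) (snd z) \<bullet> (k (fst z) (\<alpha> (fst z) (snd z)) *v x (fst z) (snd z)) \<partial>time_space T)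
   + (\<integral>z. H (fst z) (snd z) \<bullet> (k (fst z) (\<alpha> (fst z) (snd z)) *v H (fst z) (snd z)) \<partial>time_space T)
   + (\<integral>z. x (fst z) (snd z) \<bullet> ((\<theta> (fst z) (\<alpha> (fst z) (snd z))
         + (\<Sum>j\<in>UNIV. \<pi> (\<alpha> (fst z) (snd z)) j *\<^sub>R k (fst z) j)) *v x (fst z) (snd z)) \<partial>time_space T)"
    (is "?lhs = ?I1 + ?I2 + ?I3 + ?I4")
proof (rule markov_property)
  fix p assume p: "transition_function \<pi> p"
    and markov: "\<And>s t j Y. 0 \<le> s \<Longrightarrow> 0 \<le> t \<Longrightarrow> Y \<in> borel_measurable (\<F> s) \<Longrightarrow> integrable M Y \<Longrightarrow>
       expectation (\<lambda>\<omega>. Y \<omega> * of_bool (\<alpha> (s + t) \<omega> = j)) = expectation (\<lambda>\<omega>. Y \<omega> * p t (\<alpha> s \<omega>) j)"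
  let ?N = "time_space T"
  define x' a' H' where "x' z = x (fst z) (snd z)" and "a' z = a (fst z) (snd z)"
    and "H' z = H (fst z) (snd z)" for z
  define xl xu J where "xl n z = x (lower (Suc n) (fst z)) (snd z)" and "xu n z = x (upper (Suc n) (fst z)) (snd z)"
    and "J n z = I (upper (Suc n) (fst z)) (snd z) - I (lower (Suc n) (fst z)) (snd z)" for n z
  define K where "K n z = k (upper (Suc n) (fst z)) (\<alpha> (upper (Suc n) (fst z)) (snd z))" for n z
  define K' where "K' z = k (fst z) (\<alpha> (fst z) (snd z))" for z
  define \<Psi> where "\<Psi> n z = chain_rate p (lower (Suc n) (fst z)) (upper (Suc n) (fst z)) z" for n z
  define \<Psi>' where "\<Psi>' z = \<theta> (fst z) (\<alpha> (fst z) (snd z)) + (\<Sum>j\<in>UNIV. \<pi> (\<alpha> (fst z) (snd z)) j *\<^sub>R k (fst z) j)" for z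
  have xl: "L2_tendsto ?N xl x'" and xu: "L2_tendsto ?N xu x'" and J: "L2_tendsto ?N J (\<lambda>_. 0)"
    using state_lower state_upper noise_step unfolding xl_def[abs_def] xu_def[abs_def] J_def[abs_def] x'_def[abs_def] .
  have a': "square_integrable ?N a'" and H': "square_integrable ?N H'"
    using a H_sq unfolding a'_def[abs_def] H'_def[abs_def] .
  note a'L = L2_tendsto_const[OF a'] and H'L = L2_tendsto_const[OF H']
  have Km: "K n \<in> borel_measurable ?N" for n
    unfolding K_def[abs_def] using measurable_enlargedD[OF measurable_weight_chain]
    by (intro measurable_upper[where f = "\<lambda>t \<omega>. k t (\<alpha> t \<omega>)"]) auto
  have Kb: "AE z in ?N. norm (K n z) \<le> k_bound" for n
    unfolding K_def by (intro AE_I2 k_bounded cell_ends) auto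
  have K'm: "K' \<in> borel_measurable ?N" unfolding K'_def[abs_def] by (rule measurable_k_time)
  have K_lim: "AE z in ?N. (\<lambda>n. K n z) \<longlonglongrightarrow> K' z"
  proof (rule AE_I2)
    fix z assume "z \<in> space ?N"
    then have r: "fst z \<in> {0..T}" and w: "snd z \<in> space M" by auto
    have "(\<lambda>n. k (upper (Suc n) (fst z)) (\<alpha> (fst z) (snd z))) \<longlonglongrightarrow> K' z"
      unfolding K'_def by (intro k_tendsto upper_tendsto r cell_ends) auto
    then show "(\<lambda>n. K n z) \<longlonglongrightarrow> K' z"
      by (rule Lim_transform_eventually)
        (use chain_upper_eventually[OF r w] in \<open>auto simp: K_def elim: eventually_mono\<close>)
  qed
  have q_lim: "(\<lambda>n. difference_quotient p (mesh (Suc n)) i j) \<longlonglongrightarrow> \<pi> i j" for i j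
  proof -
    have "((\<lambda>h. (p h i j - of_bool (i = j)) / h) \<longlongrightarrow> \<pi> i j) (at_right 0)"
      using p by (simp add: transition_function_def)
    moreover have "filterlim (\<lambda>n. mesh (Suc n)) (at_right 0) sequentially"
    proof -
      have "mesh (Suc n) \<in> {0<..} \<and> mesh (Suc n) \<noteq> 0" for n using mesh_pos[of "Suc n"] by simp
      then show ?thesis unfolding filterlim_at using mesh_tendsto by simp
    qed
    ultimately show ?thesis unfolding difference_quotient_def by (rule filterlim_compose)
  qed
  define q where "q n = (\<Sum>i\<in>UNIV. \<Sum>j\<in>UNIV. \<bar>difference_quotient p (mesh (Suc n)) i j\<bar>)" for n
  have "q \<longlonglongrightarrow> (\<Sum>i\<in>UNIV. \<Sum>j\<in>UNIV. \<bar>\<pi> i j\<bar>)" unfolding q_def[abs_def] by (intro tendsto_intros q_lim)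
  then have "Bseq q" by (intro convergent_imp_Bseq convergentI)
  then obtain Q where Q: "Q > 0" "\<And>n. \<bar>q n\<bar> \<le> Q" by (auto simp: Bseq_def)
  have \<Psi>b: "AE z in ?N. norm (\<Psi> n z) \<le> c + Q * k_bound" for n
    using AE_time_pos AE_space
  proof eventually_elim
    case (elim z)
    then have r: "fst z \<in> {0..T}" by auto
    have "norm (chain_rate p (lower (Suc n) (fst z)) (upper (Suc n) (fst z)) z)
      \<le> c + (\<Sum>i\<in>UNIV. \<Sum>j\<in>UNIV. \<bar>difference_quotient p (upper (Suc n) (fst z) - lower (Suc n) (fst z)) i j\<bar>) * k_bound"
      by (rule chain_rate_bound[OF p markov cell_ends(2)[OF _ r]]) simp_all
    then have "norm (\<Psi> n z) \<le> c + q n * k_bound"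
      unfolding cell_bounds(7)[OF zero_less_Suc r elim(1)] \<Psi>_def q_def .
    also have "\<dots> \<le> c + Q * k_bound"
      using Q(2)[of n] k_bound_nonneg by (intro add_left_mono mult_right_mono) auto
    finally show ?case .
  qed
  have \<Psi>m: "\<Psi> n \<in> borel_measurable ?N" for n
  proof -
    have g: "(\<lambda>z. \<alpha> (lower (Suc n) (fst z)) (snd z)) \<in> measurable ?N (count_space UNIV)"
      by (intro measurable_lower measurable_chain) auto
    have k: "(\<lambda>z. difference_quotient p (upper (Suc n) (fst z) - lower (Suc n) (fst z)) (\<alpha> (lower (Suc n) (fst z)) (snd z)) j
         *\<^sub>R k (upper (Suc n) (fst z)) j) \<in> borel_measurable ?N" for j
    proof -
      have "(\<lambda>z. (\<lambda>m \<omega>. difference_quotient p (mesh (Suc n) * real m - mesh (Suc n) * real (m - 1)) (\<alpha> (mesh (Suc n) * real (m - 1)) \<omega>) j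
         *\<^sub>R k (mesh (Suc n) * real m) j) (cell_index (Suc n) (fst z)) (snd z)) \<in> borel_measurable ?N"
      proof (rule measurable_step)
        fix m assume "m \<le> Suc n"
        have "0 \<le> mesh (Suc n) * real (m - 1)" using mesh_pos[of "Suc n"] by simp
        then show "(\<lambda>\<omega>. difference_quotient p (mesh (Suc n) * real m - mesh (Suc n) * real (m - 1)) (\<alpha> (mesh (Suc n) * real (m - 1)) \<omega>) j
           *\<^sub>R k (mesh (Suc n) * real m) j) \<in> borel_measurable M"
          by (intro borel_measurable_scaleR measurable_compose[OF measurable_chain] borel_measurable_const) auto
      qed
      then show ?thesis by (simp add: upper_def lower_def)
    qed
    show ?thesis unfolding \<Psi>_def chain_rate_def
      by (intro borel_measurable_add borel_measurable_sum measurable_\<theta>_regime[OF p markov g] k)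
  qed
  have \<Psi>'m: "\<Psi>' \<in> borel_measurable ?N"
  proof -
    have "(\<lambda>z. k (fst z) j) \<in> borel_measurable ?N" for j
      by (rule measurable_compose[OF measurable_time_fst_restrict
          borel_measurable_continuous_on_restrict[OF k_continuous]])
    then show ?thesis unfolding \<Psi>'_def[abs_def]
      by (intro borel_measurable_add borel_measurable_sum borel_measurable_scaleR
          measurable_\<theta>_regime[OF p markov measurable_chain_time] measurable_compose[OF measurable_chain_time]) auto
  qed
  have \<Psi>_lim: "AE z in ?N. (\<lambda>n. \<Psi> n z) \<longlonglongrightarrow> \<Psi>' z"
    using AE_time_pos AE_space AE_chain_lower
  proof eventually_elim
    case (elim z)
    then have r: "fst z \<in> {0..T}" by auto
    define i where "i = \<alpha> (fst z) (snd z)"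
    have "(\<lambda>n. \<theta> (fst z) i + (\<Sum>j\<in>UNIV. difference_quotient p (mesh (Suc n)) i j *\<^sub>R k (upper (Suc n) (fst z)) j)) \<longlonglongrightarrow> \<Psi>' z"
      unfolding \<Psi>'_def i_def[symmetric]
      by (intro tendsto_intros q_lim k_tendsto upper_tendsto r cell_ends) auto
    then show ?case
    proof (rule Lim_transform_eventually)
      show "\<forall>\<^sub>F n in sequentially. \<theta> (fst z) i + (\<Sum>j\<in>UNIV. difference_quotient p (mesh (Suc n)) i j *\<^sub>R k (upper (Suc n) (fst z)) j) = \<Psi> n z"
        using elim(3)
        by eventually_elim (use cell_bounds(7)[OF _ r] elim(1) in \<open>simp add: \<Psi>_def chain_rate_def i_def\<close>)
    qed
  qed
  have c0: "0 \<le> c + Q * k_bound" using c_nonneg Q(1) k_bound_nonneg by simp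
  note form = tendsto_integral_matrix_form[OF _ _ Km Kb K'm K_lim k_bound_nonneg]
  have lim: "(\<lambda>n. (\<integral>z. xl n z \<bullet> (K n z *v a' z) \<partial>?N) + (\<integral>z. a' z \<bullet> (K n z *v xu n z) \<partial>?N)
      + (\<integral>z. J n z \<bullet> (K n z *v a' z) \<partial>?N) + (\<integral>z. H' z \<bullet> (K n z *v H' z) \<partial>?N)
      + (\<integral>z. xl n z \<bullet> (\<Psi> n z *v xl n z) \<partial>?N))
    \<longlonglongrightarrow> (\<integral>z. x' z \<bullet> (K' z *v a' z) \<partial>?N) + (\<integral>z. a' z \<bullet> (K' z *v x' z) \<partial>?N)
      + (\<integral>z. 0 \<bullet> (K' z *v a' z) \<partial>?N) + (\<integral>z. H' z \<bullet> (K' z *v H' z) \<partial>?N)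
      + (\<integral>z. x' z \<bullet> (\<Psi>' z *v x' z) \<partial>?N)"
    by (intro tendsto_add form[OF xl a'L] form[OF a'L xu] form[OF J a'L] form[OF H'L H'L]
        tendsto_integral_matrix_form[OF xl xl \<Psi>m \<Psi>b \<Psi>'m \<Psi>_lim c0])
  have const: "(\<integral>z. xl n z \<bullet> (K n z *v a' z) \<partial>?N) + (\<integral>z. a' z \<bullet> (K n z *v xu n z) \<partial>?N)
      + (\<integral>z. J n z \<bullet> (K n z *v a' z) \<partial>?N) + (\<integral>z. H' z \<bullet> (K n z *v H' z) \<partial>?N)
      + (\<integral>z. xl n z \<bullet> (\<Psi> n z *v xl n z) \<partial>?N) = ?lhs" for n
  proof -
    define N where "N = Suc n"
    have N: "N > 0" by (simp add: N_def)
    define G where "G z = xl n z \<bullet> (K n z *v a' z) + a' z \<bullet> (K n z *v xu n z)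
      + J n z \<bullet> (K n z *v a' z) + H' z \<bullet> (K n z *v H' z) + xl n z \<bullet> (\<Psi> n z *v xl n z)" for z
    have sq: "square_integrable ?N (xl n)" "square_integrable ?N (xu n)" "square_integrable ?N (J n)"
      using xl xu J by (auto simp: L2_tendsto_def)
    have int: "integrable ?N (\<lambda>z. f z \<bullet> (K n z *v g z))" if "square_integrable ?N f" "square_integrable ?N g" for f g
      by (intro integrable_inner_square_integrable that square_integrable_matrix_mult[OF that(2) Km Kb])
    have int\<Psi>: "integrable ?N (\<lambda>z. xl n z \<bullet> (\<Psi> n z *v xl n z))"
      by (intro integrable_inner_square_integrable sq square_integrable_matrix_mult[OF sq(1) \<Psi>m \<Psi>b])
    have G: "integrable ?N G" unfolding G_def[abs_def]
      by (intro Bochner_Integration.integrable_add int int\<Psi> sq a' H')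
    have IG: "(\<integral>z. xl n z \<bullet> (K n z *v a' z) \<partial>?N) + (\<integral>z. a' z \<bullet> (K n z *v xu n z) \<partial>?N)
      + (\<integral>z. J n z \<bullet> (K n z *v a' z) \<partial>?N) + (\<integral>z. H' z \<bullet> (K n z *v H' z) \<partial>?N)
      + (\<integral>z. xl n z \<bullet> (\<Psi> n z *v xl n z) \<partial>?N) = (\<integral>z. G z \<partial>?N)"
      unfolding G_def[abs_def]
      using int[OF sq(1) a'] int[OF a' sq(2)] int[OF sq(3) a'] int[OF H' H'] int\<Psi> by simp
    define \<phi> where "\<phi> t = expectation (\<lambda>\<omega>. x t \<omega> \<bullet> (k t (\<alpha> t \<omega>) *v x t \<omega>))" for t
    have "(\<integral>z. G z \<partial>?N) = (\<Sum>j<N. \<integral>z. indicator {mesh N * real j<..mesh N * real (Suc j)} (fst z) * G z \<partial>?N)"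
      by (rule integral_sum_cells[OF N G, symmetric])
    also have "\<dots> = (\<Sum>j<N. \<phi> (mesh N * real (Suc j)) - \<phi> (mesh N * real j))"
    proof (intro sum.cong refl)
      fix j assume "j \<in> {..<N}"
      then have j: "j < N" by simp
      have "(\<integral>z. indicator {mesh N * real j<..mesh N * real (Suc j)} (fst z) * G z \<partial>?N)
        = (\<integral>z. indicator {mesh N * real j<..mesh N * real (Suc j)} (fst z)
             * cell_rate p (mesh N * real j) (mesh N * real (Suc j)) z \<partial>?N)"
      proof (intro Bochner_Integration.integral_cong refl)
        fix z
        show "indicator {mesh N * real j<..mesh N * real (Suc j)} (fst z) * G z
          = indicator {mesh N * real j<..mesh N * real (Suc j)} (fst z)
             * cell_rate p (mesh N * real j) (mesh N * real (Suc j)) z"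
        proof (cases "fst z \<in> {mesh N * real j<..mesh N * real (Suc j)}")
          case True
          then have "cell_index N (fst z) = Suc j" using cell_index_eq[OF N j] by auto
          then have lu: "lower N (fst z) = mesh N * real j" "upper N (fst z) = mesh N * real (Suc j)"
            by (simp_all add: lower_def upper_def)
          show ?thesis
            unfolding G_def xl_def xu_def J_def K_def \<Psi>_def a'_def H'_def cell_rate_def N_def[symmetric] lu ..
        qed simp
      qed
      also have "\<dots> = \<phi> (mesh N * real (Suc j)) - \<phi> (mesh N * real j)"
        unfolding \<phi>_def
        using index_times[OF N, of "Suc j"] index_times[OF N, of j] mesh_pos[OF N] j
        by (intro one_step[OF p markov, symmetric]) auto
      finally show "(\<integral>z. indicator {mesh N * real j<..mesh N * real (Suc j)} (fst z) * G z \<partial>?N)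
        = \<phi> (mesh N * real (Suc j)) - \<phi> (mesh N * real j)" .
    qed
    also have "\<dots> = \<phi> T - \<phi> 0"
      using sum_lessThan_telescope[of "\<lambda>j. \<phi> (mesh N * real j)" N] mesh_mult[OF N] by simp
    also have "\<phi> 0 = \<xi> \<bullet> (\<kappa> i\<^sub>0 *v \<xi>)"
    proof -
      have x0 [measurable]: "x 0 \<in> borel_measurable M" using T by (intro measurable_state) auto
      have "\<phi> 0 = expectation (\<lambda>\<omega>. \<xi> \<bullet> (\<kappa> i\<^sub>0 *v \<xi>))"
        unfolding \<phi>_def
      proof (rule integral_cong_AE)
        show "AE \<omega> in M. x 0 \<omega> \<bullet> (k 0 (\<alpha> 0 \<omega>) *v x 0 \<omega>) = \<xi> \<bullet> (\<kappa> i\<^sub>0 *v \<xi>)"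
          using state_zero AE_space by eventually_elim (simp add: chain_zero k_zero)
        show "(\<lambda>\<omega>. x 0 \<omega> \<bullet> (k 0 (\<alpha> 0 \<omega>) *v x 0 \<omega>)) \<in> borel_measurable M"
          using measurable_enlargedD[OF measurable_weight_chain[of 0 0]]
          by (intro borel_measurable_inner borel_measurable_matrix_vector_mult x0) auto
      qed simp
      then show ?thesis by (simp add: prob_space)
    qed
    finally show ?thesis unfolding IG \<phi>_def .
  qed
  have "?lhs = (\<integral>z. x' z \<bullet> (K' z *v a' z) \<partial>?N) + (\<integral>z. a' z \<bullet> (K' z *v x' z) \<partial>?N)
      + (\<integral>z. 0 \<bullet> (K' z *v a' z) \<partial>?N) + (\<integral>z. H' z \<bullet> (K' z *v H' z) \<partial>?N)
      + (\<integral>z. x' z \<bullet> (\<Psi>' z *v x' z) \<partial>?N)"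
    by (rule LIMSEQ_unique[OF _ lim]) (unfold const, rule tendsto_const)
  then show ?thesis by (simp add: x'_def a'_def H'_def K'_def \<Psi>'_def)
qed

end

section \<open>Positivity of the transition probabilities\<close>

context
  fixes \<pi> :: "'d::finite \<Rightarrow> 'd \<Rightarrow> real" and p :: "real \<Rightarrow> 'd \<Rightarrow> 'd \<Rightarrow> real"
  assumes p: "transition_function \<pi> p"
begin

lemma transition_nonneg: "0 \<le> t \<Longrightarrow> 0 \<le> p t i j"
  using p by (simp add: transition_function_def)

lemma transition_zero: "p 0 i j = of_bool (i = j)"
  using p by (simp add: transition_function_def)

lemma transition_add: "0 \<le> s \<Longrightarrow> 0 \<le> t \<Longrightarrow> p (s + t) i j = (\<Sum>l\<in>UNIV. p s i l * p t l j)"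
  using p by (simp add: transition_function_def)

lemma transition_ge_product:
  assumes "0 \<le> s" "0 \<le> t"
  shows "p s i l * p t l j \<le> p (s + t) i j"
  unfolding transition_add[OF assms]
  by (rule member_le_sum) (auto intro: mult_nonneg_nonneg transition_nonneg assms)

text \<open>The derivative of \<open>p h i i\<close> at zero is finite and \<open>p 0 i i = 1\<close>.  Any constant above \<open>- \<pi> i i\<close> serves
  as slope.\<close>

lemma transition_diag_linear_bound:
  "\<exists>c>0. \<exists>h0>0. \<forall>h. 0 < h \<longrightarrow> h < h0 \<longrightarrow> 1 - c * h < p h i i"
proof -
  define c where "c = \<bar>\<pi> i i\<bar> + 1"
  have "((\<lambda>h. (p h i i - 1) / h) \<longlongrightarrow> \<pi> i i) (at_right 0)"
  proof -
    have "((\<lambda>h. (p h i i - of_bool (i = i)) / h) \<longlongrightarrow> \<pi> i i) (at_right 0)"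
      using p unfolding transition_function_def by blast
    then show ?thesis by simp
  qed
  then have "\<forall>\<^sub>F h in at_right 0. - c < (p h i i - 1) / h"
    by (rule order_tendstoD) (simp add: c_def)
  then obtain h0 where h0: "h0 > 0" "\<And>h. 0 < h \<Longrightarrow> h < h0 \<Longrightarrow> - c < (p h i i - 1) / h"
    by (auto simp: eventually_at_right_field)
  have "1 - c * h < p h i i" if "0 < h" "h < h0" for h
    using h0(2)[OF that] that by (simp add: less_divide_eq)
  moreover have "0 < c" by (simp add: c_def)
  ultimately show ?thesis using h0(1) by blast
qed

lemma transition_diag_pos:
  assumes "0 \<le> s"
  shows "0 < p s i i"
proof -
  obtain c h0 where c: "0 < c" "0 < h0" "\<And>h. 0 < h \<Longrightarrow> h < h0 \<Longrightarrow> 1 - c * h < p h i i"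
    using transition_diag_linear_bound[of i] by blast
  have small: "0 < p h i i" if "0 < h" "h < min h0 (1 / c)" for h
  proof -
    have "c * h < 1" using that c by (simp add: field_simps)
    then show ?thesis using c(3)[of h] that by simp
  qed
  have pow: "0 < p (real n * h) i i" if "0 < p h i i" "0 \<le> h" for n h
  proof (induction n)
    case (Suc n)
    have "0 < p (real n * h) i i * p h i i" using Suc that by simp
    also have "\<dots> \<le> p (real n * h + h) i i" using that by (intro transition_ge_product) auto
    finally show ?case by (simp add: algebra_simps)
  qed (simp add: transition_zero)
  show ?thesis
  proof (cases "s = 0")
    case False
    obtain n :: nat where n: "s / min h0 (1 / c) < real n" using reals_Archimedean2 by blast
    have m: "0 < min h0 (1 / c)" using c by simp
    have n0: "0 < real n" using n assms m by (meson divide_nonneg_pos le_less_trans)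
    have "s < real n * min h0 (1 / c)" using n by (simp only: pos_divide_less_eq[OF m])
    then have "s / real n < min h0 (1 / c)" by (simp only: pos_divide_less_eq[OF n0] mult.commute)
    then have "0 < p (s / real n) i i" using False assms n0 by (intro small) auto
    from pow[OF this, of n] show ?thesis using n0 assms by simp
  qed (simp add: transition_zero)
qed

lemma transition_pos_mono:
  assumes "0 < p s i j" "0 \<le> s" "s \<le> t"
  shows "0 < p t i j"
proof -
  have "0 < p s i j * p (t - s) j j" using assms transition_diag_pos[of "t - s" j] by simp
  also have "\<dots> \<le> p (s + (t - s)) i j" using assms by (intro transition_ge_product) auto
  finally show ?thesis by simp
qed

text \<open>The sets of states reachable from \<open>i\<close> within time \<open>s\<close> decrease as \<open>s\<close> does, so for small \<open>s\<close>
  they are those reachable within every positive time.  This limit relation is transitive, hence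
  by the Chapman--Kolmogorov equation contains all states that are reachable at all.\<close>

lemma irreducible_transition_pos:
  assumes irr: "\<And>i j. \<exists>t\<ge>0. 0 < p t i j" and s: "0 < s"
  shows "0 < p s i j"
proof -
  define r where "r i j \<longleftrightarrow> (\<forall>s>0. 0 < p s i j)" for i j
  have "\<exists>e>0. \<forall>s. 0 < s \<longrightarrow> s \<le> e \<longrightarrow> 0 < p s i j \<longrightarrow> r i j" for i j
  proof (cases "r i j")
    case False
    then obtain e where e: "e > 0" "\<not> 0 < p e i j" by (auto simp: r_def)
    have "\<not> 0 < p s i j" if "0 < s" "s \<le> e" for s
      using transition_pos_mono[of s i j e] e that by auto
    with e show ?thesis by blast
  qed (auto intro: exI[of _ 1])
  then obtain e where e: "\<And>i j. e i j > 0" "\<And>i j s. 0 < s \<Longrightarrow> s \<le> e i j \<Longrightarrow> 0 < p s i j \<Longrightarrow> r i j"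
    by metis
  define e0 where "e0 = Min (range (\<lambda>(i, j). e i j))"
  have e0: "0 < e0" unfolding e0_def using e(1) by (subst Min_gr_iff) auto
  have e0_le: "e0 \<le> e i j" for i j unfolding e0_def by (rule Min_le) auto
  have r_trans: "r i j" if "r i l" "r l j" for i l j
    unfolding r_def
  proof (intro allI impI)
    fix s :: real assume "s > 0"
    then have "0 < p (s / 2) i l * p (s / 2) l j" using that by (simp add: r_def)
    also have "\<dots> \<le> p (s / 2 + s / 2) i j" using \<open>s > 0\<close> by (intro transition_ge_product) auto
    finally show "0 < p s i j" by simp
  qed
  have steps: "r i j" if "0 < h" "h \<le> e0" "0 < p (real (Suc n) * h) i j" for n h i j
    using that(3)
  proof (induction n arbitrary: j)
    case 0
    then show ?case using e(2)[of h i j] e0_le[of i j] that by simp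
  next
    case (Suc n)
    have "real (Suc (Suc n)) * h = real (Suc n) * h + h" by (simp add: algebra_simps)
    then have "0 < (\<Sum>l\<in>UNIV. p (real (Suc n) * h) i l * p h l j)"
      using Suc.prems transition_add[of "real (Suc n) * h" h i j] that by simp
    then obtain l where l: "0 < p (real (Suc n) * h) i l * p h l j"
      by (meson not_less sum_nonpos)
    have "0 \<le> p (real (Suc n) * h) i l" "0 \<le> p h l j" using that by (auto intro!: transition_nonneg)
    with l have "0 < p (real (Suc n) * h) i l" "0 < p h l j"
      by (auto simp: zero_less_mult_iff)
    then have "r i l" "r l j" using Suc.IH e(2)[of h l j] e0_le[of l j] that by auto
    then show ?case by (rule r_trans)
  qed
  obtain t where t: "t \<ge> 0" "0 < p t i j" using irr by blast
  show ?thesis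
  proof (cases "t = 0")
    case True
    then have "i = j" using t by (simp add: transition_zero split: if_splits)
    then show ?thesis using transition_diag_pos[of s] s by simp
  next
    case False
    obtain n :: nat where n: "t / e0 < real n" using reals_Archimedean2 by blast
    \<comment> \<open>Cutting \<open>t\<close> into \<open>n + 1\<close> equal parts makes every part at most \<open>e0\<close>, also for \<open>n = 0\<close>.\<close>
    define h where "h = t / real (Suc n)"
    have "t < e0 * real n" using n e0 by (simp add: divide_less_eq mult.commute)
    also have "\<dots> \<le> e0 * real (Suc n)" using e0 by simp
    finally have "h \<le> e0" by (simp add: h_def divide_le_eq)
    moreover have "0 < h" using False t by (simp add: h_def)
    moreover have "real (Suc n) * h = t" by (simp add: h_def)
    ultimately have "r i j" using steps[of h n i j] t by simp
    then show ?thesis using s by (simp add: r_def)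
  qed
qed

end

section \<open>Paths that stay in one state\<close>

context regime_switching_space
begin

text \<open>The probability factorises along the grid: given that all earlier grid points are spent in \<open>i\<close>, the
  next one is with probability \<open>p h i i\<close>.\<close>

lemma prob_stay_grid:
  assumes p: "transition_function \<pi> p"
    and markov: "\<And>s t j Y. 0 \<le> s \<Longrightarrow> 0 \<le> t \<Longrightarrow> Y \<in> borel_measurable (\<F> s) \<Longrightarrow> integrable M Y \<Longrightarrow>
       expectation (\<lambda>\<omega>. Y \<omega> * of_bool (\<alpha> (s + t) \<omega> = j)) = expectation (\<lambda>\<omega>. Y \<omega> * p t (\<alpha> s \<omega>) j)"
    and s: "0 \<le> s" "0 \<le> h"
  shows "{\<omega>\<in>space M. \<forall>m\<le>n. \<alpha> (s + real m * h) \<omega> = i} \<in> sets (\<F> (s + real n * h)) \<and>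
    prob {\<omega>\<in>space M. \<forall>m\<le>n. \<alpha> (s + real m * h) \<omega> = i} = p s i\<^sub>0 i * p h i i ^ n"
proof (induction n)
  case 0
  have E: "{\<omega>\<in>space M. \<forall>m\<le>0::nat. \<alpha> (s + real m * h) \<omega> = i} = \<alpha> s -` {i} \<inter> space (\<F> s)" by auto
  have Es: "\<alpha> s -` {i} \<inter> space (\<F> s) \<in> sets (\<F> s)"
    using s by (intro measurable_sets[OF measurable_chain_filtr]) auto
  have "prob (\<alpha> s -` {i} \<inter> space (\<F> s)) = expectation (indicator (\<alpha> s -` {i} \<inter> space (\<F> s)))"
    using subsetD[OF filtr_subset Es] by simp
  also have "\<dots> = expectation (\<lambda>\<omega>. 1 * of_bool (\<alpha> (0 + s) \<omega> = i))"
    by (intro Bochner_Integration.integral_cong) (auto simp: indicator_def)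
  also have "\<dots> = expectation (\<lambda>\<omega>. 1 * p s (\<alpha> 0 \<omega>) i)"
    using s by (intro markov) auto
  also have "\<dots> = expectation (\<lambda>\<omega>. p s i\<^sub>0 i)"
    by (intro Bochner_Integration.integral_cong) (auto simp: chain_zero)
  finally have "prob (\<alpha> s -` {i} \<inter> space (\<F> s)) = p s i\<^sub>0 i" by (simp add: prob_space)
  then show ?case using Es unfolding E by simp
next
  case (Suc n)
  define E where "E = {\<omega>\<in>space M. \<forall>m\<le>n. \<alpha> (s + real m * h) \<omega> = i}"
  have E: "E \<in> sets (\<F> (s + real n * h))" and pE: "prob E = p s i\<^sub>0 i * p h i i ^ n"
    using conjunct1[OF Suc.IH] conjunct2[OF Suc.IH] unfolding E_def .
  have EM: "E \<in> sets M" by (rule subsetD[OF filtr_subset E])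
  define t where "t = s + real n * h"
  have t: "0 \<le> t" using s by (simp add: t_def)
  have t': "s + real (Suc n) * h = t + h" by (simp add: t_def algebra_simps)
  have E': "{\<omega>\<in>space M. \<forall>m\<le>Suc n. \<alpha> (s + real m * h) \<omega> = i} = E \<inter> (\<alpha> (t + h) -` {i} \<inter> space (\<F> (t + h)))"
    unfolding E_def t'[symmetric] by (auto simp: le_Suc_eq)
  have "E \<in> sets (\<F> (t + h))"
    using E filtr_mono[of t "t + h"] s by (auto simp: t_def)
  moreover have Z: "\<alpha> (t + h) -` {i} \<inter> space (\<F> (t + h)) \<in> sets (\<F> (t + h))"
    using s t by (intro measurable_sets[OF measurable_chain_filtr]) auto
  ultimately have mem: "E \<inter> (\<alpha> (t + h) -` {i} \<inter> space (\<F> (t + h))) \<in> sets (\<F> (t + h))" by (rule sets.Int)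
  have "prob (E \<inter> (\<alpha> (t + h) -` {i} \<inter> space (\<F> (t + h))))
     = expectation (indicator (E \<inter> (\<alpha> (t + h) -` {i} \<inter> space (\<F> (t + h)))))"
    using subsetD[OF filtr_subset mem] by simp
  also have "\<dots> = expectation (\<lambda>\<omega>. indicator E \<omega> * of_bool (\<alpha> (t + h) \<omega> = i))"
    by (intro Bochner_Integration.integral_cong) (auto simp: indicator_def)
  also have "\<dots> = expectation (\<lambda>\<omega>. indicator E \<omega> * p h (\<alpha> t \<omega>) i)"
  proof (rule markov[OF t s(2)])
    show "(indicator E :: 'w \<Rightarrow> real) \<in> borel_measurable (\<F> t)" using E by (simp add: t_def)
    show "integrable M (indicator E :: 'w \<Rightarrow> real)"
      using EM by (intro integrable_const_bound[where B=1]) (auto simp: indicator_def)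
  qed
  also have "\<dots> = expectation (\<lambda>\<omega>. p h i i * indicator E \<omega>)"
  proof (intro Bochner_Integration.integral_cong refl)
    have at: "\<alpha> t \<omega> = i" if "\<omega> \<in> E" for \<omega> using that unfolding E_def t_def by blast
    show "indicator E \<omega> * p h (\<alpha> t \<omega>) i = p h i i * indicator E \<omega>" for \<omega>
      by (cases "\<omega> \<in> E") (simp_all add: at)
  qed
  also have "\<dots> = p h i i * prob E" using EM by simp
  finally have pr: "prob (E \<inter> (\<alpha> (t + h) -` {i} \<inter> space (\<F> (t + h)))) = p h i i * prob E" .
  have "p h i i * (p s i\<^sub>0 i * p h i i ^ n) = p s i\<^sub>0 i * p h i i ^ Suc n" by (simp add: mult_ac)
  then show ?case unfolding E' t' using mem pr pE by (simp only: simp_thms)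
qed

text \<open>Dyadic grid points lie arbitrarily close to the right of every time, where the path agrees with
  its value at that time.\<close>

lemma path_const_of_grid:
  assumes \<omega>: "\<omega> \<in> space M" and s: "0 \<le> s" "s < T"
    and grid: "\<And>n m. m \<le> 2 ^ n \<Longrightarrow> \<alpha> (s + real m * ((T - s) / 2 ^ n)) \<omega> = i"
    and r: "s \<le> r" "r \<le> T"
  shows "\<alpha> r \<omega> = i"
proof (cases "r = T")
  case True
  then show ?thesis using grid[of 1 0] by simp
next
  case False
  have "\<forall>\<^sub>F u in at_right r. \<alpha> u \<omega> = \<alpha> r \<omega>"
    using cadlag_chain[OF \<omega>] r s by (simp add: cadlag_path_def)
  then obtain b where b: "b > r" "\<And>u. r < u \<Longrightarrow> u < b \<Longrightarrow> \<alpha> u \<omega> = \<alpha> r \<omega>"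
    by (auto simp: eventually_at_right_field)
  define e where "e = min b T - r"
  have e: "e > 0" using b False r by (simp add: e_def)
  obtain n where n: "(T - s) / e < 2 ^ n" using real_arch_pow[of 2 "(T - s) / e"] by auto
  define h where "h = (T - s) / 2 ^ n"
  have h: "0 < h" "h < e" using n e s by (simp_all add: h_def divide_less_eq mult.commute)
  define m where "m = nat (\<lfloor>(r - s) / h\<rfloor> + 1)"
  have fl: "0 \<le> \<lfloor>(r - s) / h\<rfloor>" using r h by simp
  have m: "real m = real_of_int \<lfloor>(r - s) / h\<rfloor> + 1" using fl by (simp add: m_def)
  have "(r - s) / h < real m" unfolding m by linarith
  then have lo: "r < s + real m * h" using h by (simp add: divide_less_eq)
  have "real m \<le> (r - s) / h + 1" unfolding m by linarith
  then have "real m * h \<le> (r - s) + h" using h by (simp add: field_simps)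
  then have hi: "s + real m * h < min b T" using h(2) unfolding e_def by linarith
  then have "real m * h < T - s" by simp
  moreover have "T - s = 2 ^ n * h" by (simp add: h_def)
  ultimately have "real m < 2 ^ n" using h(1) by simp
  then have "m \<le> 2 ^ n" by (metis less_imp_le of_nat_less_iff of_nat_numeral of_nat_power)
  then have "\<alpha> (s + real m * h) \<omega> = i" unfolding h_def by (rule grid)
  then show ?thesis using b(2)[OF lo] hi by simp
qed

text \<open>An almost sure property can be tested on a path that rests in a prescribed state \<open>i\<close> during
  \<open>[s,T]\<close>, since such paths have positive probability: being in \<open>i\<close> at all points of the grid of mesh
  \<open>h = (T - s) / 2 ^ n\<close> has probability at least \<open>p s i\<^sub>0 i * (1 - c * h) ^ 2 ^ n\<close>, which tends to the positive
  number \<open>p s i\<^sub>0 i * exp (- c * (T - s))\<close>.\<close>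

lemma AE_stay_witness:
  assumes s: "0 < s" "s < T" and ae: "AE \<omega> in M. P \<omega>"
  shows "\<exists>\<omega>\<in>space M. P \<omega> \<and> (\<forall>r\<in>{s..T}. \<alpha> r \<omega> = i)"
proof (rule markov_property)
  fix p assume p: "transition_function \<pi> p" and irr: "\<And>i j. \<exists>t\<ge>0. 0 < p t i j"
    and markov: "\<And>s t j Y. 0 \<le> s \<Longrightarrow> 0 \<le> t \<Longrightarrow> Y \<in> borel_measurable (\<F> s) \<Longrightarrow> integrable M Y \<Longrightarrow>
       expectation (\<lambda>\<omega>. Y \<omega> * of_bool (\<alpha> (s + t) \<omega> = j)) = expectation (\<lambda>\<omega>. Y \<omega> * p t (\<alpha> s \<omega>) j)"
  define L where "L = T - s"
  have L: "L > 0" using s by (simp add: L_def)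
  define E where "E n = {\<omega>\<in>space M. \<forall>m\<le>2 ^ n. \<alpha> (s + real m * (L / 2 ^ n)) \<omega> = i}" for n :: nat
  have E: "E n \<in> sets M" "prob (E n) = p s i\<^sub>0 i * p (L / 2 ^ n) i i ^ (2 ^ n)" for n
  proof -
    have "E n \<in> sets (\<F> (s + real (2 ^ n) * (L / 2 ^ n))) \<and> prob (E n) = p s i\<^sub>0 i * p (L / 2 ^ n) i i ^ (2 ^ n)"
      unfolding E_def
      by (rule prob_stay_grid[OF p], rule markov, assumption+) (use s L in simp_all)
    then show "E n \<in> sets M" "prob (E n) = p s i\<^sub>0 i * p (L / 2 ^ n) i i ^ (2 ^ n)"
      by (auto intro: subsetD[OF filtr_subset])
  qed
  have dec: "decseq E"
  proof (rule decseq_SucI, rule subsetI)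
    fix n \<omega> assume w: "\<omega> \<in> E (Suc n)"
    have "\<alpha> (s + real m * (L / 2 ^ n)) \<omega> = i" if "m \<le> 2 ^ n" for m
    proof -
      have "2 * m \<le> 2 ^ Suc n" using that by simp
      then have "\<alpha> (s + real (2 * m) * (L / 2 ^ Suc n)) \<omega> = i" using w unfolding E_def by blast
      then show ?thesis by simp
    qed
    then show "\<omega> \<in> E n" using w by (simp add: E_def)
  qed
  have lim: "(\<lambda>n. prob (E n)) \<longlonglongrightarrow> prob (\<Inter>n. E n)"
    using E(1) dec by (intro finite_Lim_measure_decseq) auto
  obtain c h0 where c: "0 < c" "0 < h0" "\<And>h. 0 < h \<Longrightarrow> h < h0 \<Longrightarrow> 1 - c * h < p h i i"
    using transition_diag_linear_bound[OF p, of i] by blast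
  have ps: "0 < p s i\<^sub>0 i" by (rule irreducible_transition_pos[OF p irr s(1)])
  have pow2: "filterlim (\<lambda>n. 2 ^ n :: nat) sequentially sequentially"
    by (rule filterlim_subseq) (simp add: strict_mono_def)
  have "(\<lambda>N. (1 + (- (c * L)) / real N) ^ N) \<longlonglongrightarrow> exp (- (c * L))"
    by (rule tendsto_exp_limit_sequentially)
  from filterlim_compose[OF this pow2]
  have "(\<lambda>n. (1 + (- (c * L)) / 2 ^ n) ^ (2 ^ n)) \<longlonglongrightarrow> exp (- (c * L))" by simp
  then have low: "(\<lambda>n. p s i\<^sub>0 i * (1 + (- (c * L)) / 2 ^ n) ^ (2 ^ n)) \<longlonglongrightarrow> p s i\<^sub>0 i * exp (- (c * L))"
    by (intro tendsto_intros)
  have h_lim: "(\<lambda>n. L / 2 ^ n) \<longlonglongrightarrow> 0"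
    using tendsto_mult[OF tendsto_const LIMSEQ_realpow_zero[of "1 / 2"], of L] by (simp add: power_divide)
  have "p s i\<^sub>0 i * exp (- (c * L)) \<le> prob (\<Inter>n. E n)"
  proof (rule tendsto_le[OF _ lim low])
    have "\<forall>\<^sub>F n in sequentially. L / 2 ^ n < min h0 (1 / c)"
      using c by (intro order_tendstoD[OF h_lim]) simp
    then show "\<forall>\<^sub>F n in sequentially. p s i\<^sub>0 i * (1 + (- (c * L)) / 2 ^ n) ^ (2 ^ n) \<le> prob (E n)"
    proof eventually_elim
      case (elim n)
      define h where "h = L / 2 ^ n"
      have h: "0 < h" "h < h0" "h < 1 / c" using elim L by (simp_all add: h_def)
      then have "c * h < 1" using c(1) by (simp add: field_simps)
      with c(3)[OF h(1,2)] have "1 - c * h \<le> p h i i" "0 \<le> 1 - c * h" by auto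
      then have "(1 - c * h) ^ (2 ^ n) \<le> p h i i ^ (2 ^ n)" by (intro power_mono)
      then show ?case using ps by (simp add: E h_def)
    qed
  qed simp
  then have pos: "0 < prob (\<Inter>n. E n)" using ps by (meson exp_gt_zero mult_pos_pos order_less_le_trans)
  have "\<exists>\<omega>\<in>space M. P \<omega> \<and> \<omega> \<in> (\<Inter>n. E n)"
  proof (rule ccontr)
    assume "\<not> ?thesis"
    then have "AE \<omega> in M. \<omega> \<notin> (\<Inter>n. E n)" using ae AE_space by (auto elim: eventually_elim2)
    then have "prob (\<Inter>n. E n) = 0"
      using E(1) by (intro prob_eq_0[THEN iffD2]) auto
    with pos show False by simp
  qed
  then obtain \<omega> where w: "\<omega> \<in> space M" "P \<omega>" "\<And>n. \<omega> \<in> E n" by blast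
  have "\<alpha> r \<omega> = i" if "r \<in> {s..T}" for r
  proof (rule path_const_of_grid[OF w(1) less_imp_le[OF s(1)] s(2)])
    show "m \<le> 2 ^ n \<Longrightarrow> \<alpha> (s + real m * ((T - s) / 2 ^ n)) \<omega> = i" for n m
      using w(3)[of n] by (simp add: E_def L_def)
  qed (use that in auto)
  with w show ?thesis by blast
qed

section \<open>Compensators between jumps\<close>

lemma measurable_path:
  assumes "\<omega> \<in> space M"
  shows "{r. \<alpha> (max 0 r) \<omega> = i} \<in> sets borel"
proof -
  have "(\<lambda>r. (r, \<omega>)) \<in> measurable borel (borel \<Otimes>\<^sub>M M)" using assms by (intro measurable_Pair) auto
  from measurable_compose[OF this measurable_chain_joint]
  have "(\<lambda>r. \<alpha> (max 0 r) \<omega>) \<in> measurable borel (count_space UNIV)" by simp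
  from measurable_sets[OF this, of "{i}"] show ?thesis by (simp add: vimage_def)
qed

lemma measurable_left_path:
  assumes \<omega>: "\<omega> \<in> space M"
  shows "{r\<in>{0..}. left_state \<alpha> r \<omega> = i} \<in> sets borel"
proof -
  define J where "J = {s. 0 < s \<and> left_state \<alpha> s \<omega> \<noteq> \<alpha> s \<omega>} \<union> {0}"
  have J: "countable J"
    using countable_jumps[where \<alpha>=\<alpha> and \<omega>=\<omega>, OF cadlag_chain[OF \<omega>]] by (simp add: J_def)
  have "{r\<in>{0..}. left_state \<alpha> r \<omega> = i}
     = ({r. \<alpha> (max 0 r) \<omega> = i} \<inter> {0..} - J) \<union> (J \<inter> {r\<in>{0..}. left_state \<alpha> r \<omega> = i})"
    by (auto simp: J_def max_def)
  also have "\<dots> \<in> sets borel"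
  proof (rule sets.Un)
    have "J \<in> sets borel" by (rule sets.countable[OF _ J]) simp
    then show "{r. \<alpha> (max 0 r) \<omega> = i} \<inter> {0..} - J \<in> sets borel"
      by (intro sets.Diff sets.Int measurable_path[OF \<omega>]) auto
    show "J \<inter> {r\<in>{0..}. left_state \<alpha> r \<omega> = i} \<in> sets borel"
      by (rule sets.countable[OF _ countable_Int1[OF J]]) simp
  qed
  finally show ?thesis .
qed

end

lemma set_integrable_indicator_mult:
  fixes f :: "real \<Rightarrow> 'v::euclidean_space"
  assumes "set_integrable lborel A f" "B \<in> sets borel"
  shows "set_integrable lborel A (\<lambda>r. indicator B r *\<^sub>R f r)"
proof -
  have eq: "(\<lambda>r. indicator A r *\<^sub>R (indicator B r *\<^sub>R f r)) = (\<lambda>r. indicator B r *\<^sub>R (indicator A r *\<^sub>R f r))"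
    by (simp add: mult.commute)
  show ?thesis
    unfolding set_integrable_def eq
    using assms by (intro integrable_mult_indicator[of B]) (simp_all only: set_integrable_def sets_lborel)
qed

lemma Linf_set_integrable:
  fixes f :: "real \<Rightarrow> 'v::euclidean_space"
  assumes "f \<in> Linf T V"
  shows "set_integrable lborel {0..T} f"
proof -
  obtain c where c: "AE t in lborel. t \<in> {0..T} \<longrightarrow> f t \<in> V \<and> norm (f t) \<le> c"
    and m: "f \<in> borel_measurable (restrict_space borel {0..T})"
    using assms by (auto simp: Linf_def)
  have m': "(\<lambda>t. indicator {0..T} t *\<^sub>R f t) \<in> borel_measurable borel"
    by (rule iffD1[OF borel_measurable_restrict_space_iff m]) simp
  have "integrable lborel (\<lambda>t. indicator {0..T} t *\<^sub>R (indicator {0..T} t *\<^sub>R f t))"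
  proof (rule integrableI_bounded_set_indicator[where B=c])
    show "AE t in lborel. t \<in> {0..T} \<longrightarrow> norm (indicator {0..T} t *\<^sub>R f t) \<le> c"
      using c by eventually_elim auto
  qed (use m' in \<open>auto simp: emeasure_lborel_Icc_eq\<close>)
  moreover have "(\<lambda>t. indicator {0..T} t *\<^sub>R (indicator {0..T} t *\<^sub>R f t)) = (\<lambda>t. indicator {0..T} t *\<^sub>R f t)"
    by (auto simp: indicator_def)
  ultimately show ?thesis by (simp only: set_integrable_def)
qed

context regime_switching_space
begin

text \<open>While the chain rests, the counting measure of its jumps from \<open>i\<close> to \<open>j\<close> has no mass.\<close>

lemma jump_integral_const:
  fixes f :: "real \<Rightarrow> 'v::euclidean_space"
  assumes \<omega>: "\<omega> \<in> space M" and ij: "i \<noteq> j" and st: "0 \<le> s" "s \<le> t" "t \<le> T"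
    and const: "\<And>r. r \<in> {s..t} \<Longrightarrow> \<alpha> r \<omega> = l"
    and f: "f \<in> borel_measurable (restrict_space borel {0..T})"
  shows "(LINT r:{0<..t}|interval_measure (\<lambda>r. jump_count \<alpha> i j r \<omega>). f r)
    = (LINT r:{0<..s}|interval_measure (\<lambda>r. jump_count \<alpha> i j r \<omega>). f r)"
proof -
  let ?F = "\<lambda>r. jump_count \<alpha> i j r \<omega>"
  define S where "S r = {u\<in>{0<..r}. left_state \<alpha> u \<omega> = i \<and> \<alpha> u \<omega> = j}" for r
  have F: "?F r = real (card (S r))" for r by (simp add: jump_count_def S_def)
  have fin: "finite (S r)" for r
    by (rule finite_subset[OF _ finite_jumps[where \<alpha>=\<alpha> and \<omega>=\<omega>, OF cadlag_chain[OF \<omega>], of r]])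
      (use ij in \<open>auto simp: S_def\<close>)
  have mono: "?F r \<le> ?F u" if "r \<le> u" for r u
    unfolding F using that by (simp, intro card_mono fin) (auto simp: S_def)
  have still: "S u = S r" if "r \<le> u" and const: "\<And>v. r \<le> v \<Longrightarrow> v \<le> u \<Longrightarrow> \<alpha> v \<omega> = m" for r u m
  proof -
    have "v \<le> r" if "v \<in> S u" for v
    proof (rule ccontr)
      assume "\<not> v \<le> r"
      then have "left_state \<alpha> v \<omega> = m" "\<alpha> v \<omega> = m"
        using const that by (auto simp: S_def intro!: left_state_eq_of_const[of r])
      then show False using that ij by (auto simp: S_def)
    qed
    then show ?thesis using \<open>r \<le> u\<close> by (force simp: S_def)
  qed
  have right: "continuous (at_right r) ?F" for r
  proof -
    have "\<exists>b>r. \<forall>u. r < u \<longrightarrow> u < b \<longrightarrow> ?F u = ?F r"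
    proof (cases "0 \<le> r")
      case True
      then have "\<forall>\<^sub>F u in at_right r. \<alpha> u \<omega> = \<alpha> r \<omega>"
        using cadlag_chain[OF \<omega>] by (simp add: cadlag_path_def)
      then obtain b where b: "b > r" "\<And>u. r < u \<Longrightarrow> u < b \<Longrightarrow> \<alpha> u \<omega> = \<alpha> r \<omega>"
        by (auto simp: eventually_at_right_field)
      have "?F u = ?F r" if "r < u" "u < b" for u
      proof -
        have "\<alpha> v \<omega> = \<alpha> r \<omega>" if "r \<le> v" "v \<le> u" for v
          using b(2)[of v] that \<open>u < b\<close> by (cases "v = r") auto
        from still[of r u, OF less_imp_le[OF \<open>r < u\<close>] this] show ?thesis by (simp add: F)
      qed
      then show ?thesis using b(1) by blast
    next
      case False
      then have z: "?F u = ?F r" if "u < 0" for u using that by (simp add: F S_def)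
      show ?thesis
        by (intro exI[of _ 0] conjI allI impI) (use False in simp, rule z)
    qed
    then have "\<forall>\<^sub>F u in at_right r. ?F r = ?F u" unfolding eventually_at_right_field by metis
    then have "(?F \<longlongrightarrow> ?F r) (at_right r)" by (rule Lim_transform_eventually[OF tendsto_const])
    then show ?thesis by (simp add: continuous_within)
  qed
  have "S t = S s" using const st by (intro still[of s t l]) auto
  then have "emeasure (interval_measure ?F) {s<..t} = 0"
    using emeasure_interval_measure_Ioc[of s t ?F, OF st(2) mono right] by (simp add: F)
  then have null: "AE r in interval_measure ?F. r \<notin> {s<..t}"
    by (intro AE_not_in) (auto simp: null_sets_def)
  have sets: "set_borel_measurable (interval_measure ?F) {0<..u} f" if "u \<le> T" for u
  proof -
    have "(\<lambda>r. indicator {0..T} r *\<^sub>R f r) \<in> borel_measurable borel"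
      by (rule iffD1[OF borel_measurable_restrict_space_iff f]) simp
    then have "(\<lambda>r. indicator {0<..u} r *\<^sub>R (indicator {0..T} r *\<^sub>R f r)) \<in> borel_measurable borel"
      by (rule borel_measurable_scaleR[rotated]) simp
    also have "(\<lambda>r. indicator {0<..u} r *\<^sub>R (indicator {0..T} r *\<^sub>R f r)) = (\<lambda>r. indicator {0<..u} r *\<^sub>R f r)"
      using that by (auto simp: indicator_def)
    finally show ?thesis by (simp add: set_borel_measurable_def)
  qed
  show ?thesis
  proof (rule set_integral_cong_set)
    show "AE r in interval_measure ?F. (r \<in> {0<..s}) = (r \<in> {0<..t})"
      using null by eventually_elim (use st in auto)
  qed (use sets st in auto)
qed

text \<open>The defining identity of the compensator holds along almost every path and so along one that rests
  in \<open>i\<close> during \<open>[s,T]\<close>.  There the jump integrals are constant and the two drift terms that carry the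
  generator cancel, so only the term with \<open>\<Theta>\<close> changes.  Varying \<open>i\<close> yields \<open>K\<close> in every regime from an
  identity for \<open>K\<close> in the current regime.\<close>

lemma compensator_increment:
  fixes K \<Theta> :: "real \<Rightarrow> 'd \<Rightarrow> real ^ 'n ^ 'n"
  assumes U: "Upsilon M W \<alpha> \<pi> i\<^sub>0 T K \<Theta>" and st: "0 < s" "s \<le> t" "t \<le> T"
  shows "K t i - K s i = (LINT r:{s<..t}|lborel. \<Theta> r i)"
proof (cases "s = t")
  case True
  then show ?thesis by (simp add: set_lebesgue_integral_def)
next
  case False
  have K: "(\<lambda>t. K t i) \<in> Linf T sym_mats" and \<Theta>: "(\<lambda>t. \<Theta> t i) \<in> Linf T sym_mats" for i
    using U by (auto simp: Upsilon_def)
  define g where "g = (\<lambda>\<omega> (i, j) r. (\<pi> i j * of_bool (left_state \<alpha> r \<omega> = i)) *\<^sub>R (K r j - K r i))"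
  define J where "J = (\<lambda>\<omega> (i, j) t. LINT r:{0<..t}|interval_measure (\<lambda>r. jump_count \<alpha> i j r \<omega>). K r j - K r i)"
  define D where "D = {(i :: 'd, j). i \<noteq> j}"
  define good where "good \<omega> \<longleftrightarrow> (\<forall>t\<in>{0..T}.
        K t (\<alpha> t \<omega>) = K 0 i\<^sub>0 + (LINT s:{0..t}|lborel. \<Theta> s (\<alpha> s \<omega>))
          + (LINT s:{0..t}|lborel. \<Sum>(i, j)\<in>{(i, j). i \<noteq> j}.
               (\<pi> i j * of_bool (left_state \<alpha> s \<omega> = i)) *\<^sub>R (K s j - K s i))
          + (\<Sum>(i, j)\<in>{(i, j). i \<noteq> j}.
               compensated_integral \<alpha> \<pi> i j (\<lambda>s. K s j - K s i) t \<omega>))" for \<omega>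
  have "AE \<omega> in M. good \<omega>"
    using U unfolding Upsilon_def good_def by (elim conjE)
  moreover have "s < T" using st False by simp
  ultimately have "\<exists>\<omega>\<in>space M. good \<omega> \<and> (\<forall>r\<in>{s..T}. \<alpha> r \<omega> = i)"
    using st(1) by (intro AE_stay_witness)
  then obtain \<omega> where \<omega>: "\<omega> \<in> space M" and good: "good \<omega>" and stay: "\<And>r. r \<in> {s..T} \<Longrightarrow> \<alpha> r \<omega> = i"
    by blast
  note eq = good[unfolded good_def, rule_format]
  have g_int: "set_integrable lborel {0..u} (g \<omega> q)" if "u \<le> T" for u q
  proof -
    obtain i j where [simp]: "q = (i, j)" by (cases q)
    have "set_integrable lborel {0..T} (\<lambda>r. K r j - K r i)"
      by (intro set_integral_diff Linf_set_integrable[OF K])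
    from set_integrable_indicator_mult[OF this measurable_left_path[OF \<omega>, of i]]
    have "set_integrable lborel {0..T} (\<lambda>r. \<pi> i j *\<^sub>R (indicator {r\<in>{0..}. left_state \<alpha> r \<omega> = i} r *\<^sub>R (K r j - K r i)))"
      by (intro set_integrable_scaleR_right)
    also have "?this \<longleftrightarrow> set_integrable lborel {0..T} (g \<omega> q)"
    proof (intro set_integrable_cong refl)
      fix r assume "r \<in> {0..T}"
      then show "\<pi> i j *\<^sub>R (indicator {r\<in>{0..}. left_state \<alpha> r \<omega> = i} r *\<^sub>R (K r j - K r i)) = g \<omega> q r"
        by (cases "left_state \<alpha> r \<omega> = i") (simp_all add: g_def)
    qed
    finally show ?thesis by (rule set_integrable_subset) (use that in simp_all)
  qed
  have \<Theta>_int: "set_integrable lborel {0..u} (\<lambda>r. \<Theta> r (\<alpha> r \<omega>))" if "u \<le> T" for u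
  proof -
    have "set_integrable lborel {0..T} (\<lambda>r. \<Sum>j\<in>UNIV. indicator {r. \<alpha> (max 0 r) \<omega> = j} r *\<^sub>R \<Theta> r j)"
      unfolding set_integrable_def scaleR_sum_right
      by (intro Bochner_Integration.integrable_sum)
        (use set_integrable_indicator_mult[OF Linf_set_integrable[OF \<Theta>] measurable_path[OF \<omega>]]
          in \<open>simp add: set_integrable_def\<close>)
    also have "?this \<longleftrightarrow> set_integrable lborel {0..T} (\<lambda>r. \<Theta> r (\<alpha> r \<omega>))"
    proof (intro set_integrable_cong refl)
      fix r assume "r \<in> {0..T}"
      then have "(\<Sum>j\<in>UNIV. indicator {r. \<alpha> (max 0 r) \<omega> = j} r *\<^sub>R \<Theta> r j)
         = (\<Sum>j\<in>UNIV. if j = \<alpha> r \<omega> then \<Theta> r (\<alpha> r \<omega>) else 0)"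
        by (intro sum.cong) (auto simp: indicator_def max_def)
      then show "(\<Sum>j\<in>UNIV. indicator {r. \<alpha> (max 0 r) \<omega> = j} r *\<^sub>R \<Theta> r j) = \<Theta> r (\<alpha> r \<omega>)" by simp
    qed
    finally show ?thesis by (rule set_integrable_subset) (use that in simp_all)
  qed
  have form: "K u i = K 0 i\<^sub>0 + (LINT r:{0..u}|lborel. \<Theta> r (\<alpha> r \<omega>)) + (\<Sum>q\<in>D. J \<omega> q u)"
    if u: "u \<in> {s..T}" for u
  proof -
    have uT: "u \<in> {0..T}" "u \<le> T" using u st by auto
    have "(LINT r:{0..u}|lborel. \<Sum>(i, j)\<in>{(i, j). i \<noteq> j}.
               (\<pi> i j * of_bool (left_state \<alpha> r \<omega> = i)) *\<^sub>R (K r j - K r i))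
       = (LINT r:{0..u}|lborel. \<Sum>q\<in>D. g \<omega> q r)"
      by (simp add: g_def D_def case_prod_beta')
    also have "\<dots> = (\<Sum>q\<in>D. LINT r:{0..u}|lborel. g \<omega> q r)"
      unfolding set_lebesgue_integral_def scaleR_sum_right
      using g_int[OF uT(2)] by (intro Bochner_Integration.integral_sum) (simp add: set_integrable_def)
    finally have 1: "(LINT r:{0..u}|lborel. \<Sum>(i, j)\<in>{(i, j). i \<noteq> j}.
               (\<pi> i j * of_bool (left_state \<alpha> r \<omega> = i)) *\<^sub>R (K r j - K r i)) = (\<Sum>q\<in>D. LINT r:{0..u}|lborel. g \<omega> q r)" .
    have 2: "(\<Sum>(i, j)\<in>{(i, j). i \<noteq> j}. compensated_integral \<alpha> \<pi> i j (\<lambda>s. K s j - K s i) u \<omega>)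
       = (\<Sum>q\<in>D. J \<omega> q u - (LINT r:{0..u}|lborel. g \<omega> q r))"
      unfolding D_def by (intro sum.cong) (auto simp: compensated_integral_def J_def g_def)
    show ?thesis using eq[OF uT(1)] stay[OF u] unfolding 1 2 by (simp add: sum_subtractf)
  qed
  have "J \<omega> q t = J \<omega> q s" if "q \<in> D" for q
  proof -
    obtain a b where q: "q = (a, b)" by (cases q)
    have "a \<noteq> b" using that q by (simp add: D_def)
    moreover have "(\<lambda>r. K r b - K r a) \<in> borel_measurable (restrict_space borel {0..T})"
      using K[of a] K[of b] by (intro borel_measurable_diff) (auto simp: Linf_def)
    ultimately have "(LINT r:{0<..t}|interval_measure (\<lambda>r. jump_count \<alpha> a b r \<omega>). K r b - K r a)
      = (LINT r:{0<..s}|interval_measure (\<lambda>r. jump_count \<alpha> a b r \<omega>). K r b - K r a)"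
      using st stay by (intro jump_integral_const[OF \<omega>, where l=i and T=T]) auto
    then show ?thesis by (simp add: J_def q)
  qed
  then have "K t i - K s i = (LINT r:{0..t}|lborel. \<Theta> r (\<alpha> r \<omega>)) - (LINT r:{0..s}|lborel. \<Theta> r (\<alpha> r \<omega>))"
    using form[of t] form[of s] st by simp
  also have "\<dots> = (LINT r:{s<..t}|lborel. \<Theta> r (\<alpha> r \<omega>))"
    using set_integral_split[OF _ st(2) \<Theta>_int[OF st(3)]] st by simp
  also have "\<dots> = (LINT r:{s<..t}|lborel. \<Theta> r i)"
    unfolding set_lebesgue_integral_def using st stay
    by (intro Bochner_Integration.integral_cong) (auto simp: indicator_def)
  finally show ?thesis .
qed

end

section \<open>The lower bound for the cost\<close>

lemma sum_UNIV_plus: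
  fixes g :: "'a::finite + 'b::finite \<Rightarrow> real"
  shows "sum g UNIV = (\<Sum>i\<in>UNIV. g (Inl i)) + (\<Sum>j\<in>UNIV. g (Inr j))"
  by (simp add: UNIV_Plus_UNIV[symmetric] sum.Plus del: UNIV_Plus_UNIV)

lemma block_mat_form:
  "stack x u \<bullet> (block_mat P L N *v stack x u) = x \<bullet> (P *v x) + 2 * (x \<bullet> (L *v u)) + u \<bullet> (N *v u)"
proof -
  have 1: "(block_mat P L N *v stack x u) $ Inl i = (P *v x) $ i + (L *v u) $ i" for i
    by (simp add: matrix_vector_mult_def sum_UNIV_plus block_mat_def stack_def)
  have 2: "(block_mat P L N *v stack x u) $ Inr j = (transpose L *v x) $ j + (N *v u) $ j" for j
    by (simp add: matrix_vector_mult_def sum_UNIV_plus block_mat_def stack_def transpose_def)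
  have "stack x u \<bullet> (block_mat P L N *v stack x u) = x \<bullet> (P *v x + L *v u) + u \<bullet> (transpose L *v x + N *v u)"
    by (simp add: inner_vec_def sum_UNIV_plus 1 2) (simp add: stack_def)
  moreover have "u \<bullet> (transpose L *v x) = x \<bullet> (L *v u)"
    by (simp add: dot_lmul_matrix[symmetric] inner_commute)
  ultimately show ?thesis by (simp add: inner_add_right del: transpose_matrix_vector)
qed

lemma inner_transpose_mult: "(x :: real ^ 'n) \<bullet> (transpose A *v y) = (A *v x) \<bullet> (y :: real ^ 'm)"
  by (simp add: dot_lmul_matrix[symmetric] inner_commute)

text \<open>The mixed terms on both sides agree because \<open>K\<close> is symmetric, and the differences \<open>K j - K i\<close> in
  the compensated weight may be replaced by \<open>K j\<close> because the rows of a generator sum to zero.\<close>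

lemma compensated_form:
  fixes x :: "real ^ 'n" and u :: "real ^ 'm" and \<pi> :: "'d::finite \<Rightarrow> 'd \<Rightarrow> real"
  assumes gen: "generator_matrix \<pi>" and sym: "K t i \<in> sym_mats"
  shows "stack x u \<bullet> (block_mat (Q_comp \<pi> A C Q K \<Theta> t i) (S_comp B C D S K t i) (R_comp D R K t i) *v stack x u)
   = stack x u \<bullet> (block_mat (Q t i) (S t i) (R t i) *v stack x u)
     + x \<bullet> (K t i *v (A t i *v x + B t i *v u)) + (A t i *v x + B t i *v u) \<bullet> (K t i *v x)
     + (C t i *v x + D t i *v u) \<bullet> (K t i *v (C t i *v x + D t i *v u))
     + x \<bullet> ((\<Theta> t i + (\<Sum>j\<in>UNIV. \<pi> i j *\<^sub>R K t j)) *v x)"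
proof -
  have swap: "v \<bullet> (K t i *v w) = w \<bullet> (K t i *v v)" for v w
  proof -
    have "transpose (K t i) = K t i" using sym by (simp add: sym_mats_def)
    then show ?thesis using inner_transpose_mult[of v "K t i" w] by (metis inner_commute)
  qed
  have "(\<Sum>j\<in>UNIV. \<pi> i j) = 0"
    using gen by (simp add: generator_matrix_def sum.remove[of UNIV i])
  then have rows: "(\<Sum>j\<in>UNIV. \<pi> i j *\<^sub>R (K t j - K t i)) = (\<Sum>j\<in>UNIV. \<pi> i j *\<^sub>R K t j)"
    by (simp add: scaleR_diff_right sum_subtractf scaleR_sum_left[symmetric])
  have Q: "x \<bullet> (Q_comp \<pi> A C Q K \<Theta> t i *v x) = x \<bullet> (Q t i *v x) + x \<bullet> (K t i *v (A t i *v x))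
     + (A t i *v x) \<bullet> (K t i *v x) + (C t i *v x) \<bullet> (K t i *v (C t i *v x))
     + x \<bullet> ((\<Theta> t i + (\<Sum>j\<in>UNIV. \<pi> i j *\<^sub>R K t j)) *v x)"
    unfolding Q_comp_def rows
    by (simp add: matrix_vector_mult_add_rdistrib inner_add_right inner_transpose_mult
        matrix_vector_mul_assoc[symmetric] del: transpose_matrix_vector)
  have S: "x \<bullet> (S_comp B C D S K t i *v u) = x \<bullet> (S t i *v u) + x \<bullet> (K t i *v (B t i *v u))
     + (C t i *v x) \<bullet> (K t i *v (D t i *v u))"
    unfolding S_comp_def
    by (simp add: matrix_vector_mult_add_rdistrib inner_add_right inner_transpose_mult
        matrix_vector_mul_assoc[symmetric] del: transpose_matrix_vector)
  have R: "u \<bullet> (R_comp D R K t i *v u) = u \<bullet> (R t i *v u) + (D t i *v u) \<bullet> (K t i *v (D t i *v u))"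
    unfolding R_comp_def
    by (simp add: matrix_vector_mult_add_rdistrib inner_add_right inner_transpose_mult
        matrix_vector_mul_assoc[symmetric] del: transpose_matrix_vector)
  show ?thesis
    unfolding block_mat_form Q S R
    using swap[of "B t i *v u" x] swap[of "D t i *v u" "C t i *v x"]
    by (simp add: matrix_vector_right_distrib inner_add_right inner_add_left)
qed

lemma Linf_uniform_bound:
  fixes F :: "real \<Rightarrow> 'd::finite \<Rightarrow> 'v::euclidean_space"
  assumes "\<And>i. (\<lambda>t. F t i) \<in> Linf T V"
  shows "\<exists>c. 0 \<le> c \<and> (AE t in lborel. t \<in> {0..T} \<longrightarrow> (\<forall>i. F t i \<in> V \<and> norm (F t i) \<le> c))"
proof -
  have "\<exists>c. AE t in lborel. t \<in> {0..T} \<longrightarrow> F t i \<in> V \<and> norm (F t i) \<le> c" for i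
    using assms[of i] by (simp add: Linf_def)
  then have "\<exists>c. \<forall>i. AE t in lborel. t \<in> {0..T} \<longrightarrow> F t i \<in> V \<and> norm (F t i) \<le> c i"
    by (intro choice allI)
  then obtain c where c: "\<forall>i. AE t in lborel. t \<in> {0..T} \<longrightarrow> F t i \<in> V \<and> norm (F t i) \<le> c i" ..
  define b where "b = (\<Sum>i\<in>UNIV. \<bar>c i\<bar>)"
  have cb: "c i \<le> b" for i
  proof -
    have "\<bar>c i\<bar> \<le> b" unfolding b_def by (rule member_le_sum) auto
    then show ?thesis by simp
  qed
  have "AE t in lborel. \<forall>i\<in>UNIV. t \<in> {0..T} \<longrightarrow> F t i \<in> V \<and> norm (F t i) \<le> c i"
    using c by (intro AE_finite_allI) (simp_all only: finite)
  then have "AE t in lborel. t \<in> {0..T} \<longrightarrow> (\<forall>i. F t i \<in> V \<and> norm (F t i) \<le> b)"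
  proof eventually_elim
    case (elim t)
    show ?case
    proof (intro impI allI)
      fix i assume "t \<in> {0..T}"
      with elim have "F t i \<in> V" "norm (F t i) \<le> c i" by blast+
      then show "F t i \<in> V \<and> norm (F t i) \<le> b" using cb[of i] by simp
    qed
  qed
  moreover have "0 \<le> b" unfolding b_def by (intro sum_nonneg) auto
  ultimately show ?thesis by (intro exI[of _ b] conjI)
qed

context regime_switching_space
begin

lemma bounded_coefficient:
  fixes F :: "real \<Rightarrow> 'd \<Rightarrow> real ^ 'k ^ 'l"
  assumes "\<And>i. (\<lambda>t. F t i) \<in> Linf T V"
  shows "(\<lambda>z. F (fst z) (\<alpha> (fst z) (snd z))) \<in> borel_measurable (time_space T)"
    and "\<exists>c. AE z in time_space T. norm (F (fst z) (\<alpha> (fst z) (snd z))) \<le> c"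
proof -
  show "(\<lambda>z. F (fst z) (\<alpha> (fst z) (snd z))) \<in> borel_measurable (time_space T)"
    by (rule measurable_regime_coefficient) (use assms in \<open>auto simp: Linf_def\<close>)
  from Linf_uniform_bound[where F = F, OF assms]
  obtain c where "AE t in lborel. t \<in> {0..T} \<longrightarrow> (\<forall>i. F t i \<in> V \<and> norm (F t i) \<le> c)"
    by (elim exE conjE) (rule that)
  then have "AE z in time_space T. \<forall>i. F (fst z) i \<in> V \<and> norm (F (fst z) i) \<le> c"
    by (rule AE_time_space_deterministic)
  then have "AE z in time_space T. norm (F (fst z) (\<alpha> (fst z) (snd z))) \<le> c"
    by eventually_elim simp
  then show "\<exists>c. AE z in time_space T. norm (F (fst z) (\<alpha> (fst z) (snd z))) \<le> c" by blast
qed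

lemma square_integrable_coefficient:
  fixes F :: "real \<Rightarrow> 'd \<Rightarrow> real ^ 'k ^ 'l"
  assumes "\<And>i. (\<lambda>t. F t i) \<in> Linf T V" and f: "square_integrable (time_space T) f"
  shows "square_integrable (time_space T) (\<lambda>z. F (fst z) (\<alpha> (fst z) (snd z)) *v f z)"
proof -
  obtain c where "AE z in time_space T. norm (F (fst z) (\<alpha> (fst z) (snd z))) \<le> c"
    using bounded_coefficient(2)[where F = F, OF assms(1)] by blast
  then show ?thesis by (rule square_integrable_matrix_mult[OF f bounded_coefficient(1)[where F = F, OF assms(1)]])
qed

lemma integrable_coefficient_form:
  fixes F :: "real \<Rightarrow> 'd \<Rightarrow> real ^ 'k ^ 'l"
  assumes "\<And>i. (\<lambda>t. F t i) \<in> Linf T V" "square_integrable (time_space T) f" "square_integrable (time_space T) h"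
  shows "integrable (time_space T) (\<lambda>z. f z \<bullet> (F (fst z) (\<alpha> (fst z) (snd z)) *v h z))"
  by (intro integrable_inner_square_integrable assms square_integrable_coefficient[where F = F, OF assms(1)])

lemma integrable_terminal_form:
  fixes F :: "'d \<Rightarrow> real ^ 'n ^ 'n"
  assumes y: "square_integrable M y" and "0 \<le> t"
  shows "integrable M (\<lambda>\<omega>. y \<omega> \<bullet> (F (\<alpha> t \<omega>) *v y \<omega>))"
proof -
  have "norm (F i) \<le> (\<Sum>i\<in>UNIV. norm (F i))" for i by (rule member_le_sum) auto
  then show ?thesis
    using assms(2)
    by (intro integrable_inner_square_integrable y
        square_integrable_matrix_mult[OF y, where c = "\<Sum>i\<in>UNIV. norm (F i)"]
        measurable_compose[OF measurable_chain] AE_I2) auto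
qed

text \<open>The increments of \<open>K\<close> are given by \<open>\<Theta>\<close> at positive times only, so the weight that is continuous
  on all of \<open>[0,T]\<close> is anchored at the terminal value; this gives the matrix in the bound.  Adding the
  verification identity to twice the cost leaves a nonnegative running form, a nonnegative terminal
  form and the constant.\<close>

lemma cost_lower_bound:
  fixes A C Q K \<Theta> :: "real \<Rightarrow> 'd \<Rightarrow> real ^ 'n ^ 'n" and B D S :: "real \<Rightarrow> 'd \<Rightarrow> real ^ 'm ^ 'n"
    and R :: "real \<Rightarrow> 'd \<Rightarrow> real ^ 'm ^ 'm" and G :: "'d \<Rightarrow> real ^ 'n ^ 'n"
  assumes T: "T > 0"
    and A: "\<And>i. (\<lambda>t. A t i) \<in> Linf T UNIV" and B: "\<And>i. (\<lambda>t. B t i) \<in> Linf T UNIV"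
    and C: "\<And>i. (\<lambda>t. C t i) \<in> Linf T UNIV" and D: "\<And>i. (\<lambda>t. D t i) \<in> Linf T UNIV"
    and Q: "\<And>i. (\<lambda>t. Q t i) \<in> Linf T sym_mats" and S: "\<And>i. (\<lambda>t. S t i) \<in> Linf T UNIV"
    and R: "\<And>i. (\<lambda>t. R t i) \<in> Linf T sym_mats"
    and K: "\<And>i. (\<lambda>t. K t i) \<in> Linf T sym_mats" and \<Theta>: "\<And>i. (\<lambda>t. \<Theta> t i) \<in> Linf T sym_mats"
    and incr: "\<And>s t i. 0 < s \<Longrightarrow> s \<le> t \<Longrightarrow> t \<le> T \<Longrightarrow> K t i - K s i = (LINT r:{s<..t}|lborel. \<Theta> r i)"
    and block: "\<And>i. (\<lambda>t. block_mat (Q_comp \<pi> A C Q K \<Theta> t i) (S_comp B C D S K t i) (R_comp D R K t i)) \<in> Linf T psd_mats"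
    and terminal: "\<And>i. G i - K T i \<in> psd_mats"
    and u: "u \<in> L2_F M \<F> T V" and sol: "state_solution M W \<alpha> T A B C D \<xi> u x"
  shows "cost M \<alpha> T Q S R G x u \<ge> 1 / 2 * (\<xi> \<bullet> ((K T i\<^sub>0 - (LINT r:{0..T}|lborel. \<Theta> r i\<^sub>0)) *v \<xi>))"
proof -
  let ?N = "time_space T"
  obtain I where ito: "has_ito_integral M \<F> W T (\<lambda>t \<omega>. C t (\<alpha> t \<omega>) *v x t \<omega> + D t (\<alpha> t \<omega>) *v u t \<omega>) I"
    and dyn: "AE \<omega> in M. \<forall>t\<in>{0..T}.
       x t \<omega> = \<xi> + (LINT s:{0..t}|lborel. A s (\<alpha> s \<omega>) *v x s \<omega> + B s (\<alpha> s \<omega>) *v u s \<omega>) + I t \<omega>"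
    and x: "x \<in> L2_F M \<F> T UNIV"
    using sol unfolding state_solution_def by blast
  define a where "a t \<omega> = A t (\<alpha> t \<omega>) *v x t \<omega> + B t (\<alpha> t \<omega>) *v u t \<omega>" for t \<omega>
  define H where "H t \<omega> = C t (\<alpha> t \<omega>) *v x t \<omega> + D t (\<alpha> t \<omega>) *v u t \<omega>" for t \<omega>
  have x_sq: "square_integrable ?N (\<lambda>z. x (fst z) (snd z))"
    and u_sq: "square_integrable ?N (\<lambda>z. u (fst z) (snd z))"
    using square_integrable_L2_F[OF x] square_integrable_L2_F[OF u] T by auto
  have a_sq: "square_integrable ?N (\<lambda>z. a (fst z) (snd z))"
    unfolding a_def by (intro square_integrable_add 
        square_integrable_coefficient[where F = A, OF A x_sq] square_integrable_coefficient[where F = B, OF B u_sq])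
  obtain c where c: "0 \<le> c" "AE t in lborel. t \<in> {0..T} \<longrightarrow> (\<forall>i. \<Theta> t i \<in> sym_mats \<and> norm (\<Theta> t i) \<le> c)"
    using Linf_uniform_bound[where F = \<Theta>, OF \<Theta>] by (elim exE conjE) (rule that)
  define g where "g r i = indicator {0..T} r *\<^sub>R \<Theta> r i" for r i
  \<comment> \<open>A version of \<open>\<Theta>\<close> that is bounded and measurable on the whole real line; on \<open>[0,T]\<close> it
    differs from \<open>\<Theta>\<close> in a null set only.\<close>
  define \<theta> where "\<theta> r i = (if norm (g r i) \<le> c then g r i else 0)" for r i
  have gm: "(\<lambda>r. g r i) \<in> borel_measurable borel" for i
  proof -
    have "(\<lambda>t. \<Theta> t i) \<in> borel_measurable (restrict_space borel {0..T})" using \<Theta>[of i] by (simp add: Linf_def)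
    from iffD1[OF borel_measurable_restrict_space_iff this] show ?thesis unfolding g_def by simp
  qed
  have \<theta>m: "(\<lambda>r. \<theta> r i) \<in> borel_measurable borel" for i
    unfolding \<theta>_def using gm[of i] by measurable
  have \<theta>_AE: "AE t in lborel. t \<in> {0..T} \<longrightarrow> (\<forall>i. \<theta> t i = \<Theta> t i)"
    using c(2) by eventually_elim (simp add: \<theta>_def g_def)
  have \<theta>_int: "(LINT r:X|lborel. \<theta> r i) = (LINT r:X|lborel. \<Theta> r i)" if X: "X \<subseteq> {0..T}" "X \<in> sets borel" for X i
    unfolding set_lebesgue_integral_def
  proof (rule integral_cong_AE)
    have eq: "(\<lambda>r. indicator X r *\<^sub>R \<Theta> r i) = (\<lambda>r. indicator X r *\<^sub>R g r i)"
      using X(1) by (intro ext) (auto simp: g_def indicator_def)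
    show "(\<lambda>r. indicator X r *\<^sub>R \<theta> r i) \<in> borel_measurable lborel"
      using \<theta>m[of i] X(2) by simp
    show "(\<lambda>r. indicator X r *\<^sub>R \<Theta> r i) \<in> borel_measurable lborel"
      unfolding eq using gm[of i] X(2) by simp
    show "AE r in lborel. indicator X r *\<^sub>R \<theta> r i = indicator X r *\<^sub>R \<Theta> r i"
      using \<theta>_AE by eventually_elim (use X(1) in \<open>auto simp: indicator_def\<close>)
  qed
  define \<kappa> where "\<kappa> i = K T i - (LINT r:{0..T}|lborel. \<Theta> r i)" for i
  interpret V: weighted_ito_process M W \<alpha> \<pi> i\<^sub>0 T a x H I \<xi> \<kappa> \<theta> c
  proof
    show "x t \<in> borel_measurable (\<F> t)" if "t \<in> {0..T}" for t
      using x that by (intro progressive_adapted[of T]) (auto simp: L2_F_def)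
    show "has_ito_integral M \<F> W T H I" using ito unfolding H_def .
    show "AE \<omega> in M. \<forall>t\<in>{0..T}. x t \<omega> = \<xi> + (LINT s:{0..t}|lborel. a s \<omega>) + I t \<omega>"
      using dyn unfolding a_def .
    show "norm (\<theta> t i) \<le> c" for t i using c(1) by (simp add: \<theta>_def)
  qed (use T a_sq x_sq \<theta>m in auto)
  have kT: "V.k T i = K T i" for i
    using \<theta>_int[of "{0..T}" i] by (simp add: V.k_def \<kappa>_def)
  have k_eq: "V.k t i = K t i" if "0 < t" "t \<le> T" for t i
    using V.k_increment[of t T i] kT[of i] incr[of t T i] \<theta>_int[of "{t<..T}" i] that
    by (simp add: algebra_simps subset_iff)
  define x' u' a' H' where "x' z = x (fst z) (snd z)" and "u' z = u (fst z) (snd z)"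
    and "a' z = a (fst z) (snd z)" and "H' z = H (fst z) (snd z)" for z
  define r where "r z = \<alpha> (fst z) (snd z)" for z
  define k' where "k' z = V.k (fst z) (r z)" for z
  define \<Psi> where "\<Psi> z = \<theta> (fst z) (r z) + (\<Sum>j\<in>UNIV. \<pi> (r z) j *\<^sub>R V.k (fst z) j)" for z
  define q where "q z = stack (x' z) (u' z) \<bullet> (block_mat (Q (fst z) (r z)) (S (fst z) (r z)) (R (fst z) (r z)) *v stack (x' z) (u' z))" for z
  have sq: "square_integrable ?N x'" "square_integrable ?N u'" "square_integrable ?N a'" "square_integrable ?N H'"
    using x_sq u_sq a_sq V.H_sq unfolding x'_def[abs_def] u'_def[abs_def] a'_def[abs_def] H'_def[abs_def] by auto
  have q_int: "integrable ?N q"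
    unfolding q_def[abs_def] block_mat_form r_def
    by (intro Bochner_Integration.integrable_add integrable_mult_right
        integrable_coefficient_form[where F = Q, OF Q] integrable_coefficient_form[where F = S, OF S]
        integrable_coefficient_form[where F = R, OF R] sq)
  have k'm: "k' \<in> borel_measurable ?N" unfolding k'_def[abs_def] r_def by (rule V.measurable_k_time)
  have k'b: "AE z in ?N. norm (k' z) \<le> V.k_bound" unfolding k'_def by (intro AE_I2 V.k_bounded) auto
  have form: "integrable ?N (\<lambda>z. f z \<bullet> (k' z *v h z))" if "square_integrable ?N f" "square_integrable ?N h" for f h
    by (intro integrable_inner_square_integrable that square_integrable_matrix_mult[OF that(2) k'm k'b])
  have \<Psi>_int: "integrable ?N (\<lambda>z. x' z \<bullet> (\<Psi> z *v x' z))"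
  proof -
    have kj: "(\<lambda>z. V.k (fst z) j) \<in> borel_measurable ?N" for j
      by (rule measurable_compose[OF measurable_time_fst_restrict
          borel_measurable_continuous_on_restrict[OF V.k_continuous]])
    have "(\<lambda>z. \<theta> (fst z) (r z)) \<in> borel_measurable ?N"
      unfolding r_def using \<theta>m by (intro measurable_regime_coefficient measurable_restrict_space1)
    then have m: "\<Psi> \<in> borel_measurable ?N"
      unfolding \<Psi>_def[abs_def] r_def
      by (intro borel_measurable_add borel_measurable_sum borel_measurable_scaleR kj
          measurable_compose[OF measurable_chain_time]) auto
    have "norm (\<Psi> z) \<le> c + (\<Sum>i\<in>UNIV. \<Sum>j\<in>UNIV. \<bar>\<pi> i j\<bar> * V.k_bound)" if "z \<in> space ?N" for z
    proof -
      have "norm (\<Sum>j\<in>UNIV. \<pi> (r z) j *\<^sub>R V.k (fst z) j) \<le> (\<Sum>j\<in>UNIV. \<bar>\<pi> (r z) j\<bar> * V.k_bound)"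
        using V.k_bounded[of "fst z"] that by (intro sum_norm_le) (auto intro: mult_left_mono)
      also have "\<dots> \<le> (\<Sum>i\<in>UNIV. \<Sum>j\<in>UNIV. \<bar>\<pi> i j\<bar> * V.k_bound)"
        using V.k_bound_nonneg
        by (intro member_le_sum[where f = "\<lambda>i. \<Sum>j\<in>UNIV. \<bar>\<pi> i j\<bar> * V.k_bound"]) (auto intro!: sum_nonneg)
      finally show ?thesis unfolding \<Psi>_def using V.\<theta>_bound by (intro norm_triangle_le add_mono)
    qed
    then show ?thesis
      by (intro integrable_inner_square_integrable sq square_integrable_matrix_mult[OF sq(1) m AE_I2])
  qed
  have xT: "square_integrable M (x T)" using T by (intro V.square_integrable_state) auto
  have run_int: "integrable M (\<lambda>\<omega>. LINT t:{0..T}|lborel. stack (x t \<omega>) (u t \<omega>) \<bullet>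
        (block_mat (Q t (\<alpha> t \<omega>)) (S t (\<alpha> t \<omega>)) (R t (\<alpha> t \<omega>)) *v stack (x t \<omega>) (u t \<omega>)))"
    and run: "expectation (\<lambda>\<omega>. LINT t:{0..T}|lborel. stack (x t \<omega>) (u t \<omega>) \<bullet>
        (block_mat (Q t (\<alpha> t \<omega>)) (S t (\<alpha> t \<omega>)) (R t (\<alpha> t \<omega>)) *v stack (x t \<omega>) (u t \<omega>))) = (\<integral>z. q z \<partial>?N)"
    using integral_time_space(1,2)[of T "\<lambda>t \<omega>. stack (x t \<omega>) (u t \<omega>) \<bullet>
        (block_mat (Q t (\<alpha> t \<omega>)) (S t (\<alpha> t \<omega>)) (R t (\<alpha> t \<omega>)) *v stack (x t \<omega>) (u t \<omega>))"] q_int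
    unfolding q_def[abs_def] x'_def u'_def r_def by auto
  have "2 * cost M \<alpha> T Q S R G x u = (\<integral>z. q z \<partial>?N) + expectation (\<lambda>\<omega>. x T \<omega> \<bullet> (G (\<alpha> T \<omega>) *v x T \<omega>))"
    unfolding cost_def run[symmetric]
    using run_int integrable_terminal_form[OF xT less_imp_le[OF T], of G] by simp
  moreover have "expectation (\<lambda>\<omega>. x T \<omega> \<bullet> (G (\<alpha> T \<omega>) *v x T \<omega>))
    \<ge> expectation (\<lambda>\<omega>. x T \<omega> \<bullet> (V.k T (\<alpha> T \<omega>) *v x T \<omega>))"
  proof (rule integral_mono)
    fix \<omega>
    have "0 \<le> x T \<omega> \<bullet> ((G (\<alpha> T \<omega>) - K T (\<alpha> T \<omega>)) *v x T \<omega>)"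
      using terminal[of "\<alpha> T \<omega>"] by (simp add: psd_mats_def)
    then show "x T \<omega> \<bullet> (V.k T (\<alpha> T \<omega>) *v x T \<omega>) \<le> x T \<omega> \<bullet> (G (\<alpha> T \<omega>) *v x T \<omega>)"
      by (simp add: kT matrix_vector_mult_diff_rdistrib inner_diff_right)
  qed (intro integrable_terminal_form[OF xT less_imp_le[OF T]])+
  ultimately have lower: "(\<integral>z. q z \<partial>?N) + expectation (\<lambda>\<omega>. x T \<omega> \<bullet> (V.k T (\<alpha> T \<omega>) *v x T \<omega>)) \<le> 2 * cost M \<alpha> T Q S R G x u"
    by simp
  have "0 \<le> (\<integral>z. q z + x' z \<bullet> (k' z *v a' z) + a' z \<bullet> (k' z *v x' z) + H' z \<bullet> (k' z *v H' z) + x' z \<bullet> (\<Psi> z *v x' z) \<partial>?N)"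
  proof (rule integral_nonneg_AE)
    obtain cK where cK: "AE t in lborel. t \<in> {0..T} \<longrightarrow> (\<forall>i. K t i \<in> sym_mats \<and> norm (K t i) \<le> cK)"
      using Linf_uniform_bound[where F = K, OF K] by (elim exE conjE) (rule that)
    obtain cB where cB: "AE t in lborel. t \<in> {0..T} \<longrightarrow> (\<forall>i. block_mat (Q_comp \<pi> A C Q K \<Theta> t i) (S_comp B C D S K t i) (R_comp D R K t i) \<in> psd_mats
        \<and> norm (block_mat (Q_comp \<pi> A C Q K \<Theta> t i) (S_comp B C D S K t i) (R_comp D R K t i)) \<le> cB)"
      using Linf_uniform_bound[where F = "\<lambda>t i. block_mat (Q_comp \<pi> A C Q K \<Theta> t i) (S_comp B C D S K t i) (R_comp D R K t i)", OF block] by (elim exE conjE) (rule that)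
    have gen: "generator_matrix \<pi>" using chain by (simp add: markov_chain_def)
    show "AE z in ?N. 0 \<le> q z + x' z \<bullet> (k' z *v a' z) + a' z \<bullet> (k' z *v x' z) + H' z \<bullet> (k' z *v H' z) + x' z \<bullet> (\<Psi> z *v x' z)"
      using AE_time_space_deterministic[OF cK] AE_time_space_deterministic[OF cB]
        AE_time_space_deterministic[OF \<theta>_AE] V.AE_time_pos AE_space
    proof eventually_elim
      case (elim z)
      have k: "V.k (fst z) i = K (fst z) i" for i using elim by (intro k_eq) auto
      have "0 \<le> stack (x' z) (u' z) \<bullet> (block_mat (Q_comp \<pi> A C Q K \<Theta> (fst z) (r z)) (S_comp B C D S K (fst z) (r z)) (R_comp D R K (fst z) (r z)) *v stack (x' z) (u' z))"
        using elim(2) by (simp add: psd_mats_def)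
      also have "\<dots> = q z + x' z \<bullet> (k' z *v a' z) + a' z \<bullet> (k' z *v x' z) + H' z \<bullet> (k' z *v H' z) + x' z \<bullet> (\<Psi> z *v x' z)"
        using elim(1,3) unfolding q_def k'_def \<Psi>_def k
        by (subst compensated_form[OF gen]) (simp_all add: a'_def H'_def a_def H_def x'_def u'_def r_def)
      finally show ?case .
    qed
  qed
  also have "\<dots> = (\<integral>z. q z \<partial>?N) + (\<integral>z. x' z \<bullet> (k' z *v a' z) \<partial>?N) + (\<integral>z. a' z \<bullet> (k' z *v x' z) \<partial>?N)
     + (\<integral>z. H' z \<bullet> (k' z *v H' z) \<partial>?N) + (\<integral>z. x' z \<bullet> (\<Psi> z *v x' z) \<partial>?N)"
    using q_int form[OF sq(1,3)] form[OF sq(3,1)] form[OF sq(4,4)] \<Psi>_int by simp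
  also have "\<dots> = (\<integral>z. q z \<partial>?N) + (expectation (\<lambda>\<omega>. x T \<omega> \<bullet> (V.k T (\<alpha> T \<omega>) *v x T \<omega>)) - \<xi> \<bullet> (\<kappa> i\<^sub>0 *v \<xi>))"
    using V.verification_identity unfolding x'_def a'_def H'_def k'_def \<Psi>_def r_def by simp
  finally show ?thesis using lower by (simp add: \<kappa>_def)
qed

end

theorem theorem2p1:
  fixes M :: "'d::finite \<Rightarrow> 'w measure"
    and W :: "'d \<Rightarrow> real \<Rightarrow> 'w \<Rightarrow> real"
    and \<alpha> :: "'d \<Rightarrow> real \<Rightarrow> 'w \<Rightarrow> 'd"
    and \<pi> :: "'d \<Rightarrow> 'd \<Rightarrow> real"
    and T :: real
    and A C Q :: "real \<Rightarrow> 'd \<Rightarrow> real ^ 'n ^ 'n"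
    and B D S :: "real \<Rightarrow> 'd \<Rightarrow> real ^ 'm ^ 'n"
    and R :: "real \<Rightarrow> 'd \<Rightarrow> real ^ 'm ^ 'm"
    and G :: "'d \<Rightarrow> real ^ 'n ^ 'n"
    and j\<^sub>0 :: 'd
  assumes "T > 0"
    and "\<And>i. regime_switching_space (M i) (W i) (\<alpha> i) \<pi> i"
    and "\<And>i. (\<lambda>t. A t i) \<in> Linf T UNIV" and "\<And>i. (\<lambda>t. B t i) \<in> Linf T UNIV"
    and "\<And>i. (\<lambda>t. C t i) \<in> Linf T UNIV" and "\<And>i. (\<lambda>t. D t i) \<in> Linf T UNIV"
    and "\<And>i. (\<lambda>t. Q t i) \<in> Linf T sym_mats" and "\<And>i. (\<lambda>t. S t i) \<in> Linf T UNIV"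
    and "\<And>i. (\<lambda>t. R t i) \<in> Linf T sym_mats" and "\<And>i. G i \<in> sym_mats"
    and "\<exists>K. relaxed_compensator (M j\<^sub>0) (W j\<^sub>0) (\<alpha> j\<^sub>0) \<pi> j\<^sub>0 T A B C D Q S R G K"
  shows "\<forall>\<xi> i\<^sub>0. \<forall>U \<in> {U_ad (M i\<^sub>0) (W i\<^sub>0) (\<alpha> i\<^sub>0) T, Uc_ad (M i\<^sub>0) (W i\<^sub>0) (\<alpha> i\<^sub>0) T}.
    slq_value (M i\<^sub>0) (W i\<^sub>0) (\<alpha> i\<^sub>0) T A B C D Q S R G U \<xi> > -\<infinity>"
proof (intro allI ballI)
  fix \<xi> :: "real ^ 'n" and i\<^sub>0 and U :: "(real \<Rightarrow> 'w \<Rightarrow> real ^ 'm) set"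
  assume U: "U \<in> {U_ad (M i\<^sub>0) (W i\<^sub>0) (\<alpha> i\<^sub>0) T, Uc_ad (M i\<^sub>0) (W i\<^sub>0) (\<alpha> i\<^sub>0) T}"
  obtain K \<Theta> where ups: "Upsilon (M j\<^sub>0) (W j\<^sub>0) (\<alpha> j\<^sub>0) \<pi> j\<^sub>0 T K \<Theta>"
    and block: "\<And>i. (\<lambda>t. block_mat (Q_comp \<pi> A C Q K \<Theta> t i) (S_comp B C D S K t i) (R_comp D R K t i)) \<in> Linf T psd_mats"
    and terminal: "\<And>i. G i - K T i \<in> psd_mats"
    using assms(11) unfolding relaxed_compensator_def by blast
  have K: "\<And>i. (\<lambda>t. K t i) \<in> Linf T sym_mats" and \<Theta>: "\<And>i. (\<lambda>t. \<Theta> t i) \<in> Linf T sym_mats"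
    using ups by (auto simp: Upsilon_def)
  note incr = regime_switching_space.compensator_increment[OF assms(2)[of j\<^sub>0] ups]
  define b where "b = 1 / 2 * (\<xi> \<bullet> ((K T i\<^sub>0 - (LINT r:{0..T}|lborel. \<Theta> r i\<^sub>0)) *v \<xi>))"
  have "ereal b \<le> slq_value (M i\<^sub>0) (W i\<^sub>0) (\<alpha> i\<^sub>0) T A B C D Q S R G U \<xi>"
    unfolding slq_value_def
  proof (rule Inf_greatest)
    fix v assume "v \<in> {ereal (cost (M i\<^sub>0) (\<alpha> i\<^sub>0) T Q S R G x u) |x u.
        u \<in> U \<and> state_solution (M i\<^sub>0) (W i\<^sub>0) (\<alpha> i\<^sub>0) T A B C D \<xi> u x}"
    then obtain x u where v: "v = ereal (cost (M i\<^sub>0) (\<alpha> i\<^sub>0) T Q S R G x u)" and uU: "u \<in> U"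
      and sol: "state_solution (M i\<^sub>0) (W i\<^sub>0) (\<alpha> i\<^sub>0) T A B C D \<xi> u x" by blast
    have "\<exists>V. u \<in> L2_F (M i\<^sub>0) (filtr (M i\<^sub>0) (W i\<^sub>0) (\<alpha> i\<^sub>0)) T V"
      using U uU unfolding U_ad_def Uc_ad_def by blast
    then obtain V where u: "u \<in> L2_F (M i\<^sub>0) (filtr (M i\<^sub>0) (W i\<^sub>0) (\<alpha> i\<^sub>0)) T V" ..
    show "ereal b \<le> v"
      unfolding v b_def ereal_less_eq
      by (rule regime_switching_space.cost_lower_bound[OF assms(2)[of i\<^sub>0] assms(1) assms(3-9) K \<Theta> incr block terminal u sol])
  qed
  then show "slq_value (M i\<^sub>0) (W i\<^sub>0) (\<alpha> i\<^sub>0) T A B C D Q S R G U \<xi> > -\<infinity>"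
    by (rule order_less_le_trans[rotated]) simp
qed

end
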